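(* Let $\Omega\subset\mathbb{R}^N$ be a bounded $C^1$-domain, let $\mathcal{I}(u,x)=\int_{\mathbb{R}^N}[u(x+z)-u(x)]\,\nu_x(dz)$ satisfy assumptions (M0), (M1), (M2), (M3) of the context with the same $\sigma\in(0,1)$, and let $H_0\in C(\bar\Omega\times\mathbb{R}^N)$ satisfy (H2) of the context with $m>1$. Then there exists a unique constant $c\in\mathbb{R}$ for which the state-constraint problem $$-\mathcal{I}(u)+H_0(x,Du)=c\ \text{in }\Omega,\qquad-\mathcal{I}(u)+H_0(x,Du)\ge c\ \text{on }\partial\Omega$$ has a viscosity solution in $C(\bar\Omega)$, which is Lipschitz continuous on $\bar\Omega$.
   Context: Notation: $d(x)=\mathrm{dist}(x,\partial\Omega)$, $B_r(x)$ is the open ball, $B_r=B_r(0)$, $B_r^c$ its complement. "$C^1$-domain" means that the boundary is $C^1$, with the convention that there is $\delta_0>0$ such that $d$ is of class $C^1$ in $\{x\in\Omega:d(x)<\delta_0\}$. For each $x\in\bar\Omega$, $\nu_x$ is a nonnegative regular measure on $\mathbb{R}^N$. For $D\subset\mathbb{R}^N$, $\mathcal{I}[D](u,y)=\int_D[u(y+z)-u(y)]\nu_y(dz)$. (M0): (M0-1) $\bigcup_{x\in\bar\Omega}\{x+\mathrm{supp}\,\nu_x\}\subseteq\bar\Omega$. (M0-2) if $x\in\bar\Omega$, $r>0$ and $u\in L^\infty(\bar\Omega)$ is $C^1$ in $B_r(x)$ (i.e. in $B_r(x)\cap\bar\Omega$), then $\mathcal{I}(u,x)$ is well defined, and for any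 $D\subset\mathbb{R}^N$ the map $y\mapsto\mathcal{I}[D](u,y)$ is continuous in $B_r(x)$ (i.e. in $B_r(x)\cap\bar\Omega$). (M1): there is $C_1>0$ such that for all $\beta\in[0,2]$ and $\delta>0$, $\sup_{x\in\bar\Omega}\int_{B_\delta^c}\min\{1,|z|^\beta\}\nu_x(dz)\le C_1h_{\beta,\sigma}(\delta)$, where $h_{\beta,\sigma}(\delta)=\delta^{\beta-\sigma}$ if $\beta<\sigma$, $=|\ln\delta|+1$ if $\beta=\sigma$, $=1$ if $\beta>\sigma$ (convention $|z|^0=1$). (M2): there is $C_2>0$ such that for all $\beta\in(\sigma,2]$ and $\delta\in(0,1)$, $\sup_{x\in\bar\Omega}\int_{B_\delta}|z|^\beta\nu_x(dz)\le C_2\delta^{\beta-\sigma}$. (M3): for each $\beta>0$ there is a modulus of continuity $\omega_{\beta,\sigma}$ such that for all $x,y\in\bar\Omega$, $\delta>0$, $\int_{B_\delta^c}|z|^\beta|\nu_x(dz)-\nu_y(dz)|\le(1+h_{\beta,\sigma}(\delta))\,\omega_{\beta,\sigma}(|x-y|)$, where $|\nu_x-\nu_y|$ is the total variation measure. (H2) for $H_0$ (with exponent $m$): there are $\underline c>0$, $C\ge0$ with $H_0(x,p)\ge\underline c|p|^m-C$ for all $x\in\bar\Omega$, $p\in\mathbb{R}^N$. Viscosity solution of the state-constraint problem: $u$ is a viscosity subsolution of the equation in $\Omega$ and a viscosity supersolution of the equation on $\bar\Omega$; that is, for $\phi\in C^1(\bar\Omega)$ and all $\delta>0$, $-\mathcal{I}[B_\delta](\phi,x_0)-\mathcal{I}[B_\delta^c](u,x_0)+H_0(x_0,D\phi(x_0))\le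 c$ at each maximum point $x_0\in\Omega$ of $u-\phi$ on $\bar\Omega$, and $\ge c$ at each minimum point $x_0\in\bar\Omega$ of $u-\phi$ on $\bar\Omega$. *)

theory Defs
  imports "HOL-Analysis.Analysis"
begin

section \<open>Functions of class \<open>C\<^sup>1\<close> and \<open>C\<^sup>1\<close>-domains\<close>

text \<open>
  \<open>f\<close> is of class \<open>C\<^sup>1\<close> on \<open>S\<close> with gradient \<open>G\<close>.  The derivative is taken within \<open>S\<close>, so that
  for \<open>S = closure \<Omega>\<close> or \<open>S = ball x r \<inter> closure \<Omega>\<close> this means \<open>C\<^sup>1\<close> up to the boundary; for a
  \<open>C\<^sup>1\<close>-domain \<open>\<Omega>\<close> the gradient is then uniquely determined by \<open>f\<close> at every point of \<open>S\<close>.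
\<close>

definition C1_with_gradient_on ::
    "'a::euclidean_space set \<Rightarrow> ('a \<Rightarrow> real) \<Rightarrow> ('a \<Rightarrow> 'a) \<Rightarrow> bool" where
  "C1_with_gradient_on S f G \<longleftrightarrow>
     continuous_on S G \<and>
     (\<forall>x\<in>S. (f has_derivative (\<lambda>h. G x \<bullet> h)) (at x within S))"

definition C1_on :: "'a::euclidean_space set \<Rightarrow> ('a \<Rightarrow> real) \<Rightarrow> bool" where
  "C1_on S f \<longleftrightarrow> (\<exists>G. C1_with_gradient_on S f G)"

text \<open>
  Near each boundary point \<open>\<Omega>\<close> is the part above the graph of a \<open>C\<^sup>1\<close> function over the hyperplane
  orthogonal to a unit vector \<open>e\<close>; \<open>x - (x \<bullet> e) *\<^sub>R e\<close> is the projection of \<open>x\<close> to that hyperplane.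
\<close>

definition C1_boundary :: "'a::euclidean_space set \<Rightarrow> bool" where
  "C1_boundary \<Omega> \<longleftrightarrow>
     (\<forall>p\<in>frontier \<Omega>. \<exists>r>0. \<exists>e \<gamma>. norm e = 1 \<and> C1_on UNIV \<gamma> \<and>
        \<Omega> \<inter> ball p r = {x \<in> ball p r. \<gamma> (x - (x \<bullet> e) *\<^sub>R e) < x \<bullet> e})"

definition C1_domain :: "'a::euclidean_space set \<Rightarrow> bool" where
  "C1_domain \<Omega> \<longleftrightarrow>
     open \<Omega> \<and> connected \<Omega> \<and> \<Omega> \<noteq> {} \<and> C1_boundary \<Omega> \<and>
     (\<exists>\<delta>\<^sub>0>0. C1_on {x \<in> \<Omega>. infdist x (frontier \<Omega>) < \<delta>\<^sub>0} (\<lambda>x. infdist x (frontier \<Omega>)))"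

section \<open>The jump measures and the nonlocal operator\<close>

text \<open>
  Jump measures may have infinite mass in every neighbourhood of \<open>0\<close>, where outer regularity
  necessarily fails (already for \<open>{0}\<close>); it is therefore required away from \<open>0\<close> only.
\<close>

definition regular_jump_measure :: "'a::euclidean_space measure \<Rightarrow> bool" where
  "regular_jump_measure \<mu> \<longleftrightarrow>
     sets \<mu> = sets borel \<and>
     (\<forall>A\<in>sets borel. emeasure \<mu> A = (SUP K\<in>{K. compact K \<and> K \<subseteq> A}. emeasure \<mu> K)) \<and>
     (\<forall>A\<in>sets borel. 0 \<notin> closure A \<longrightarrow>
        emeasure \<mu> A = (INF U\<in>{U. open U \<and> A \<subseteq> U}. emeasure \<mu> U))"

definition measure_support :: "'a::euclidean_space measure \<Rightarrow> 'a set" where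
  "measure_support \<mu> = {z. \<forall>U. open U \<and> z \<in> U \<longrightarrow> emeasure \<mu> U > 0}"

text \<open>
  Functions are meaningful on \<open>closure \<Omega>\<close> only.  Restricting the integral to the \<open>z\<close> with
  \<open>y + z \<in> closure \<Omega>\<close> makes the operator independent of the values (and of the measurability) of
  \<open>u\<close> elsewhere.  It removes only a null set as soon as \<open>y + measure_support (\<nu> y)\<close> is contained
  in \<open>closure \<Omega>\<close>.
\<close>

definition nonlocal_op ::
    "'a::euclidean_space set \<Rightarrow> ('a \<Rightarrow> 'a measure) \<Rightarrow> 'a set \<Rightarrow> ('a \<Rightarrow> real) \<Rightarrow> 'a \<Rightarrow> real" where
  "nonlocal_op \<Omega> \<nu> D u y =
     (LINT z:{z \<in> D. y + z \<in> closure \<Omega>}|\<nu> y. u (y + z) - u y)"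

text \<open>
  The total variation measure of the signed measure \<open>M - N\<close>, for finite measures \<open>M\<close> and \<open>N\<close> on
  the same \<open>\<sigma>\<close>-algebra.
\<close>

definition total_variation_diff :: "'a measure \<Rightarrow> 'a measure \<Rightarrow> 'a measure" where
  "total_variation_diff M N =
     measure_of (space M) (sets M)
       (\<lambda>A. SUP E\<in>{E :: nat \<Rightarrow> 'a set. range E \<subseteq> sets M \<and> disjoint_family E \<and> (\<Union>i. E i) = A}.
              \<Sum>i. ennreal \<bar>measure M (E i) - measure N (E i)\<bar>)"

section \<open>Structural assumptions\<close>

definition h_fun :: "real \<Rightarrow> real \<Rightarrow> real \<Rightarrow> real" where
  "h_fun \<beta> \<sigma> \<delta> =
     (if \<beta> < \<sigma> then \<delta> powr (\<beta> - \<sigma>) else if \<beta> = \<sigma> then \<bar>ln \<delta>\<bar> + 1 else 1)"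

definition modulus_of_continuity :: "(real \<Rightarrow> real) \<Rightarrow> bool" where
  "modulus_of_continuity \<omega> \<longleftrightarrow>
     \<omega> 0 = 0 \<and> mono_on {0..} \<omega> \<and> (\<omega> \<longlongrightarrow> 0) (at_right 0)"

definition cond_M0 :: "'a::euclidean_space set \<Rightarrow> ('a \<Rightarrow> 'a measure) \<Rightarrow> bool" where
  "cond_M0 \<Omega> \<nu> \<longleftrightarrow>
     (\<forall>x\<in>closure \<Omega>. \<forall>z\<in>measure_support (\<nu> x). x + z \<in> closure \<Omega>) \<and>
     (\<forall>x\<in>closure \<Omega>. \<forall>r>0. \<forall>u.
        u \<in> borel_measurable (restrict_space borel (closure \<Omega>)) \<and> bounded (u ` closure \<Omega>) \<and>
        C1_on (ball x r \<inter> closure \<Omega>) u \<longrightarrow>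
          set_integrable (\<nu> x) {z. x + z \<in> closure \<Omega>} (\<lambda>z. u (x + z) - u x) \<and>
          (\<forall>D\<in>sets borel. continuous_on (ball x r \<inter> closure \<Omega>) (nonlocal_op \<Omega> \<nu> D u)))"

text \<open>
  The convention \<open>|z|\<^sup>0 = 1\<close> is respected by \<open>powr\<close>, since \<open>z \<noteq> 0\<close> outside \<open>ball 0 \<delta>\<close>.
\<close>

definition cond_M1 :: "'a::euclidean_space set \<Rightarrow> ('a \<Rightarrow> 'a measure) \<Rightarrow> real \<Rightarrow> bool" where
  "cond_M1 \<Omega> \<nu> \<sigma> \<longleftrightarrow>
     (\<exists>C\<^sub>1>0. \<forall>\<beta>\<in>{0..2}. \<forall>\<delta>>0.
        (SUP x\<in>closure \<Omega>. \<integral>\<^sup>+z\<in>- ball 0 \<delta>. ennreal (min 1 (norm z powr \<beta>)) \<partial>\<nu> x)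
          \<le> ennreal (C\<^sub>1 * h_fun \<beta> \<sigma> \<delta>))"

definition cond_M2 :: "'a::euclidean_space set \<Rightarrow> ('a \<Rightarrow> 'a measure) \<Rightarrow> real \<Rightarrow> bool" where
  "cond_M2 \<Omega> \<nu> \<sigma> \<longleftrightarrow>
     (\<exists>C\<^sub>2>0. \<forall>\<beta>\<in>{\<sigma><..2}. \<forall>\<delta>\<in>{0<..<1}.
        (SUP x\<in>closure \<Omega>. \<integral>\<^sup>+z\<in>ball 0 \<delta>. ennreal (norm z powr \<beta>) \<partial>\<nu> x)
          \<le> ennreal (C\<^sub>2 * \<delta> powr (\<beta> - \<sigma>)))"

text \<open>
  The restrictions of the \<open>\<nu> x\<close> to the complement of \<open>ball 0 \<delta>\<close> are finite measures by
  \<open>cond_M1\<close> (with \<open>\<beta> = 0\<close>).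
\<close>

definition cond_M3 :: "'a::euclidean_space set \<Rightarrow> ('a \<Rightarrow> 'a measure) \<Rightarrow> real \<Rightarrow> bool" where
  "cond_M3 \<Omega> \<nu> \<sigma> \<longleftrightarrow>
     (\<forall>\<beta>>0. \<exists>\<omega>. modulus_of_continuity \<omega> \<and>
        (\<forall>x\<in>closure \<Omega>. \<forall>y\<in>closure \<Omega>. \<forall>\<delta>>0.
           (\<integral>\<^sup>+z. ennreal (norm z powr \<beta>)
              \<partial>total_variation_diff (restrict_space (\<nu> x) (- ball 0 \<delta>))
                                    (restrict_space (\<nu> y) (- ball 0 \<delta>)))
             \<le> ennreal ((1 + h_fun \<beta> \<sigma> \<delta>) * \<omega> (norm (x - y)))))"

definition cond_H2 :: "'a::euclidean_space set \<Rightarrow> ('a \<Rightarrow> 'a \<Rightarrow> real) \<Rightarrow> real \<Rightarrow> bool" where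
  "cond_H2 \<Omega> H m \<longleftrightarrow>
     (\<exists>c>0. \<exists>C\<ge>0. \<forall>x\<in>closure \<Omega>. \<forall>p. H x p \<ge> c * norm p powr m - C)"

section \<open>Viscosity solutions of the state-constraint problem\<close>

definition viscosity_subsolution ::
    "'a::euclidean_space set \<Rightarrow> ('a \<Rightarrow> 'a measure) \<Rightarrow> ('a \<Rightarrow> 'a \<Rightarrow> real) \<Rightarrow> real \<Rightarrow> ('a \<Rightarrow> real) \<Rightarrow> bool"
  where
  "viscosity_subsolution \<Omega> \<nu> H c u \<longleftrightarrow>
     (\<forall>\<phi> D\<phi>. C1_with_gradient_on (closure \<Omega>) \<phi> D\<phi> \<longrightarrow>
        (\<forall>\<delta>>0. \<forall>x\<^sub>0\<in>\<Omega>. (\<forall>y\<in>closure \<Omega>. u y - \<phi> y \<le> u x\<^sub>0 - \<phi> x\<^sub>0) \<longrightarrow>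
           - nonlocal_op \<Omega> \<nu> (ball 0 \<delta>) \<phi> x\<^sub>0 - nonlocal_op \<Omega> \<nu> (- ball 0 \<delta>) u x\<^sub>0
             + H x\<^sub>0 (D\<phi> x\<^sub>0) \<le> c))"

definition viscosity_supersolution ::
    "'a::euclidean_space set \<Rightarrow> ('a \<Rightarrow> 'a measure) \<Rightarrow> ('a \<Rightarrow> 'a \<Rightarrow> real) \<Rightarrow> real \<Rightarrow> ('a \<Rightarrow> real) \<Rightarrow> bool"
  where
  "viscosity_supersolution \<Omega> \<nu> H c u \<longleftrightarrow>
     (\<forall>\<phi> D\<phi>. C1_with_gradient_on (closure \<Omega>) \<phi> D\<phi> \<longrightarrow>
        (\<forall>\<delta>>0. \<forall>x\<^sub>0\<in>closure \<Omega>. (\<forall>y\<in>closure \<Omega>. u y - \<phi> y \<ge> u x\<^sub>0 - \<phi> x\<^sub>0) \<longrightarrow>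
           - nonlocal_op \<Omega> \<nu> (ball 0 \<delta>) \<phi> x\<^sub>0 - nonlocal_op \<Omega> \<nu> (- ball 0 \<delta>) u x\<^sub>0
             + H x\<^sub>0 (D\<phi> x\<^sub>0) \<ge> c))"

definition state_constraint_solution ::
    "'a::euclidean_space set \<Rightarrow> ('a \<Rightarrow> 'a measure) \<Rightarrow> ('a \<Rightarrow> 'a \<Rightarrow> real) \<Rightarrow> real \<Rightarrow> ('a \<Rightarrow> real) \<Rightarrow> bool"
  where
  "state_constraint_solution \<Omega> \<nu> H c u \<longleftrightarrow>
     continuous_on (closure \<Omega>) u \<and>
     viscosity_subsolution \<Omega> \<nu> H c u \<and> viscosity_supersolution \<Omega> \<nu> H c u"

end

theory Submission
  imports Defs "HOL-Complex_Analysis.Great_Picard"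
begin

text \<open>
  A continuous subsolution is Lipschitz up to the boundary. Touching it from above by cones
  with vertex at depth \<open>r\<close>, coercivity bounds its slope there by a multiple of
  \<open>r powr (- (\<sigma> - \<gamma>) / m)\<close> when it is already \<open>\<gamma>\<close>-Hoelder; since \<open>m > 1\<close>, integrating this along
  paths that approach the boundary transversally improves the exponent by a fixed amount, until
  \<open>\<gamma> > \<sigma>\<close> and the slope is bounded. The same estimate applied to a function that is already
  Lipschitz gives a constant independent of its oscillation.

  Perron's method solves the problem with an additional term \<open>\<kappa> u\<close>, and the uniform Lipschitz
  bound lets \<open>\<kappa>\<close> tend to \<open>0\<close>. For uniqueness of the constant, a Lipschitz subsolution is compared
  with a supersolution by doubling the variables; the penalisation is shifted so that the
  subsolution is tested inside \<open>\<Omega>\<close>. For a continuous function the nonlocal term away from the origin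
  is continuous in the base point, by (M0) and uniform approximation with \<open>C\<^sup>1\<close> functions.
\<close>

text \<open>Since \<sigma> < 1, the measures integrate \<open>norm z\<close> near the origin. Near
  jumps are therefore controlled by slopes of test functions alone, with an error of order
  \<open>\<delta> powr (1 - \<sigma>)\<close>.

  Two Lipschitz estimates are needed because far jumps see the oscillation of \<open>u\<close>, and
  for the discounted problem this is at first bounded only by a multiple of
  \<open>1 / \<kappa>\<close>. The first estimate starts from a sup bound and makes the Perron class
  equi-Lipschitz for fixed \<kappa>. In the second the old slope enters linearly and the Hamiltonian
  superlinearly, so large slopes can be halved; its constant survives the limit. The bootstrap must
  step over the exponent \<sigma> itself, where (M1) has a logarithm.

  In the comparison no zeroth-order term provides strictness. The two constants are ordered because,
  at a maximum of the difference of the two functions, the far jumps of the subsolution are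
  dominated by those of the supersolution, while the Hamiltonians cancel in the limit.\<close>

section \<open>Domains with the uniform cone property\<close>

text \<open>The one parameter \<open>\<rho>\<close> bounds both the size of the neighbourhoods and the aperture of the cones.\<close>

definition uniform_cone :: "'a::euclidean_space set \<Rightarrow> real \<Rightarrow> bool" where
  "uniform_cone \<Omega> \<rho> \<longleftrightarrow>
     (\<forall>x\<in>closure \<Omega>. \<exists>e. norm e = 1 \<and>
        (\<forall>y\<in>closure \<Omega> \<inter> ball x \<rho>. \<forall>t\<in>{0<..\<rho>}. ball (y + t *\<^sub>R e) (\<rho> * t) \<subseteq> \<Omega>))"

lemma C1_locally_lipschitz:
  fixes \<gamma> :: "'a::euclidean_space \<Rightarrow> real"
  assumes "C1_on UNIV \<gamma>"
  obtains \<Lambda> where "\<Lambda> \<ge> 0"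
    "\<And>a b. norm a \<le> R \<Longrightarrow> norm b \<le> R \<Longrightarrow> \<bar>\<gamma> a - \<gamma> b\<bar> \<le> \<Lambda> * norm (a - b)"
proof -
  obtain G where cG: "continuous_on UNIV G"
    and dG: "\<And>x. (\<gamma> has_derivative (\<lambda>h. G x \<bullet> h)) (at x)"
    using assms unfolding C1_on_def C1_with_gradient_on_def by auto
  have "compact (G ` cball 0 R)"
    by (intro compact_continuous_image continuous_on_subset[OF cG]) auto
  then obtain \<Lambda> where \<Lambda>: "\<Lambda> > 0" "\<And>x. x \<in> cball 0 R \<Longrightarrow> norm (G x) \<le> \<Lambda>"
    using bounded_pos compact_imp_bounded by (metis imageI)
  have "\<bar>\<gamma> a - \<gamma> b\<bar> \<le> \<Lambda> * norm (a - b)" if "norm a \<le> R" "norm b \<le> R" for a b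
  proof -
    have "norm (\<gamma> a - \<gamma> b) \<le> \<Lambda> * norm (a - b)"
    proof (rule differentiable_bound[where S="cball 0 R" and f'="\<lambda>x h. G x \<bullet> h"])
      show "onorm (\<lambda>h. G x \<bullet> h) \<le> \<Lambda>" if "x \<in> cball 0 R" for x
      proof (rule onorm_le)
        show "norm (G x \<bullet> h) \<le> \<Lambda> * norm h" for h
          using Cauchy_Schwarz_ineq2[of "G x" h] \<Lambda>(2)[OF that]
          by (smt (verit) mult_right_mono norm_ge_zero real_norm_def)
      qed
      show "(\<gamma> has_derivative (\<lambda>h. G x \<bullet> h)) (at x within cball 0 R)" for x
        by (rule has_derivative_at_withinI[OF dG])
    qed (use that in auto)
    then show ?thesis by simp
  qed
  with \<Lambda>(1) show ?thesis by (intro that[of \<Lambda>]) auto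
qed

text \<open>Moving up by \<open>t\<close> and then aside by less than \<open>\<rho> * t\<close>
  raises the height by more than \<open>(1 - \<rho>) * t\<close>, while \<open>\<gamma>\<close>,
  Lipschitz with constant \<open>\<Lambda>\<close> on a ball, changes by at most
  \<open>\<Lambda> * \<rho> * t\<close>. So \<open>\<rho> * (\<Lambda> + 1) \<le> 1\<close> keeps
  the point above the graph. At interior points any axis will do.\<close>

lemma uniform_cone_local:
  fixes \<Omega> :: "'a::euclidean_space set"
  assumes "C1_boundary \<Omega>" "open \<Omega>" "p \<in> closure \<Omega>"
  shows "\<exists>\<rho>>0. \<exists>e. norm e = 1 \<and>
    (\<forall>y\<in>closure \<Omega> \<inter> ball p \<rho>. \<forall>t\<in>{0<..\<rho>}. ball (y + t *\<^sub>R e) (\<rho> * t) \<subseteq> \<Omega>)"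
proof (cases "p \<in> \<Omega>")
  case True
  then obtain r where r: "r > 0" "ball p r \<subseteq> \<Omega>" using assms(2) openE by blast
  obtain e :: 'a where e: "norm e = 1" using norm_Basis nonempty_Basis by blast
  define \<rho> where "\<rho> = min 1 (r/3)"
  have \<rho>: "\<rho> > 0" "\<rho> \<le> 1" "\<rho> \<le> r/3" using r by (auto simp: \<rho>_def)
  have "ball (y + t *\<^sub>R e) (\<rho> * t) \<subseteq> \<Omega>" if "y \<in> ball p \<rho>" "0 < t" "t \<le> \<rho>" for y t
  proof
    fix w assume "w \<in> ball (y + t *\<^sub>R e) (\<rho> * t)"
    then have "norm (w - (y + t *\<^sub>R e)) < \<rho> * t" by (simp add: dist_norm norm_minus_commute)
    moreover have "\<rho> * t \<le> \<rho>" using \<rho> that by (simp add: mult_left_le)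
    moreover have "norm (w - p) \<le> norm (w - (y + t *\<^sub>R e)) + norm (y - p) + norm (t *\<^sub>R e)"
      using norm_triangle_ineq[of "w - (y + t *\<^sub>R e) + (y - p)" "t *\<^sub>R e"]
        norm_triangle_ineq[of "w - (y + t *\<^sub>R e)" "y - p"] by simp
    moreover have "norm (t *\<^sub>R e) \<le> \<rho>" using e that by simp
    moreover have "norm (y - p) < \<rho>" using that by (simp add: dist_norm norm_minus_commute)
    ultimately have "norm (w - p) < r" using \<rho> by linarith
    then show "w \<in> \<Omega>" using r by (auto simp: dist_norm norm_minus_commute)
  qed
  then show ?thesis using \<rho>(1) e by (intro exI[of _ \<rho>] conjI exI[of _ e]) auto
next
  case False
  then have "p \<in> frontier \<Omega>" using assms by (simp add: frontier_def interior_open)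
  then obtain r e \<gamma> where r: "r > 0" and e: "norm e = 1" and \<gamma>: "C1_on UNIV \<gamma>"
    and eq: "\<Omega> \<inter> ball p r = {x \<in> ball p r. \<gamma> (x - (x \<bullet> e) *\<^sub>R e) < x \<bullet> e}"
    using assms(1) unfolding C1_boundary_def by meson
  define P where "P x = x - (x \<bullet> e) *\<^sub>R e" for x
  have P_norm: "norm (P x) \<le> norm x" for x
  proof -
    have "norm (P x) ^ 2 = norm x ^ 2 - (x \<bullet> e) ^ 2"
      using e unfolding power2_norm_eq_inner P_def
      by (simp add: inner_diff_left inner_diff_right power2_eq_square inner_commute norm_eq_1)
    then have "norm (P x) ^ 2 \<le> norm x ^ 2" by simp
    then show ?thesis by (rule power2_le_imp_le) simp
  qed
  have P_diff: "P x - P y = P (x - y)" for x y by (simp add: P_def algebra_simps)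
  obtain \<Lambda> where \<Lambda>: "\<Lambda> \<ge> 0"
    "\<And>a b. norm a \<le> norm p + r \<Longrightarrow> norm b \<le> norm p + r \<Longrightarrow> \<bar>\<gamma> a - \<gamma> b\<bar> \<le> \<Lambda> * norm (a - b)"
    using C1_locally_lipschitz[OF \<gamma>] by blast
  have c\<gamma>: "continuous_on UNIV \<gamma>"
    using \<gamma> unfolding C1_on_def C1_with_gradient_on_def
    by (meson has_derivative_continuous_on)
  have P_ball: "norm (P x) \<le> norm p + r" if "x \<in> ball p r" for x
  proof -
    have "norm x \<le> norm p + norm (x - p)" by (metis add.commute diff_add_cancel norm_triangle_ineq)
    then show ?thesis using P_norm[of x] that by (simp add: dist_norm norm_minus_commute)
  qed
  \<comment> \<open>The bound \<open>r/3\<close> leaves room in \<open>ball p r\<close> for three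
    displacements: from \<open>p\<close> to \<open>y\<close>, along \<open>e\<close>, and inside the
    small ball. The last bound is the aperture condition.\<close>
  define \<rho> where "\<rho> = min (min 1 (r/3)) (1 / (\<Lambda> + 1))"
  have \<rho>: "\<rho> > 0" "\<rho> \<le> 1" "\<rho> \<le> r/3" "\<rho> \<le> 1 / (\<Lambda> + 1)" using r \<Lambda>(1) by (auto simp: \<rho>_def)
  have \<rho>': "\<rho> * (\<Lambda> + 1) \<le> 1" using \<rho>(4) \<Lambda>(1) by (simp add: pos_le_divide_eq)
  \<comment> \<open>On the closure the graph inequality is only weak; strictness returns at the end
    because \<open>w\<close> ranges over an open ball.\<close>
  have graph: "\<gamma> (P y) \<le> y \<bullet> e" if "y \<in> closure \<Omega>" "y \<in> ball p r" for y
  proof -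
    have "y \<in> closure (\<Omega> \<inter> ball p r)"
      using that open_Int_closure_subset[of "ball p r" \<Omega>] by (auto simp: Int_commute)
    moreover have "closed {y. \<gamma> (P y) \<le> y \<bullet> e}" unfolding P_def
      by (intro closed_Collect_le continuous_intros continuous_on_compose2[OF c\<gamma>]) auto
    moreover have "\<Omega> \<inter> ball p r \<subseteq> {y. \<gamma> (P y) \<le> y \<bullet> e}" using eq by (auto simp: P_def)
    ultimately show ?thesis using closure_minimal by blast
  qed
  have "ball (y + t *\<^sub>R e) (\<rho> * t) \<subseteq> \<Omega>"
    if y: "y \<in> closure \<Omega>" "y \<in> ball p \<rho>" and t: "0 < t" "t \<le> \<rho>" for y t
  proof
    fix w assume "w \<in> ball (y + t *\<^sub>R e) (\<rho> * t)"
    then have v: "norm (w - (y + t *\<^sub>R e)) < \<rho> * t" by (simp add: dist_norm norm_minus_commute)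
    have "\<rho> * t \<le> \<rho>" using \<rho> t by (simp add: mult_left_le)
    moreover have "norm (w - p) \<le> norm (w - (y + t *\<^sub>R e)) + norm (y - p) + norm (t *\<^sub>R e)"
      using norm_triangle_ineq[of "w - (y + t *\<^sub>R e) + (y - p)" "t *\<^sub>R e"]
        norm_triangle_ineq[of "w - (y + t *\<^sub>R e)" "y - p"] by simp
    moreover have "norm (t *\<^sub>R e) \<le> \<rho>" using e t by simp
    moreover have "norm (y - p) < \<rho>" using y by (simp add: dist_norm norm_minus_commute)
    ultimately have "norm (w - p) < r" using \<rho> v by linarith
    then have w: "w \<in> ball p r" by (simp add: dist_norm norm_minus_commute)
    have yr: "y \<in> ball p r" using y \<rho> r by auto
    have Pw: "P w - P y = P (w - (y + t *\<^sub>R e))"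
      using e by (simp add: P_def algebra_simps inner_diff_left norm_eq_1 inner_add_left)
    have "\<gamma> (P w) \<le> \<gamma> (P y) + \<Lambda> * norm (P w - P y)"
      using \<Lambda>(2)[OF P_ball[OF w] P_ball[OF yr]] by linarith
    also have "\<dots> \<le> y \<bullet> e + \<Lambda> * (\<rho> * t)"
      using graph[OF y(1) yr] P_norm[of "w - (y + t *\<^sub>R e)"] v \<Lambda>(1) unfolding Pw
      by (intro add_mono mult_left_mono) auto
    also have "\<dots> \<le> y \<bullet> e + t - \<rho> * t"
      using mult_right_mono[OF \<rho>', of t] t by (simp add: algebra_simps)
    also have "\<dots> < w \<bullet> e"
    proof -
      have "\<bar>(w - (y + t *\<^sub>R e)) \<bullet> e\<bar> \<le> norm (w - (y + t *\<^sub>R e))"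
        using Cauchy_Schwarz_ineq2[of "w - (y + t *\<^sub>R e)" e] e by simp
      moreover have "(w - (y + t *\<^sub>R e)) \<bullet> e = w \<bullet> e - y \<bullet> e - t"
        using e by (simp add: inner_diff_left inner_add_left norm_eq_1)
      ultimately show ?thesis using v by linarith
    qed
    finally have "w \<in> \<Omega> \<inter> ball p r" using w unfolding eq P_def by simp
    then show "w \<in> \<Omega>" by simp
  qed
  then show ?thesis using \<rho>(1) e by (intro exI[of _ \<rho>] conjI exI[of _ e]) auto
qed

text \<open>Compactness: \<open>mono\<close> carries a good radius at \<open>p\<close> to nearby
  points with the distance subtracted, so points at which the radii \<open>1 / real (Suc n)\<close>
  fail cannot accumulate.\<close>

lemma C1_boundary_imp_uniform_cone:
  fixes \<Omega> :: "'a::euclidean_space set"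
  assumes "C1_boundary \<Omega>" "open \<Omega>" "bounded \<Omega>"
  obtains \<rho> where "0 < \<rho>" "\<rho> \<le> 1" "uniform_cone \<Omega> \<rho>"
proof -
  let ?good = "\<lambda>x \<rho>. \<exists>e. norm e = 1 \<and>
    (\<forall>y\<in>closure \<Omega> \<inter> ball x \<rho>. \<forall>t\<in>{0<..\<rho>}. ball (y + t *\<^sub>R e) (\<rho> * t) \<subseteq> \<Omega>)"
  have mono: "?good x \<rho>'" if g: "?good p \<rho>" and le: "0 < \<rho>'" "\<rho>' + dist p x \<le> \<rho>" for p x \<rho> \<rho>'
  proof -
    have le': "\<rho>' \<le> \<rho>" "ball x \<rho>' \<subseteq> ball p \<rho>"
      using le zero_le_dist[of p x] by (linarith, simp add: ball_subset_ball_iff dist_commute)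
    have "ball (y + t *\<^sub>R e) (\<rho>' * t) \<subseteq> ball (y + t *\<^sub>R e) (\<rho> * t)" if "t > 0" for t :: real and e y :: 'a
      using that le' by (intro subset_ball mult_right_mono) auto
    note sub = this
    from g obtain e where e: "norm e = 1"
      "\<forall>y\<in>closure \<Omega> \<inter> ball p \<rho>. \<forall>t\<in>{0<..\<rho>}. ball (y + t *\<^sub>R e) (\<rho> * t) \<subseteq> \<Omega>" by blast
    show ?thesis
    proof (intro exI[of _ e] conjI e(1) ballI)
      fix y t assume yt: "y \<in> closure \<Omega> \<inter> ball x \<rho>'" "t \<in> {0<..\<rho>'}"
      then have "y \<in> closure \<Omega> \<inter> ball p \<rho>" "t \<in> {0<..\<rho>}" using le' by auto
      then have "ball (y + t *\<^sub>R e) (\<rho> * t) \<subseteq> \<Omega>" using e(2) by blast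
      then show "ball (y + t *\<^sub>R e) (\<rho>' * t) \<subseteq> \<Omega>" using sub[of t y e] yt(2) by auto
    qed
  qed
  have "\<exists>n. \<forall>x\<in>closure \<Omega>. ?good x (1 / real (Suc n))"
  proof (rule ccontr)
    assume "\<not> ?thesis"
    then have "\<forall>n. \<exists>x\<in>closure \<Omega>. \<not> ?good x (1 / real (Suc n))" by blast
    then obtain X where X: "\<And>n. X n \<in> closure \<Omega>" "\<And>n. \<not> ?good (X n) (1 / real (Suc n))" by metis
    have "compact (closure \<Omega>)" using assms(3) by simp
    then obtain p r where p: "p \<in> closure \<Omega>" "strict_mono r" "(X \<circ> r) \<longlonglongrightarrow> p"
      using X(1) unfolding compact_def by (metis (no_types, lifting))
    obtain \<rho> where \<rho>: "\<rho> > 0" "?good p \<rho>" using uniform_cone_local[OF assms(1,2) p(1)] by blast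
    have "(\<lambda>n. 1 / real (Suc (r n)) + dist p (X (r n))) \<longlonglongrightarrow> 0 + dist p p"
    proof (intro tendsto_intros)
      show "(\<lambda>n. 1 / real (Suc (r n))) \<longlonglongrightarrow> 0"
        using LIMSEQ_subseq_LIMSEQ[OF LIMSEQ_inverse_real_of_nat p(2)]
        by (simp add: o_def inverse_eq_divide)
      show "(\<lambda>n. X (r n)) \<longlonglongrightarrow> p" using p(3) by (simp add: o_def)
    qed
    then have "\<forall>\<^sub>F n in sequentially. 1 / real (Suc (r n)) + dist p (X (r n)) < \<rho>"
      using \<rho>(1) by (intro order_tendstoD) auto
    then obtain n where "1 / real (Suc (r n)) + dist p (X (r n)) < \<rho>"
      by (auto simp: eventually_sequentially)
    then have "?good (X (r n)) (1 / real (Suc (r n)))"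
      by (intro mono[OF \<rho>(2)]) auto
    then show False using X(2) by blast
  qed
  then obtain n where "\<forall>x\<in>closure \<Omega>. ?good x (1 / real (Suc n))" by blast
  then show ?thesis by (intro that[of "1 / real (Suc n)"]) (auto simp: uniform_cone_def)
qed

text \<open>Cutting the segment into \<open>n + 1\<close> equal pieces divides the total quadratic
  error by \<open>n + 1\<close>. This removes the penalty term of
  \<open>interior_increment_bound\<close>, whose coefficient blows up at the boundary.\<close>

lemma segment_lipschitz_of_quadratic:
  fixes f :: "'a::real_normed_vector \<Rightarrow> real"
  assumes "\<And>a b. a \<in> closed_segment x y \<Longrightarrow> b \<in> closed_segment x y \<Longrightarrow>
             f b - f a \<le> K * norm (b - a) + B * norm (b - a) ^ 2"
  shows "f y - f x \<le> K * norm (y - x)"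
proof -
  define s where "s = norm (y - x)"
  have bd: "f y - f x \<le> K * s + B * s ^ 2 * inverse (real (Suc n))" for n
  proof -
    define N where "N = real (Suc n)"
    have N: "N > 0" by (simp add: N_def)
    define P where "P i = x + (real i / N) *\<^sub>R (y - x)" for i
    have P_in: "P i \<in> closed_segment x y" if "i \<le> Suc n" for i
    proof -
      have "P i = (1 - real i / N) *\<^sub>R x + (real i / N) *\<^sub>R y" by (simp add: P_def algebra_simps)
      moreover have "real i / N \<le> 1" using that N by (simp add: N_def)
      ultimately show ?thesis using N unfolding closed_segment_def by force
    qed
    have step: "f (P (Suc i)) - f (P i) \<le> K * (s / N) + B * (s / N) ^ 2" if "i < Suc n" for i
    proof -
      have "P (Suc i) - P i = (1 / N) *\<^sub>R (y - x)"
        by (simp add: P_def add_divide_distrib algebra_simps)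
      then have "norm (P (Suc i) - P i) = s / N" using N by (simp add: s_def)
      then show ?thesis using assms[OF P_in[of i] P_in[of "Suc i"]] that by simp
    qed
    have "f y - f x = f (P (Suc n)) - f (P 0)"
      using N by (simp add: P_def N_def)
    also have "\<dots> = (\<Sum>i<Suc n. f (P (Suc i)) - f (P i))" by (rule sum_lessThan_telescope[symmetric])
    also have "\<dots> \<le> (\<Sum>i<Suc n. K * (s / N) + B * (s / N) ^ 2)"
      by (intro sum_mono step) auto
    also have "\<dots> = K * s + B * s ^ 2 * inverse N"
      using N by (simp add: N_def[symmetric] field_simps power2_eq_square del: of_nat_Suc)
    finally show ?thesis by (simp add: N_def)
  qed
  have "(\<lambda>n. K * s + B * s ^ 2 * inverse (real (Suc n))) \<longlonglongrightarrow> K * s + B * s ^ 2 * 0"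
    by (intro tendsto_intros LIMSEQ_inverse_real_of_nat)
  then show ?thesis using bd by (intro LIMSEQ_le_const[of _ "K * norm (y - x)"]) (auto simp: s_def)
qed

text \<open>By connectedness the interval between two values of \<open>u\<close> is covered by the
  intervals of radius \<open>q\<close> around the values at a finite net; comparing lengths gives
  \<open>2 * card T * q\<close>. The net, hence \<open>n\<close>, is chosen before \<open>u\<close>
  and \<open>q\<close>.\<close>

lemma oscillation_chain:
  fixes S :: "'a::metric_space set"
  assumes "compact S" "connected S" "s > 0"
  obtains n :: nat where "\<And>(u :: 'a \<Rightarrow> real) q x y. continuous_on S u \<Longrightarrow> q \<ge> 0 \<Longrightarrow>
     (\<And>x y. x \<in> S \<Longrightarrow> y \<in> S \<Longrightarrow> dist x y < s \<Longrightarrow> \<bar>u x - u y\<bar> \<le> q) \<Longrightarrow>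
     x \<in> S \<Longrightarrow> y \<in> S \<Longrightarrow> \<bar>u x - u y\<bar> \<le> real n * q"
proof -
  obtain T where T: "finite T" "T \<subseteq> S" "S \<subseteq> (\<Union>p\<in>T. ball p s)"
    using compactE_image[OF assms(1), of S "\<lambda>p. ball p s"] assms(3)
    by (metis (no_types, lifting) UN_I centre_in_ball open_ball subsetI)
  have *: "u y - u x \<le> real (2 * card T) * q"
    if u: "continuous_on S u" and q: "q \<ge> 0"
      and le: "\<And>x y. x \<in> S \<Longrightarrow> y \<in> S \<Longrightarrow> dist x y < s \<Longrightarrow> \<bar>u x - u y\<bar> \<le> q"
      and xy: "x \<in> S" "y \<in> S" for u :: "'a \<Rightarrow> real" and q x y
  proof (cases "u x \<le> u y")
    case True
    have "connected (u ` S)" by (rule connected_continuous_image[OF u assms(2)])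
    then have "{u x..u y} \<subseteq> u ` S" using xy connected_contains_Icc by blast
    also have "\<dots> \<subseteq> (\<Union>p\<in>T. {u p - q..u p + q})"
    proof
      fix c assume "c \<in> u ` S"
      then obtain w where w: "w \<in> S" "c = u w" by blast
      then obtain p where "p \<in> T" "dist p w < s" using T by auto
      then show "c \<in> (\<Union>p\<in>T. {u p - q..u p + q})"
        using le[of p w] w T(2) by force
    qed
    finally have "emeasure lborel {u x..u y} \<le> emeasure lborel (\<Union>p\<in>T. {u p - q..u p + q})"
      by (intro emeasure_mono) (auto intro!: sets.finite_UN T)
    also have "\<dots> \<le> (\<Sum>p\<in>T. emeasure lborel {u p - q..u p + q})"
      by (intro emeasure_subadditive_finite T) auto
    also have "\<dots> = (\<Sum>p\<in>T. ennreal (2 * q))" using q by (intro sum.cong) auto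
    also have "\<dots> = ennreal (real (2 * card T) * q)"
      using q by (simp add: ennreal_of_nat_eq_real_of_nat ennreal_mult' [symmetric] mult_ac)
    finally show ?thesis using True q by simp
  next
    case False
    then show ?thesis using q by (smt (verit) mult_nonneg_nonneg of_nat_0_le_iff)
  qed
  have "\<bar>u x - u y\<bar> \<le> real (2 * card T) * q" if "continuous_on S u" "q \<ge> 0"
      "\<And>x y. x \<in> S \<Longrightarrow> y \<in> S \<Longrightarrow> dist x y < s \<Longrightarrow> \<bar>u x - u y\<bar> \<le> q" "x \<in> S" "y \<in> S"
    for u :: "'a \<Rightarrow> real" and q x y
    using *[OF that] *[OF that(1-3) that(5,4)] by linarith
  then show ?thesis by (rule that)
qed

text \<open>Slopes growing like \<open>d powr (-a)\<close> with \<open>a < 1\<close> are integrable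
  in the depth \<open>d\<close>. Two close points are joined by moving from each along a common cone
  axis to a depth comparable to their distance, and then across. \<open>M\<close> depends on the
  geometry and \<open>a\<close> alone, which the later iterations rely on.\<close>

lemma holder_of_interior_lipschitz:
  fixes \<Omega> :: "'a::euclidean_space set"
  assumes "bounded \<Omega>" "connected \<Omega>" and \<rho>: "0 < \<rho>" "\<rho> \<le> 1" and cone: "uniform_cone \<Omega> \<rho>"
    and a: "0 \<le> a" "a < 1"
  obtains M where "M > 0"
    "\<And>u A x y. continuous_on (closure \<Omega>) u \<Longrightarrow> A \<ge> 0 \<Longrightarrow>
       (\<And>d x y. 0 < d \<Longrightarrow> d < 1 \<Longrightarrow> (\<And>z. z \<in> closed_segment x y \<Longrightarrow> ball z d \<subseteq> \<Omega>) \<Longrightarrow>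
           u y - u x \<le> A * d powr (-a) * norm (y - x)) \<Longrightarrow>
       x \<in> closure \<Omega> \<Longrightarrow> y \<in> closure \<Omega> \<Longrightarrow> \<bar>u x - u y\<bar> \<le> M * A * norm (x - y) powr (1 - a)"
proof -
  \<comment> \<open>For \<open>s < s1\<close> the depth \<open>2 * s / \<rho>\<close> chosen below
    does not exceed the cone height \<open>\<rho>\<close>.\<close>
  define s1 where "s1 = \<rho>\<^sup>2 / 2"
  have s1: "s1 > 0" "s1 \<le> \<rho>" "s1 < 1"
    using \<rho> mult_mono[of \<rho> 1 \<rho> 1] by (auto simp: s1_def power2_eq_square field_simps)
  obtain n :: nat where n: "\<And>(u :: 'a \<Rightarrow> real) q x y. continuous_on (closure \<Omega>) u \<Longrightarrow> q \<ge> 0 \<Longrightarrow>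
     (\<And>x y. x \<in> closure \<Omega> \<Longrightarrow> y \<in> closure \<Omega> \<Longrightarrow> dist x y < s1 \<Longrightarrow> \<bar>u x - u y\<bar> \<le> q) \<Longrightarrow>
     x \<in> closure \<Omega> \<Longrightarrow> y \<in> closure \<Omega> \<Longrightarrow> \<bar>u x - u y\<bar> \<le> real n * q"
    using oscillation_chain[of "closure \<Omega>" s1] assms(1,2) s1 connected_imp_connected_closure
    by (metis compact_closure)
  define q where "q = (1/2::real) powr (1 - a)"
  have q: "0 < q" "q < 1" using a powr_less_mono2[of "1 - a" "1/2::real" 1] by (auto simp: q_def)
  \<comment> \<open>\<open>E * (1 - q) = \<rho> powr (-a) * q\<close>: each dyadic increment becomes
    \<open>A * E\<close> times a difference of powers, and the increments telescope.\<close>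
  define E where "E = \<rho> powr (-a) * q / (1 - q)"
  have E: "E > 0" using q \<rho> by (simp add: E_def)
  \<comment> \<open>In units of \<open>A * s powr (1-a)\<close>, the two paths along the axis cost
    \<open>E * (2 / \<rho>) powr (1-a)\<close> each and the crossing costs 1.\<close>
  define M1 where "M1 = 2 * E * (2 / \<rho>) powr (1 - a) + 1"
  have M1: "M1 > 0" using E by (simp add: M1_def add_pos_pos add_nonneg_pos)
  have near: "\<bar>u x - u y\<bar> \<le> M1 * A * norm (x - y) powr (1 - a)"
    if cu: "continuous_on (closure \<Omega>) u" and A: "A \<ge> 0"
      and lip: "\<And>d x y. 0 < d \<Longrightarrow> d < 1 \<Longrightarrow> (\<And>z. z \<in> closed_segment x y \<Longrightarrow> ball z d \<subseteq> \<Omega>) \<Longrightarrow>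
           u y - u x \<le> A * d powr (-a) * norm (y - x)"
      and xy: "x \<in> closure \<Omega>" "y \<in> closure \<Omega>" "norm (x - y) < s1"
    for u :: "'a \<Rightarrow> real" and A x y
  proof (cases "x = y")
    case False
    have lip': "\<bar>u y - u x\<bar> \<le> A * d powr (-a) * norm (y - x)"
      if "0 < d" "d < 1" "\<And>z. z \<in> closed_segment x y \<Longrightarrow> ball z d \<subseteq> \<Omega>" for d x y
      using lip[of d x y] lip[of d y x] that by (simp add: closed_segment_commute norm_minus_commute)
    obtain e where e: "norm e = 1" and
      e2: "\<And>y t. y \<in> closure \<Omega> \<Longrightarrow> norm (x - y) < \<rho> \<Longrightarrow> 0 < t \<Longrightarrow> t \<le> \<rho> \<Longrightarrow>
             ball (y + t *\<^sub>R e) (\<rho> * t) \<subseteq> \<Omega>"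
      using cone xy(1) unfolding uniform_cone_def by (auto simp: dist_norm)
    have half: "\<bar>u (w + t *\<^sub>R e) - u (w + (t/2) *\<^sub>R e)\<bar> \<le> A * E * (t powr (1-a) - (t/2) powr (1-a))"
      if w: "w \<in> closure \<Omega>" "norm (x - w) < \<rho>" and t: "0 < t" "t \<le> \<rho>" for w t
    proof -
      have "ball z (\<rho> * (t/2)) \<subseteq> \<Omega>" if "z \<in> closed_segment (w + (t/2) *\<^sub>R e) (w + t *\<^sub>R e)" for z
      proof -
        from that obtain \<theta> where \<theta>: "0 \<le> \<theta>" "\<theta> \<le> 1"
          "z = (1 - \<theta>) *\<^sub>R (w + (t/2) *\<^sub>R e) + \<theta> *\<^sub>R (w + t *\<^sub>R e)"
          unfolding closed_segment_def by blast
        define s where "s = t/2 + \<theta> * t / 2"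
        have "z = w + s *\<^sub>R e" using \<theta>(3)
          by (simp add: s_def algebra_simps) (simp flip: scaleR_add_left add: field_simps)
        moreover have s: "t/2 \<le> s" "s \<le> t" using \<theta> t by (auto simp: s_def field_simps mult_left_le)
        ultimately have "ball z (\<rho> * s) \<subseteq> \<Omega>" using e2[OF w, of s] t by simp
        moreover have "ball z (\<rho> * (t/2)) \<subseteq> ball z (\<rho> * s)"
          using s \<rho> by (intro subset_ball mult_left_mono) auto
        ultimately show ?thesis by blast
      qed
      moreover have "0 < \<rho> * (t/2)" "\<rho> * (t/2) < 1"
        using \<rho> t mult_mono[of \<rho> 1 "t/2" "1/2"] by auto
      ultimately have "\<bar>u (w + t *\<^sub>R e) - u (w + (t/2) *\<^sub>R e)\<bar> \<le>
          A * (\<rho> * (t/2)) powr (-a) * norm ((w + t *\<^sub>R e) - (w + (t/2) *\<^sub>R e))"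
        by (intro lip')
      also have "norm ((w + t *\<^sub>R e) - (w + (t/2) *\<^sub>R e)) = t/2"
      proof -
        have "(w + t *\<^sub>R e) - (w + (t/2) *\<^sub>R e) = (t/2) *\<^sub>R e"
          by (simp add: algebra_simps) (simp flip: scaleR_add_left scaleR_diff_left)
        then show ?thesis using e t by simp
      qed
      also have "A * (\<rho> * (t/2)) powr (-a) * (t/2) = A * \<rho> powr (-a) * (t/2) powr (1-a)"
        using \<rho> t powr_add[of "t/2" "-a" 1] powr_mult[of \<rho> "t/2" "-a"] by simp
      also have "(t/2) powr (1-a) = q * t powr (1-a)"
        using powr_mult[of "1/2" t "1-a"] t by (simp add: q_def)
      also have "A * \<rho> powr (-a) * (q * t powr (1-a)) = A * E * (t powr (1-a) - q * t powr (1-a))"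
        using q by (simp add: E_def field_simps)
      finally show ?thesis
        using powr_mult[of "1/2" t "1-a"] t by (simp add: q_def)
    qed
    have vert: "\<bar>u (w + t *\<^sub>R e) - u w\<bar> \<le> A * E * t powr (1-a)"
      if w: "w \<in> closure \<Omega>" "norm (x - w) < \<rho>" and t: "0 < t" "t \<le> \<rho>" for w t
    proof -
      have k: "\<bar>u (w + t *\<^sub>R e) - u (w + (t/2^k) *\<^sub>R e)\<bar> \<le> A * E * (t powr (1-a) - (t/2^k) powr (1-a))" for k
      proof (induction k)
        case (Suc k)
        have "t / 2^k \<le> \<rho>" using t by (simp add: field_simps) (smt (verit) mult_le_cancel_left1 one_le_power)
        then have "\<bar>u (w + (t/2^k) *\<^sub>R e) - u (w + (t/2^k/2) *\<^sub>R e)\<bar> \<le>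
            A * E * ((t/2^k) powr (1-a) - (t/2^k/2) powr (1-a))"
          using t by (intro half[OF w]) auto
        with Suc show ?case by (simp add: algebra_simps)
      qed simp
      \<comment> \<open>The dyadic points tend to \<open>w\<close>, possibly a boundary point; there
        the bound is transferred by continuity of \<open>u\<close>.\<close>
      have lim: "(\<lambda>k. w + (t/2^k) *\<^sub>R e) \<longlonglongrightarrow> w + 0 *\<^sub>R e"
      proof (intro tendsto_intros)
        have "(\<lambda>k. t * (1/2)^k) \<longlonglongrightarrow> t * 0"
          by (intro tendsto_intros LIMSEQ_power_zero) simp
        then show "(\<lambda>k. t / 2^k) \<longlonglongrightarrow> 0" by (simp add: power_one_over)
      qed
      have mem: "w + (t/2^k) *\<^sub>R e \<in> closure \<Omega>" for k
      proof -
        have tk: "t / 2^k \<le> t" using t by (simp add: field_simps mult_le_cancel_left1)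
        then have "ball (w + (t/2^k) *\<^sub>R e) (\<rho> * (t/2^k)) \<subseteq> \<Omega>"
          using t by (intro e2[OF w]) auto
        moreover have "w + (t/2^k) *\<^sub>R e \<in> ball (w + (t/2^k) *\<^sub>R e) (\<rho> * (t/2^k))"
          using \<rho> t by simp
        ultimately show ?thesis using closure_subset by blast
      qed
      have "(\<lambda>k. u (w + (t/2^k) *\<^sub>R e)) \<longlonglongrightarrow> u w"
        by (rule continuous_on_tendsto_compose[OF cu])
          (use lim mem w in auto)
      then have "(\<lambda>k. \<bar>u (w + t *\<^sub>R e) - u (w + (t/2^k) *\<^sub>R e)\<bar>) \<longlonglongrightarrow> \<bar>u (w + t *\<^sub>R e) - u w\<bar>"
        by (intro tendsto_intros)
      moreover have "\<bar>u (w + t *\<^sub>R e) - u (w + (t/2^k) *\<^sub>R e)\<bar> \<le> A * E * t powr (1-a)" for k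
        by (rule order_trans[OF k]) (use A E in \<open>auto intro!: mult_left_mono mult_nonneg_nonneg\<close>)
      ultimately show ?thesis by (intro LIMSEQ_le_const2) auto
    qed
    define s where "s = norm (x - y)"
    \<comment> \<open>At this depth the ball of radius \<open>\<rho> * t = 2 * s\<close> about
      \<open>x + t *\<^sub>R e\<close> lies in \<open>\<Omega>\<close>, so the crossing, of length
      \<open>s\<close>, keeps the margin \<open>s\<close>.\<close>
    define t where "t = 2 * s / \<rho>"
    have s: "0 < s" "s < s1" using False xy(3) by (auto simp: s_def)
    have t: "0 < t" "t \<le> \<rho>" using s \<rho> by (auto simp: t_def s1_def field_simps power2_eq_square)
    have bx: "ball (x + t *\<^sub>R e) (2 * s) \<subseteq> \<Omega>"
      using e2[OF xy(1) _ t] \<rho> by (simp add: t_def)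
    have "\<bar>u (y + t *\<^sub>R e) - u (x + t *\<^sub>R e)\<bar> \<le> A * s powr (-a) * norm ((y + t *\<^sub>R e) - (x + t *\<^sub>R e))"
    proof (rule lip')
      fix z assume z: "z \<in> closed_segment (x + t *\<^sub>R e) (y + t *\<^sub>R e)"
      then have "dist z (x + t *\<^sub>R e) \<le> dist (x + t *\<^sub>R e) (y + t *\<^sub>R e)"
        by (rule dist_in_closed_segment[THEN conjunct1])
      then have "dist (x + t *\<^sub>R e) z \<le> s" by (simp add: s_def dist_norm norm_minus_commute)
      then have "ball z s \<subseteq> ball (x + t *\<^sub>R e) (2 * s)"
        by (simp add: ball_subset_ball_iff dist_commute)
      then show "ball z s \<subseteq> \<Omega>" using bx by blast
    qed (use s s1 in auto)
    also have "\<dots> = A * s powr (1 - a)"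
      using powr_add[of s "-a" 1] s by (simp add: s_def norm_minus_commute)
    finally have mid: "\<bar>u (y + t *\<^sub>R e) - u (x + t *\<^sub>R e)\<bar> \<le> A * s powr (1 - a)" .
    have v1: "\<bar>u (x + t *\<^sub>R e) - u x\<bar> \<le> A * E * t powr (1-a)"
      using vert[OF xy(1) _ t] \<rho> by simp
    have v2: "\<bar>u (y + t *\<^sub>R e) - u y\<bar> \<le> A * E * t powr (1-a)"
      using vert[OF xy(2) _ t] s s1 by (simp add: s_def)
    have "t powr (1-a) = (2/\<rho>) powr (1-a) * s powr (1-a)"
      using powr_mult[of "2/\<rho>" s "1-a"] \<rho> s by (simp add: t_def)
    then have "\<bar>u x - u y\<bar> \<le> 2 * (A * E * ((2/\<rho>) powr (1-a) * s powr (1-a))) + A * s powr (1 - a)"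
      using v1 v2 mid by simp
    also have "\<dots> = M1 * A * s powr (1-a)" by (simp add: M1_def algebra_simps)
    finally show ?thesis by (simp add: s_def)
  qed (use a in simp)
  define M where "M = M1 * (real n + 1)"
  have M: "M \<ge> M1" "M > 0" using M1 by (auto simp: M_def mult_le_cancel_left1)
  show ?thesis
  proof (rule that[OF M(2)])
    fix u :: "'a \<Rightarrow> real" and A x y
    assume cu: "continuous_on (closure \<Omega>) u" and A: "A \<ge> 0"
      and lip: "\<And>d x y. 0 < d \<Longrightarrow> d < 1 \<Longrightarrow> (\<And>z. z \<in> closed_segment x y \<Longrightarrow> ball z d \<subseteq> \<Omega>) \<Longrightarrow>
           u y - u x \<le> A * d powr (-a) * norm (y - x)"
      and xy: "x \<in> closure \<Omega>" "y \<in> closure \<Omega>"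
    have near': "\<bar>u x - u y\<bar> \<le> M1 * A * norm (x - y) powr (1 - a)"
      if "x \<in> closure \<Omega>" "y \<in> closure \<Omega>" "norm (x - y) < s1" for x y
      by (rule near[OF cu A _ that]) (rule lip)
    show "\<bar>u x - u y\<bar> \<le> M * A * norm (x - y) powr (1 - a)"
    proof (cases "norm (x - y) < s1")
      case True
      have "M1 * A * norm (x - y) powr (1 - a) \<le> M * A * norm (x - y) powr (1 - a)"
        using M A by (intro mult_right_mono) auto
      with near'[OF xy True] show ?thesis by fastforce
    next
      case False
      \<comment> \<open>Distant points: chain the estimate at scale \<open>s1\<close>, then enlarge
        \<open>s1\<close> to their distance.\<close>
      have "\<bar>u x - u y\<bar> \<le> real n * (M1 * A * s1 powr (1 - a))"
      proof (rule n[OF cu _ _ xy])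
        show "0 \<le> M1 * A * s1 powr (1 - a)" using M1 A by simp
        fix x' y' assume *: "x' \<in> closure \<Omega>" "y' \<in> closure \<Omega>" "dist x' y' < s1"
        then have "\<bar>u x' - u y'\<bar> \<le> M1 * A * norm (x' - y') powr (1 - a)"
          by (intro near') (auto simp: dist_norm)
        also have "\<dots> \<le> M1 * A * s1 powr (1 - a)"
          using * a M1 A by (intro mult_left_mono powr_mono2) (auto simp: dist_norm)
        finally show "\<bar>u x' - u y'\<bar> \<le> M1 * A * s1 powr (1 - a)" .
      qed
      also have "\<dots> \<le> (real n + 1) * (M1 * A * s1 powr (1 - a))"
        using M1 A by (intro mult_right_mono) auto
      also have "\<dots> \<le> (real n + 1) * (M1 * A * norm (x - y) powr (1 - a))"
        using M1 A a False s1 by (intro mult_left_mono powr_mono2) auto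
      finally show ?thesis by (simp add: M_def mult_ac)
    qed
  qed
qed

section \<open>Nonlocal operators and generalised subsolutions\<close>

text \<open>For integrable \<open>f\<close> drop the negative part; otherwise the Bochner integral
  is 0, which is at most \<open>B\<close>. Upper bounds of the operator thus reduce to pointwise
  bounds of increments.\<close>

lemma set_integral_le_of_nn_integral:
  fixes f g :: "'a \<Rightarrow> real"
  assumes "\<And>z. z \<in> A \<Longrightarrow> f z \<le> g z"
    and "(\<integral>\<^sup>+z\<in>A. ennreal (g z) \<partial>M) \<le> ennreal B" "B \<ge> 0"
  shows "(LINT z:A|M. f z) \<le> B"
proof (cases "set_integrable M A f")
  case True
  let ?f = "\<lambda>z. indicat_real A z *\<^sub>R f z"
  have "(LINT z:A|M. f z) \<le> enn2real (\<integral>\<^sup>+z. ennreal (?f z) \<partial>M)"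
    using True unfolding set_lebesgue_integral_def set_integrable_def
    by (simp add: real_lebesgue_integral_def enn2real_nonneg)
  also have "(\<integral>\<^sup>+z. ennreal (?f z) \<partial>M) \<le> (\<integral>\<^sup>+z\<in>A. ennreal (g z) \<partial>M)"
    using assms(1) by (intro nn_integral_mono) (auto simp: indicator_def ennreal_leI)
  then have "enn2real (\<integral>\<^sup>+z. ennreal (?f z) \<partial>M) \<le> enn2real (ennreal B)"
    using assms(2) by (intro enn2real_mono) (auto intro: order_trans)
  finally show ?thesis using assms(3) by simp
next
  case False
  then show ?thesis using assms(3)
    by (simp add: set_lebesgue_integral_def set_integrable_def not_integrable_integral_eq)
qed

section \<open>Calculus of test functions\<close>

lemma C1_with_gradient_on_add:
  assumes "C1_with_gradient_on S f F" "C1_with_gradient_on S g G"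
  shows "C1_with_gradient_on S (\<lambda>x. f x + g x) (\<lambda>x. F x + G x)"
  using assms unfolding C1_with_gradient_on_def
  by (auto intro!: continuous_intros derivative_eq_intros simp: inner_add_left)

lemma C1_with_gradient_on_cmult:
  assumes "C1_with_gradient_on S f F"
  shows "C1_with_gradient_on S (\<lambda>x. c * f x) (\<lambda>x. c *\<^sub>R F x)"
  using assms unfolding C1_with_gradient_on_def
  by (auto intro!: continuous_intros derivative_eq_intros)

lemma C1_with_gradient_on_minus:
  assumes "C1_with_gradient_on S f F"
  shows "C1_with_gradient_on S (\<lambda>x. - f x) (\<lambda>x. - F x)"
  using C1_with_gradient_on_cmult[OF assms, of "-1"] by simp

lemma C1_with_gradient_on_const: "C1_with_gradient_on S (\<lambda>x. c) (\<lambda>x. 0)"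
  unfolding C1_with_gradient_on_def by (auto intro!: has_derivative_eq_rhs[OF has_derivative_const])

lemma C1_with_gradient_on_subset:
  "C1_with_gradient_on S f F \<Longrightarrow> T \<subseteq> S \<Longrightarrow> C1_with_gradient_on T f F"
  unfolding C1_with_gradient_on_def
  by (meson continuous_on_subset has_derivative_subset in_mono)

lemma C1_with_gradient_on_continuous: "C1_with_gradient_on S f F \<Longrightarrow> continuous_on S f"
  unfolding C1_with_gradient_on_def by (meson has_derivative_continuous_on)

lemma C1_with_gradient_on_sqnorm:
  "C1_with_gradient_on S (\<lambda>x. norm (x - a) ^ 2) (\<lambda>x. 2 *\<^sub>R (x - a))"
  unfolding C1_with_gradient_on_def power2_norm_eq_inner
  by (auto intro!: continuous_intros derivative_eq_intros simp: inner_commute)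

text \<open>The cone smoothed at its vertex on the scale \<open>\<tau>\<close>. Its gradient always
  has norm below 1 and retains a fixed fraction of the slope 1 at distances of at least
  \<open>\<tau>\<close> from the vertex.\<close>

lemma C1_with_gradient_on_soft_norm:
  assumes "\<tau> > 0"
  shows "C1_with_gradient_on S (\<lambda>x. sqrt (norm (x - a) ^ 2 + \<tau>\<^sup>2))
           (\<lambda>x. (1 / sqrt (norm (x - a) ^ 2 + \<tau>\<^sup>2)) *\<^sub>R (x - a))"
proof -
  have pos: "norm (x - a) ^ 2 + \<tau>\<^sup>2 > 0" for x using assms by (simp add: add_nonneg_pos)
  have "((\<lambda>x. sqrt (norm (x - a) ^ 2 + \<tau>\<^sup>2)) has_derivative
      (\<lambda>h. ((1 / sqrt (norm (x - a) ^ 2 + \<tau>\<^sup>2)) *\<^sub>R (x - a)) \<bullet> h)) (at x within S)" for x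
  proof -
    have d: "((\<lambda>x. norm (x - a) ^ 2 + \<tau>\<^sup>2) has_derivative (\<lambda>h. 2 * ((x - a) \<bullet> h))) (at x within S)"
      unfolding power2_norm_eq_inner
      by (auto intro!: derivative_eq_intros simp: inner_commute)
    have "((1 / s) *\<^sub>R v) \<bullet> h = inverse s / 2 * (2 * (v \<bullet> h))" for s and v h :: 'a
      by (simp add: inverse_eq_divide)
    note eq = this[of "sqrt (norm (x - a) ^ 2 + \<tau>\<^sup>2)" "x - a"]
    show ?thesis unfolding eq
      using has_derivative_compose[OF d DERIV_real_sqrt[OF pos[of x], unfolded has_field_derivative_def]]
      by (simp only:)
  qed
  moreover have "continuous_on S (\<lambda>x. (1 / sqrt (norm (x - a) ^ 2 + \<tau>\<^sup>2)) *\<^sub>R (x - a))"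
    using assms by (intro continuous_intros) auto
  ultimately show ?thesis unfolding C1_with_gradient_on_def by blast
qed

text \<open>
  Tested at the points of \<open>E\<close> only and with a right-hand side depending on the point, so that it
  covers discounted problems and, through \<open>- u\<close>, supersolutions.
\<close>

definition vsub ::
  "'a::euclidean_space set \<Rightarrow> ('a \<Rightarrow> 'a measure) \<Rightarrow> 'a set \<Rightarrow> ('a \<Rightarrow> 'a \<Rightarrow> real) \<Rightarrow> ('a \<Rightarrow> real) \<Rightarrow>
    ('a \<Rightarrow> real) \<Rightarrow> bool" where
  "vsub \<Omega> \<nu> E H f u \<longleftrightarrow>
     (\<forall>\<phi> G. C1_with_gradient_on (closure \<Omega>) \<phi> G \<longrightarrow>
        (\<forall>\<delta>>0. \<forall>x\<in>E. (\<forall>y\<in>closure \<Omega>. u y - \<phi> y \<le> u x - \<phi> x) \<longrightarrow>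
           - nonlocal_op \<Omega> \<nu> (ball 0 \<delta>) \<phi> x - nonlocal_op \<Omega> \<nu> (- ball 0 \<delta>) u x + H x (G x) \<le> f x))"

lemma vsubD:
  assumes "vsub \<Omega> \<nu> E H f u" "C1_with_gradient_on (closure \<Omega>) \<phi> G" "\<delta> > 0" "x \<in> E"
    "\<And>y. y \<in> closure \<Omega> \<Longrightarrow> u y - \<phi> y \<le> u x - \<phi> x"
  shows "- nonlocal_op \<Omega> \<nu> (ball 0 \<delta>) \<phi> x - nonlocal_op \<Omega> \<nu> (- ball 0 \<delta>) u x + H x (G x) \<le> f x"
  using assms unfolding vsub_def by blast

lemma viscosity_subsolution_iff_vsub:
  "viscosity_subsolution \<Omega> \<nu> H c u \<longleftrightarrow> vsub \<Omega> \<nu> \<Omega> H (\<lambda>_. c) u"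
  unfolding viscosity_subsolution_def vsub_def ..

lemma nonlocal_op_minus: "nonlocal_op \<Omega> \<nu> D (\<lambda>x. - u x) y = - nonlocal_op \<Omega> \<nu> D u y"
proof -
  show ?thesis unfolding nonlocal_op_def set_lebesgue_integral_def integral_minus[symmetric]
    by (rule Bochner_Integration.integral_cong) (auto simp: algebra_simps)
qed

lemma nonlocal_op_add_const: "nonlocal_op \<Omega> \<nu> D (\<lambda>x. u x + c) y = nonlocal_op \<Omega> \<nu> D u y"
  unfolding nonlocal_op_def by simp

text \<open>Passing to \<open>- u\<close> turns minima into maxima and negates the test function,
  hence its gradient. Stability then needs to be proved for \<open>vsub\<close> only, with the
  boundary points included through \<open>E\<close>.\<close>

lemma viscosity_supersolution_iff_vsub:
  "viscosity_supersolution \<Omega> \<nu> H c u \<longleftrightarrow>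
     vsub \<Omega> \<nu> (closure \<Omega>) (\<lambda>x p. - H x (- p)) (\<lambda>_. - c) (\<lambda>x. - u x)"
proof
  assume L: "viscosity_supersolution \<Omega> \<nu> H c u"
  show "vsub \<Omega> \<nu> (closure \<Omega>) (\<lambda>x p. - H x (- p)) (\<lambda>_. - c) (\<lambda>x. - u x)"
    unfolding vsub_def
  proof (intro allI impI ballI)
    fix \<phi> G \<delta> x
    assume *: "C1_with_gradient_on (closure \<Omega>) \<phi> G" "(0::real) < \<delta>" "x \<in> closure \<Omega>"
      "\<forall>y\<in>closure \<Omega>. - u y - \<phi> y \<le> - u x - \<phi> x"
    then have "c \<le> - nonlocal_op \<Omega> \<nu> (ball 0 \<delta>) (\<lambda>x. - \<phi> x) x
        - nonlocal_op \<Omega> \<nu> (- ball 0 \<delta>) u x + H x (- G x)"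
      using L[unfolded viscosity_supersolution_def, rule_format,
          OF C1_with_gradient_on_minus[OF *(1)], of \<delta> x] by fastforce
    then show "- nonlocal_op \<Omega> \<nu> (ball 0 \<delta>) \<phi> x - nonlocal_op \<Omega> \<nu> (- ball 0 \<delta>) (\<lambda>x. - u x) x +
        - H x (- G x) \<le> - c"
      by (simp add: nonlocal_op_minus)
  qed
next
  assume R: "vsub \<Omega> \<nu> (closure \<Omega>) (\<lambda>x p. - H x (- p)) (\<lambda>_. - c) (\<lambda>x. - u x)"
  show "viscosity_supersolution \<Omega> \<nu> H c u"
    unfolding viscosity_supersolution_def
  proof (intro allI impI ballI)
    fix \<phi> G \<delta> x
    assume *: "C1_with_gradient_on (closure \<Omega>) \<phi> G" "(0::real) < \<delta>" "x \<in> closure \<Omega>"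
      "\<forall>y\<in>closure \<Omega>. u x - \<phi> x \<le> u y - \<phi> y"
    have "- nonlocal_op \<Omega> \<nu> (ball 0 \<delta>) (\<lambda>x. - \<phi> x) x - nonlocal_op \<Omega> \<nu> (- ball 0 \<delta>) (\<lambda>x. - u x) x
      + - H x (- (- G x)) \<le> - c"
      by (rule vsubD[OF R C1_with_gradient_on_minus[OF *(1)] *(2,3)]) (use *(4) in force)
    then show "c \<le> - nonlocal_op \<Omega> \<nu> (ball 0 \<delta>) \<phi> x - nonlocal_op \<Omega> \<nu> (- ball 0 \<delta>) u x + H x (G x)"
      by (simp add: nonlocal_op_minus)
  qed
qed

lemma vsub_add_const:
  assumes "vsub \<Omega> \<nu> E H f u" shows "vsub \<Omega> \<nu> E H f (\<lambda>x. u x + c)"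
  using assms unfolding vsub_def nonlocal_op_add_const by simp

text \<open>The suprema are unfolded into pointwise bounds with fixed constants. (M2) enters at
  exponent 1, admissible because \<open>\<sigma> < 1\<close>: near jumps of test functions are
  compared with multiples of \<open>norm z\<close>.\<close>

locale jump_setting =
  fixes \<Omega> :: "'a::euclidean_space set" and \<nu> :: "'a \<Rightarrow> 'a measure" and \<sigma> C\<^sub>1 C\<^sub>2 \<rho> :: real
  assumes open_\<Omega>: "open \<Omega>" and bounded_\<Omega>: "bounded \<Omega>" and connected_\<Omega>: "connected \<Omega>"
    and nonempty_\<Omega>: "\<Omega> \<noteq> {}"
    and \<rho>: "0 < \<rho>" "\<rho> \<le> 1" and cone: "uniform_cone \<Omega> \<rho>"
    and \<sigma>: "0 < \<sigma>" "\<sigma> < 1" and C\<^sub>1: "C\<^sub>1 > 0" and C\<^sub>2: "C\<^sub>2 > 0"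
    and sets_\<nu>: "x \<in> closure \<Omega> \<Longrightarrow> sets (\<nu> x) = sets borel"
    and M0: "cond_M0 \<Omega> \<nu>"
    and M1: "x \<in> closure \<Omega> \<Longrightarrow> 0 \<le> \<beta> \<Longrightarrow> \<beta> \<le> 2 \<Longrightarrow> \<delta> > 0 \<Longrightarrow>
      (\<integral>\<^sup>+z\<in>- ball 0 \<delta>. ennreal (min 1 (norm z powr \<beta>)) \<partial>\<nu> x) \<le> ennreal (C\<^sub>1 * h_fun \<beta> \<sigma> \<delta>)"
    and M2: "x \<in> closure \<Omega> \<Longrightarrow> 0 < \<delta> \<Longrightarrow> \<delta> < 1 \<Longrightarrow>
      (\<integral>\<^sup>+z\<in>ball 0 \<delta>. ennreal (norm z) \<partial>\<nu> x) \<le> ennreal (C\<^sub>2 * \<delta> powr (1 - \<sigma>))"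
begin

abbreviation C where "C \<equiv> closure \<Omega>"
abbreviation I where "I \<equiv> nonlocal_op \<Omega> \<nu>"
abbreviation jumps where "jumps D x \<equiv> {z \<in> D. x + z \<in> C}"

text \<open>The summand 1 ensures \<open>Dm \<ge> 1\<close>, so that truncating powers as in (M1)
  costs at most the factor \<open>Dm\<close> on jumps that stay in \<open>C\<close>.\<close>

definition "Dm = 1 + diameter C"

lemma compact_C: "compact C" using bounded_\<Omega> by simp

lemma \<Omega>_sub_C: "\<Omega> \<subseteq> C" by (rule closure_subset)

lemma nonempty_C: "C \<noteq> {}" using nonempty_\<Omega> by simp

lemma Dm: "Dm \<ge> 1" "x \<in> C \<Longrightarrow> y \<in> C \<Longrightarrow> norm (x - y) \<le> Dm"
proof -
  have "bounded C" using bounded_\<Omega> by (rule bounded_closure)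
  then show "Dm \<ge> 1" "x \<in> C \<Longrightarrow> y \<in> C \<Longrightarrow> norm (x - y) \<le> Dm"
    using diameter_ge_0[of C] diameter_bounded_bound[of C x y] by (auto simp: Dm_def dist_norm)
qed

lemma jumps_measurable: "x \<in> C \<Longrightarrow> D \<in> sets borel \<Longrightarrow> jumps D x \<in> sets (\<nu> x)"
proof -
  assume x: "x \<in> C" and D: "D \<in> sets borel"
  have "closed {z. x + z \<in> C}"
    using continuous_closed_vimage[OF closed_closure, of "\<lambda>z. x + z" \<Omega>]
    by (auto simp: vimage_def intro!: continuous_intros)
  then have "{z. x + z \<in> C} \<in> sets borel" by simp
  then have "D \<inter> {z. x + z \<in> C} \<in> sets borel" using D by blast
  then show ?thesis using x by (simp add: sets_\<nu> Int_def)
qed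

lemma continuous_measurable_shift:
  fixes u :: "'a \<Rightarrow> real"
  assumes "continuous_on C u" "x \<in> C" "D \<in> sets borel"
  shows "(\<lambda>z. indicat_real (jumps D x) z *\<^sub>R (u (x + z) - u x)) \<in> borel_measurable (\<nu> x)"
proof -
  have cl: "closed {z. x + z \<in> C}"
    using continuous_closed_vimage[OF closed_closure, of "\<lambda>z. x + z" \<Omega>]
    by (auto simp: vimage_def intro!: continuous_intros)
  have "(\<lambda>z. indicat_real {z. x + z \<in> C} z *\<^sub>R (u (x + z) - u x)) \<in> borel_measurable borel"
  proof (rule borel_measurable_continuous_on_indicator)
    show "continuous_on {z. x + z \<in> C} (\<lambda>z. u (x + z) - u x)"
      by (intro continuous_intros continuous_on_compose2[OF assms(1)]) auto
  qed (use cl in auto)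
  then have "(\<lambda>z. indicat_real D z *\<^sub>R (indicat_real {z. x + z \<in> C} z *\<^sub>R (u (x + z) - u x))) \<in> borel_measurable borel"
    using assms(3) by measurable
  moreover have "(\<lambda>z. indicat_real D z *\<^sub>R (indicat_real {z. x + z \<in> C} z *\<^sub>R (u (x + z) - u x))) =
     (\<lambda>z. indicat_real (jumps D x) z *\<^sub>R (u (x + z) - u x))"
    by (auto simp: indicator_def)
  ultimately show ?thesis using sets_\<nu>[OF assms(2)] by (simp cong: measurable_cong_sets)
qed

section \<open>Estimates for near and far jumps\<close>

lemma nn_integral_cmult_borel:
  assumes "x \<in> C" "g \<in> borel_measurable borel" "A \<in> sets borel"
  shows "(\<integral>\<^sup>+z. k * (g z * indicator A z) \<partial>\<nu> x) = k * (\<integral>\<^sup>+z\<in>A. g z \<partial>\<nu> x)"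
proof (rule nn_integral_cmult)
  have "(\<lambda>z. g z * indicator A z) \<in> borel_measurable borel" using assms by measurable
  then show "(\<lambda>z. g z * indicator A z) \<in> borel_measurable (\<nu> x)"
    using sets_\<nu>[OF assms(1)] by (simp cong: measurable_cong_sets)
qed

lemma mass_far:
  assumes "x \<in> C" "\<delta> > 0" "D \<subseteq> - ball 0 \<delta>" "q \<ge> 0"
  shows "(\<integral>\<^sup>+z\<in>jumps D x. ennreal q \<partial>\<nu> x) \<le> ennreal (q * (C\<^sub>1 * \<delta> powr (-\<sigma>)))"
proof -
  have "(\<integral>\<^sup>+z\<in>jumps D x. ennreal q \<partial>\<nu> x)
      \<le> (\<integral>\<^sup>+z. ennreal q * (ennreal (min 1 (norm z powr 0)) * indicator (- ball 0 \<delta>) z) \<partial>\<nu> x)"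
    using assms by (intro nn_integral_mono) (auto simp: indicator_def split: if_splits)
  also have "\<dots> = ennreal q * (\<integral>\<^sup>+z\<in>- ball 0 \<delta>. ennreal (min 1 (norm z powr 0)) \<partial>\<nu> x)"
    by (intro nn_integral_cmult_borel) (use assms in auto)
  also have "\<dots> \<le> ennreal q * ennreal (C\<^sub>1 * h_fun 0 \<sigma> \<delta>)"
    using assms by (intro mult_left_mono M1) auto
  also have "\<dots> = ennreal (q * (C\<^sub>1 * \<delta> powr (-\<sigma>)))"
    using \<sigma> assms by (simp add: h_fun_def ennreal_mult')
  finally show ?thesis .
qed

text \<open>(M0) is stated on balls; it is applied on the unit ball about each point, and
  continuity, being local, holds on all of \<open>C\<close>.\<close>

lemma integrable_C1:
  assumes "C1_with_gradient_on C \<phi> G" "x \<in> C" "D \<in> sets borel"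
  shows "set_integrable (\<nu> x) (jumps D x) (\<lambda>z. \<phi> (x + z) - \<phi> x)"
    and continuous_C1: "continuous_on C (I D \<phi>)"
proof -
  have c: "continuous_on C \<phi>" using C1_with_gradient_on_continuous[OF assms(1)] .
  have meas: "\<phi> \<in> borel_measurable (restrict_space borel C)"
    by (rule borel_measurable_continuous_on_restrict[OF c])
  have bd: "bounded (\<phi> ` C)" by (intro compact_imp_bounded compact_continuous_image c compact_C)
  have C1: "C1_on (ball x 1 \<inter> C) \<phi>" for x
    using C1_with_gradient_on_subset[OF assms(1)] unfolding C1_on_def by blast
  have *: "set_integrable (\<nu> x) {z. x + z \<in> C} (\<lambda>z. \<phi> (x + z) - \<phi> x) \<and>
     (\<forall>D\<in>sets borel. continuous_on (ball x 1 \<inter> C) (I D \<phi>))" if "x \<in> C" for x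
    using M0 meas bd C1 that zero_less_one unfolding cond_M0_def by blast
  show "set_integrable (\<nu> x) (jumps D x) (\<lambda>z. \<phi> (x + z) - \<phi> x)"
    by (rule set_integrable_subset[OF conjunct1[OF *[OF assms(2)]]])
      (use jumps_measurable[OF assms(2,3)] in auto)
  show "continuous_on C (I D \<phi>)"
    unfolding continuous_on_eq_continuous_within
  proof
    fix y assume y: "y \<in> C"
    then have "continuous_on (ball y 1 \<inter> C) (I D \<phi>)" using * assms(3) by blast
    then have "continuous (at y within (ball y 1 \<inter> C)) (I D \<phi>)"
      using y by (simp add: continuous_on_eq_continuous_within)
    then show "continuous (at y within C) (I D \<phi>)"
      using at_within_nhd[of y "ball y 1" "ball y 1 \<inter> C" C] by (simp add: Int_ac)
  qed
qed

lemma integrable_far: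
  fixes u :: "'a \<Rightarrow> real"
  assumes "continuous_on C u" "x \<in> C" "D \<in> sets borel" "\<delta> > 0" "D \<subseteq> - ball 0 \<delta>"
  shows "set_integrable (\<nu> x) (jumps D x) (\<lambda>z. u (x + z) - u x)"
proof -
  have "bounded (u ` C)" by (intro compact_imp_bounded compact_continuous_image assms(1) compact_C)
  then obtain B where B: "B > 0" "\<And>y. y \<in> C \<Longrightarrow> \<bar>u y\<bar> \<le> B"
    by (metis bounded_pos imageI real_norm_def)
  let ?f = "\<lambda>z. indicat_real (jumps D x) z *\<^sub>R (u (x + z) - u x)"
  have "(\<integral>\<^sup>+z. ennreal (norm (?f z)) \<partial>\<nu> x) \<le> (\<integral>\<^sup>+z\<in>jumps D x. ennreal (2 * B) \<partial>\<nu> x)"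
    using B(2)[OF assms(2)] B(2)
    by (intro nn_integral_mono) (auto simp: indicator_def intro!: ennreal_leI; smt (verit))
  also have "\<dots> \<le> ennreal (2 * B * (C\<^sub>1 * \<delta> powr (-\<sigma>)))"
    using B by (intro mass_far assms) auto
  also have "\<dots> < \<infinity>" by simp
  finally show ?thesis unfolding set_integrable_def
    by (intro integrableI_bounded continuous_measurable_shift assms)
qed

text \<open>An error \<open>q\<close> in the increments costs \<open>q\<close> times the mass of the
  far jumps. With \<open>q = 0\<close> this is monotonicity; with small \<open>q\<close> it controls
  approximations.\<close>

lemma I_far_le:
  assumes u: "continuous_on C u" and v: "continuous_on C v" and x: "x \<in> C"
    and D: "D \<in> sets borel" "\<delta> > 0" "D \<subseteq> - ball 0 \<delta>" and q: "q \<ge> 0"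
    and le: "\<And>z. z \<in> D \<Longrightarrow> x + z \<in> C \<Longrightarrow> v (x + z) - v x \<le> u (x + z) - u x + q"
  shows "I D v x \<le> I D u x + q * (C\<^sub>1 * \<delta> powr (-\<sigma>))"
proof -
  have "I D v x - I D u x = (LINT z:jumps D x|\<nu> x. (v (x + z) - v x) - (u (x + z) - u x))"
    unfolding nonlocal_op_def
    by (rule set_integral_diff(2)[symmetric]) (intro integrable_far[OF _ x D] u v)+
  also have "\<dots> \<le> q * (C\<^sub>1 * \<delta> powr (-\<sigma>))"
  proof (rule set_integral_le_of_nn_integral[where g="\<lambda>_. q"])
    show "v (x + z) - v x - (u (x + z) - u x) \<le> q" if "z \<in> jumps D x" for z
      using le[of z] that by auto
    show "(\<integral>\<^sup>+z\<in>jumps D x. ennreal q \<partial>\<nu> x) \<le> ennreal (q * (C\<^sub>1 * \<delta> powr (-\<sigma>)))"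
      by (rule mass_far[OF x D(2,3) q])
  qed (use q C\<^sub>1 in auto)
  finally show ?thesis by simp
qed

lemma I_near_le:
  assumes x: "x \<in> C" and \<delta>: "0 < \<delta>" "\<delta> < 1" and K: "K \<ge> 0"
    and le: "\<And>z. norm z < \<delta> \<Longrightarrow> x + z \<in> C \<Longrightarrow> \<phi> (x + z) - \<phi> x \<le> K * norm z"
  shows "I (ball 0 \<delta>) \<phi> x \<le> K * (C\<^sub>2 * \<delta> powr (1 - \<sigma>))"
  unfolding nonlocal_op_def
proof (rule set_integral_le_of_nn_integral[where g="\<lambda>z. K * norm z"])
  have "(\<integral>\<^sup>+z\<in>jumps (ball 0 \<delta>) x. ennreal (K * norm z) \<partial>\<nu> x)
      \<le> (\<integral>\<^sup>+z. ennreal K * (ennreal (norm z) * indicator (ball 0 \<delta>) z) \<partial>\<nu> x)"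
    using K by (intro nn_integral_mono) (auto simp: indicator_def ennreal_mult' split: if_splits)
  also have "\<dots> = ennreal K * (\<integral>\<^sup>+z\<in>ball 0 \<delta>. ennreal (norm z) \<partial>\<nu> x)"
    by (intro nn_integral_cmult_borel) (use x in auto)
  also have "\<dots> \<le> ennreal K * ennreal (C\<^sub>2 * \<delta> powr (1 - \<sigma>))"
    using x \<delta> by (intro mult_left_mono M2) auto
  also have "\<dots> = ennreal (K * (C\<^sub>2 * \<delta> powr (1 - \<sigma>)))"
    using K by (simp add: ennreal_mult')
  finally show "(\<integral>\<^sup>+z\<in>jumps (ball 0 \<delta>) x. ennreal (K * norm z) \<partial>\<nu> x)
     \<le> ennreal (K * (C\<^sub>2 * \<delta> powr (1 - \<sigma>)))" .
qed (use le K C\<^sub>2 in auto)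

lemma I_far_power_le:
  assumes x: "x \<in> C" and \<delta>: "0 < \<delta>" and \<gamma>: "0 \<le> \<gamma>" "\<gamma> \<le> 1" and N: "N \<ge> 0"
    and le: "\<And>z. norm z \<ge> \<delta> \<Longrightarrow> x + z \<in> C \<Longrightarrow> u (x + z) - u x \<le> N * norm z powr \<gamma>"
  shows "I (- ball 0 \<delta>) u x \<le> N * Dm * (C\<^sub>1 * h_fun \<gamma> \<sigma> \<delta>)"
  unfolding nonlocal_op_def
proof (rule set_integral_le_of_nn_integral[where g="\<lambda>z. N * Dm * min 1 (norm z powr \<gamma>)"])
  have D0: "Dm \<ge> 0" using Dm(1) by simp
  fix z assume "z \<in> jumps (- ball 0 \<delta>) x"
  then have z: "norm z \<ge> \<delta>" "x + z \<in> C" by auto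
  have zD: "norm z \<le> Dm" using Dm(2)[OF z(2) x] by simp
  have "norm z powr \<gamma> \<le> Dm * min 1 (norm z powr \<gamma>)"
  proof (cases "norm z \<le> 1")
    case True
    then have "norm z powr \<gamma> \<le> 1" using \<gamma> by (simp add: powr_le1)
    then show ?thesis using Dm(1) by (simp add: mult_le_cancel_right1)
  next
    case False
    then have "norm z powr \<gamma> \<ge> 1" using \<gamma> by (simp add: ge_one_powr_ge_zero)
    moreover have "norm z powr \<gamma> \<le> norm z powr 1" using False \<gamma> by (intro powr_mono) auto
    ultimately show ?thesis using zD False by (simp add: min_def)
  qed
  then have "N * norm z powr \<gamma> \<le> N * (Dm * min 1 (norm z powr \<gamma>))" using N by (intro mult_left_mono)
  then show "u (x + z) - u x \<le> N * Dm * min 1 (norm z powr \<gamma>)"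
    using le[OF z] by (simp add: mult_ac)
next
  have ND: "N * Dm \<ge> 0" using N Dm(1) by simp
  have "(\<integral>\<^sup>+z\<in>jumps (- ball 0 \<delta>) x. ennreal (N * Dm * min 1 (norm z powr \<gamma>)) \<partial>\<nu> x)
      \<le> (\<integral>\<^sup>+z. ennreal (N * Dm) * (ennreal (min 1 (norm z powr \<gamma>)) * indicator (- ball 0 \<delta>) z) \<partial>\<nu> x)"
    using ND by (intro nn_integral_mono) (auto simp: indicator_def ennreal_mult' split: if_splits)
  also have "\<dots> = ennreal (N * Dm) * (\<integral>\<^sup>+z\<in>- ball 0 \<delta>. ennreal (min 1 (norm z powr \<gamma>)) \<partial>\<nu> x)"
    by (intro nn_integral_cmult_borel) (use x in auto)
  also have "\<dots> \<le> ennreal (N * Dm) * ennreal (C\<^sub>1 * h_fun \<gamma> \<sigma> \<delta>)"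
    using x \<delta> \<gamma> by (intro mult_left_mono M1) auto
  also have "\<dots> = ennreal (N * Dm * (C\<^sub>1 * h_fun \<gamma> \<sigma> \<delta>))"
    using ND by (simp add: ennreal_mult')
  finally show "(\<integral>\<^sup>+z\<in>jumps (- ball 0 \<delta>) x. ennreal (N * Dm * min 1 (norm z powr \<gamma>)) \<partial>\<nu> x)
      \<le> ennreal (N * Dm * (C\<^sub>1 * h_fun \<gamma> \<sigma> \<delta>))" .
next
  show "0 \<le> N * Dm * (C\<^sub>1 * h_fun \<gamma> \<sigma> \<delta>)" using N Dm(1) C\<^sub>1 by (auto simp: h_fun_def)
qed

text \<open>Stone-Weierstrass for the algebra of functions that are C1 up to the boundary; squared
  distances separate points.\<close>

lemma C1_dense:
  assumes "continuous_on C u" "e > 0"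
  obtains w G where "C1_with_gradient_on C w G" "\<And>x. x \<in> C \<Longrightarrow> \<bar>u x - w x\<bar> < e"
proof -
  have "\<exists>w. C1_on C w \<and> (\<forall>x\<in>C. \<bar>u x - w x\<bar> < e)"
  proof (rule Stone_Weierstrass_HOL[OF compact_C _ _ _ _ _ assms])
    show "C1_on C (\<lambda>x. c)" for c using C1_with_gradient_on_const unfolding C1_on_def by blast
    show "continuous_on C f" if "C1_on C f" for f
      using that C1_with_gradient_on_continuous unfolding C1_on_def by blast
    show "C1_on C (\<lambda>x. f x + g x)" if "C1_on C f \<and> C1_on C g" for f g
      using that C1_with_gradient_on_add unfolding C1_on_def by blast
    show "C1_on C (\<lambda>x. f x * g x)" if fg: "C1_on C f \<and> C1_on C g" for f g
    proof -
      obtain F G where F: "C1_with_gradient_on C f F" and G: "C1_with_gradient_on C g G"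
        using fg unfolding C1_on_def by blast
      have "C1_with_gradient_on C (\<lambda>x. f x * g x) (\<lambda>x. f x *\<^sub>R G x + g x *\<^sub>R F x)"
        using F G C1_with_gradient_on_continuous[OF F] C1_with_gradient_on_continuous[OF G]
        unfolding C1_with_gradient_on_def
        by (auto intro!: continuous_intros derivative_eq_intros simp: inner_add_left algebra_simps)
      then show ?thesis unfolding C1_on_def by blast
    qed
    show "\<exists>f. C1_on C f \<and> f x \<noteq> f y" if "x \<in> C \<and> y \<in> C \<and> x \<noteq> y" for x y
      using that C1_with_gradient_on_sqnorm[of C x] unfolding C1_on_def
      by (intro exI[of _ "\<lambda>w. norm (w - x) ^ 2"]) auto
  qed
  then show ?thesis using that unfolding C1_on_def by blast
qed

text \<open>The mass of the far jumps is bounded uniformly in the base point, so uniform convergence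
  of the approximations passes to the operator.\<close>

lemma continuous_far:
  assumes u: "continuous_on C u" and D: "D \<in> sets borel" "\<delta> > 0" "D \<subseteq> - ball 0 \<delta>"
  shows "continuous_on C (I D u)"
proof -
  have "\<exists>w G. C1_with_gradient_on C w G \<and> (\<forall>x\<in>C. \<bar>u x - w x\<bar> < inverse (real (Suc n)))" for n
    using C1_dense[OF u, of "inverse (real (Suc n))"] by (metis inverse_positive_iff_positive of_nat_0_less_iff zero_less_Suc)
  then obtain w G where w: "\<And>n. C1_with_gradient_on C (w n) (G n)"
    "\<And>n x. x \<in> C \<Longrightarrow> \<bar>u x - w n x\<bar> < inverse (real (Suc n))" by metis
  have bd: "\<bar>I D (w n) x - I D u x\<bar> \<le> inverse (real (Suc n)) * (2 * (C\<^sub>1 * \<delta> powr (-\<sigma>)))"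
    if x: "x \<in> C" for n x
  proof -
    let ?q = "2 * inverse (real (Suc n))"
    have *: "\<bar>(u (x + z) - u x) - (w n (x + z) - w n x)\<bar> \<le> ?q" if "x + z \<in> C" for z
      using w(2)[OF x, of n] w(2)[OF that, of n] by linarith
    have cw: "continuous_on C (w n)" using w(1) C1_with_gradient_on_continuous by blast
    have "I D (w n) x \<le> I D u x + ?q * (C\<^sub>1 * \<delta> powr (-\<sigma>))"
    proof (rule I_far_le[OF u cw x D])
      show "w n (x + z) - w n x \<le> u (x + z) - u x + ?q" if "x + z \<in> C" for z
        using *[OF that] by linarith
    qed simp
    moreover have "I D u x \<le> I D (w n) x + ?q * (C\<^sub>1 * \<delta> powr (-\<sigma>))"
    proof (rule I_far_le[OF cw u x D])
      show "u (x + z) - u x \<le> w n (x + z) - w n x + ?q" if "x + z \<in> C" for z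
        using *[OF that] by linarith
    qed simp
    ultimately show ?thesis by (simp add: abs_le_iff)
  qed
  have "uniform_limit C (\<lambda>n x. I D (w n) x) (I D u) sequentially"
  proof (rule uniform_limitI)
    fix e :: real assume e: "e > 0"
    have "(\<lambda>n. inverse (real (Suc n)) * (2 * (C\<^sub>1 * \<delta> powr (-\<sigma>)))) \<longlonglongrightarrow> 0 * (2 * (C\<^sub>1 * \<delta> powr (-\<sigma>)))"
      by (intro tendsto_intros LIMSEQ_inverse_real_of_nat)
    then have "\<forall>\<^sub>F n in sequentially. inverse (real (Suc n)) * (2 * (C\<^sub>1 * \<delta> powr (-\<sigma>))) < e"
      using e by (intro order_tendstoD) auto
    then show "\<forall>\<^sub>F n in sequentially. \<forall>x\<in>C. dist (I D (w n) x) (I D u x) < e"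
    proof eventually_elim
      case (elim n)
      then show ?case using bd unfolding dist_real_def by (meson le_less_trans)
    qed
  qed
  moreover obtain x0 where x0: "x0 \<in> C" using nonempty_C by (meson ex_in_conv)
  have "continuous_on C (I D (w n))" for n
    using continuous_C1[OF w(1) x0 D(1)] .
  ultimately show ?thesis by (intro uniform_limit_theorem[where f="\<lambda>n x. I D (w n) x" and F=sequentially]) auto
qed

end

section \<open>Lipschitz regularity of subsolutions\<close>

text \<open>This bounds the near jumps of smoothed cones by slope times \<open>norm z\<close>,
  independently of \<open>\<tau>\<close>.\<close>

lemma soft_norm_triangle:
  fixes a b :: "'a::real_normed_vector"
  shows "sqrt (norm a ^ 2 + \<tau>\<^sup>2) \<le> sqrt (norm b ^ 2 + \<tau>\<^sup>2) + norm (a - b)"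
proof -
  let ?s = "sqrt (norm b ^ 2 + \<tau>\<^sup>2)"
  have s: "norm b \<le> ?s" "?s ^ 2 = norm b ^ 2 + \<tau>\<^sup>2" "?s \<ge> 0"
    by (auto simp: real_le_rsqrt)
  have "norm a \<le> norm b + norm (a - b)" by (metis add.commute diff_add_cancel norm_triangle_ineq)
  then have "norm a ^ 2 \<le> (norm b + norm (a - b)) ^ 2" by (intro power_mono) auto
  also have "\<dots> = norm b ^ 2 + norm (a - b) ^ 2 + 2 * (norm b * norm (a - b))"
    by (simp add: power2_eq_square algebra_simps)
  also have "\<dots> \<le> norm b ^ 2 + norm (a - b) ^ 2 + 2 * (?s * norm (a - b))"
    using mult_right_mono[OF s(1), of "norm (a - b)"] by simp
  finally have "norm a ^ 2 + \<tau>\<^sup>2 \<le> ?s ^ 2 + norm (a - b) ^ 2 + 2 * (?s * norm (a - b))"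
    using s(2) by linarith
  also have "\<dots> = (?s + norm (a - b)) ^ 2" by (simp only: power2_eq_square algebra_simps)
  finally show ?thesis using s(3) by (intro real_le_lsqrt) auto
qed

text \<open>Once \<open>A powr (m-1)\<close> exceeds the threshold \<open>T\<close>, the power
  absorbs \<open>(P + Q + 1) * A\<close>. The argument \<open>A/2\<close> anticipates that the
  contact slope in \<open>interior_increment_bound\<close> is at least half the nominal one.\<close>

lemma superlinear_beats_affine:
  fixes c m P Q :: real
  assumes "c > 0" "m > 1" "P \<ge> 0" "Q \<ge> 0"
  obtains A\<^sub>0 where "A\<^sub>0 \<ge> 1" "\<And>A. A \<ge> A\<^sub>0 \<Longrightarrow> c * (A/2) powr m > P + Q * A"
proof -
  define T where "T = 2 powr m * (P + Q + 1) / c"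
  have T: "T > 0" using assms by (simp add: T_def)
  define A\<^sub>0 where "A\<^sub>0 = max 1 (T powr (1/(m-1)))"
  have "c * (A/2) powr m > P + Q * A" if A: "A \<ge> A\<^sub>0" for A
  proof -
    have A1: "A \<ge> 1" using A by (simp add: A\<^sub>0_def)
    have "T = (T powr (1/(m-1))) powr (m-1)" using T assms by (simp add: powr_powr)
    also have "\<dots> \<le> A powr (m-1)" using A assms by (intro powr_mono2) (auto simp: A\<^sub>0_def)
    finally have "T * A \<le> A powr (m-1) * A" using A1 by (intro mult_right_mono) auto
    also have "\<dots> = A powr m" using powr_add[of A "m-1" 1] A1 by simp
    finally have "2 powr m * (P + Q + 1) * A \<le> c * A powr m"
      using assms by (simp add: T_def field_simps)
    moreover have "(A/2) powr m = A powr m / 2 powr m" using A1 by (simp add: powr_divide)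
    ultimately have "(P + Q + 1) * A \<le> c * (A/2) powr m"
      by (simp add: pos_le_divide_eq mult_ac)
    moreover have "P \<le> P * A" using A1 assms by (simp add: mult_le_cancel_left1)
    ultimately show ?thesis using A1 by (simp add: algebra_simps)
  qed
  then show ?thesis by (intro that[of A\<^sub>0]) (auto simp: A\<^sub>0_def)
qed

locale coercive_setting = jump_setting \<Omega> \<nu> \<sigma> C\<^sub>1 C\<^sub>2 \<rho>
  for \<Omega> :: "'a::euclidean_space set" and \<nu> :: "'a \<Rightarrow> 'a measure" and \<sigma> C\<^sub>1 C\<^sub>2 \<rho> :: real +
  fixes H :: "'a \<Rightarrow> 'a \<Rightarrow> real" and m c\<^sub>H C\<^sub>H :: real
  assumes H_cont: "continuous_on (closure \<Omega> \<times> UNIV) (\<lambda>(x, p). H x p)"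
    and m: "m > 1" and c\<^sub>H: "c\<^sub>H > 0" and C\<^sub>H: "C\<^sub>H \<ge> 0"
    and coercive: "x \<in> closure \<Omega> \<Longrightarrow> H x p \<ge> c\<^sub>H * norm p powr m - C\<^sub>H"
begin

text \<open>
  Touching from above by a smoothed cone with vertex \<open>x\<close>; the quadratic term keeps the contact
  point inside \<open>ball x r\<close>, hence inside \<open>\<Omega>\<close>, where the equation forces the slope to be small.
\<close>

lemma interior_increment_bound:
  assumes cu: "continuous_on C u" and sub: "vsub \<Omega> \<nu> \<Omega> H f u"
    and f: "\<And>x. x \<in> \<Omega> \<Longrightarrow> f x \<le> C\<^sub>0" and C\<^sub>0: "C\<^sub>0 \<ge> 0"
    and \<gamma>: "0 \<le> \<gamma>" "\<gamma> \<le> 1" "\<gamma> \<noteq> \<sigma>" and N: "N > 0"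
    and hold: "\<And>x y. x \<in> C \<Longrightarrow> y \<in> C \<Longrightarrow> u y - u x \<le> N * norm (y - x) powr \<gamma>"
    and A: "A \<ge> 1" "c\<^sub>H * (A/2) powr m > C\<^sub>H + C\<^sub>0 + C\<^sub>2 * A + (3 * C\<^sub>2 + Dm * C\<^sub>1) * N"
    and r: "0 < r" "r < 1" "ball x r \<subseteq> \<Omega>" and y: "y \<in> C"
  shows "u y - u x \<le> A * r powr (- (max 0 (\<sigma> - \<gamma>) / m)) * norm (y - x)
           + N * r powr (\<gamma> - 2) * norm (y - x) ^ 2"
proof (rule ccontr)
  define b where "b = max 0 (\<sigma> - \<gamma>)"
  \<comment> \<open>The exponent \<open>b/m\<close> makes \<open>K powr m\<close> grow like
    \<open>R\<close>, which is exactly the rate of the far term in (M1) for increments of order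
    \<open>\<gamma>\<close>.\<close>
  define K where "K = A * r powr (- (b/m))"
  \<comment> \<open>With this \<open>B\<close> the parabola reaches the Hoelder bound
    \<open>N * s powr \<gamma>\<close> at \<open>s = r\<close> and stays above it beyond.\<close>
  define B where "B = N * r powr (\<gamma> - 2)"
  define R where "R = r powr (-b)"
  have b: "b \<ge> 0" "b < 1" using \<sigma> \<gamma> by (auto simp: b_def)
  have K: "K > 0" using A r by (simp add: K_def)
  have B: "B > 0" using N r by (simp add: B_def)
  have R1: "R \<ge> 1" using r b powr_mono'[of "-b" 0 r] by (simp add: R_def)
  have x: "x \<in> \<Omega>" using r by (metis centre_in_ball subsetD)
  then have x: "x \<in> \<Omega>" "x \<in> C" using \<Omega>_sub_C by blast+
  define g where "g = u y - u x - K * norm (y - x) - B * norm (y - x) ^ 2"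
  assume "\<not> ?thesis"
  then have g: "g > 0" by (simp add: g_def K_def B_def b_def)
  obtain s\<^sub>0 where s\<^sub>0: "s\<^sub>0 > 0" "\<And>w. w \<in> C \<Longrightarrow> norm (w - x) < s\<^sub>0 \<Longrightarrow> u w - u x < g/2"
  proof -
    obtain d where "d > 0" "\<And>w. w \<in> C \<Longrightarrow> dist w x < d \<Longrightarrow> dist (u w) (u x) < g/2"
      using cu x g unfolding continuous_on_iff by (meson half_gt_zero)
    note d = this
    show ?thesis
    proof (rule that[OF d(1)])
      show "u w - u x < g/2" if "w \<in> C" "norm (w - x) < d" for w
        using d(2)[of w] that unfolding dist_norm real_norm_def by linarith
    qed
  qed
  \<comment> \<open>One bound keeps the smoothing error below \<open>g/2\<close>; the other puts the
    contact point at distance at least \<open>\<tau>\<close> from the vertex, where the smoothed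
    cone is still steep.\<close>
  define \<tau> where "\<tau> = min s\<^sub>0 (g / (2 * K))"
  have \<tau>: "\<tau> > 0" "\<tau> \<le> s\<^sub>0" "K * \<tau> \<le> g/2" using s\<^sub>0 g K by (auto simp: \<tau>_def min_def field_simps)
  define \<phi> where "\<phi> w = K * sqrt (norm (w - x) ^ 2 + \<tau>\<^sup>2) + B * norm (w - x) ^ 2" for w
  define G where "G w = K *\<^sub>R ((1 / sqrt (norm (w - x) ^ 2 + \<tau>\<^sup>2)) *\<^sub>R (w - x)) + B *\<^sub>R (2 *\<^sub>R (w - x))" for w
  have C1: "C1_with_gradient_on C \<phi> G" unfolding \<phi>_def G_def
    by (intro C1_with_gradient_on_add C1_with_gradient_on_cmult C1_with_gradient_on_soft_norm
        C1_with_gradient_on_sqnorm \<tau>)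
  have "continuous_on C (\<lambda>w. u w - \<phi> w)"
    using cu C1_with_gradient_on_continuous[OF C1] by (intro continuous_intros)
  then obtain y\<^sub>1 where y\<^sub>1: "y\<^sub>1 \<in> C" "\<And>w. w \<in> C \<Longrightarrow> u w - \<phi> w \<le> u y\<^sub>1 - \<phi> y\<^sub>1"
    using continuous_attains_sup[OF compact_C nonempty_C] by blast
  define s where "s = norm (y\<^sub>1 - x)"
  have "sqrt (norm (y - x) ^ 2 + \<tau>\<^sup>2) \<le> norm (y - x) + \<tau>"
    using \<tau> by (intro real_le_lsqrt) (auto simp: power2_eq_square algebra_simps)
  then have "\<phi> y \<le> K * (norm (y - x) + \<tau>) + B * norm (y - x) ^ 2"
    using K unfolding \<phi>_def by (intro add_right_mono mult_left_mono) auto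
  then have "u y - \<phi> y \<ge> u x + g - K * \<tau>" by (simp add: g_def algebra_simps)
  then have inc: "u y\<^sub>1 - u x \<ge> \<phi> y\<^sub>1 + g/2" using y\<^sub>1(2)[OF y] \<tau>(3) by linarith
  have \<phi>y\<^sub>1: "\<phi> y\<^sub>1 \<ge> B * s ^ 2" using K by (simp add: \<phi>_def s_def)
  then have "\<phi> y\<^sub>1 \<ge> 0" using B by (smt (verit) mult_nonneg_nonneg zero_le_power2)
  \<comment> \<open>Within \<open>s\<^sub>0\<close> of the vertex \<open>u\<close> rises by less
    than \<open>g/2\<close>, too little for contact.\<close>
  then have "s \<ge> s\<^sub>0" using s\<^sub>0(2)[OF y\<^sub>1(1)] inc by (force simp: s_def)
  then have s: "s > 0" "\<tau> \<le> s" using \<tau> s\<^sub>0 by auto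
  have "s < r"
  proof (rule ccontr)
    assume "\<not> s < r"
    then have "s powr (\<gamma> - 2) \<le> r powr (\<gamma> - 2)" using r \<gamma> by (intro powr_mono2') auto
    then have "s powr (\<gamma> - 2) * s ^ 2 \<le> r powr (\<gamma> - 2) * s ^ 2" by (intro mult_right_mono) auto
    moreover have "s powr (\<gamma> - 2) * s ^ 2 = s powr \<gamma>"
      using s powr_add[of s "\<gamma> - 2" 2] by simp
    ultimately have "N * s powr \<gamma> \<le> B * s ^ 2" using N by (simp add: B_def mult_left_mono)
    moreover have "u y\<^sub>1 - u x \<le> N * s powr \<gamma>" using hold[OF x(2) y\<^sub>1(1)] by (simp add: s_def)
    ultimately show False using inc \<phi>y\<^sub>1 g by linarith
  qed
  then have y\<^sub>1\<Omega>: "y\<^sub>1 \<in> \<Omega>" using r(3) by (auto simp: s_def dist_norm norm_minus_commute)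
  have eqn: "- I (ball 0 r) \<phi> y\<^sub>1 - I (- ball 0 r) u y\<^sub>1 + H y\<^sub>1 (G y\<^sub>1) \<le> C\<^sub>0"
    using vsubD[OF sub C1 r(1) y\<^sub>1\<Omega> y\<^sub>1(2)] f[OF y\<^sub>1\<Omega>] by linarith
  have near: "I (ball 0 r) \<phi> y\<^sub>1 \<le> (K + 3 * B * r) * (C\<^sub>2 * r powr (1 - \<sigma>))"
  proof (rule I_near_le[OF y\<^sub>1(1) r(1,2)])
    show "0 \<le> K + 3 * B * r" using K B r by simp
    fix z assume z: "norm z < r" "y\<^sub>1 + z \<in> C"
    have "sqrt (norm (y\<^sub>1 + z - x) ^ 2 + \<tau>\<^sup>2) \<le> sqrt (norm (y\<^sub>1 - x) ^ 2 + \<tau>\<^sup>2) + norm z"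
      using soft_norm_triangle[of "y\<^sub>1 + z - x" \<tau> "y\<^sub>1 - x"] by simp
    then have 1: "K * sqrt (norm (y\<^sub>1 + z - x) ^ 2 + \<tau>\<^sup>2) \<le> K * sqrt (norm (y\<^sub>1 - x) ^ 2 + \<tau>\<^sup>2) + K * norm z"
      using K by (metis distrib_left mult_left_mono less_imp_le)
    have "norm (y\<^sub>1 + z - x) \<le> s + norm z"
      using norm_triangle_ineq[of "y\<^sub>1 - x" z] by (simp add: s_def algebra_simps)
    then have "norm (y\<^sub>1 + z - x) ^ 2 \<le> (s + norm z) ^ 2" by (intro power_mono) auto
    also have "\<dots> = s ^ 2 + (2 * s + norm z) * norm z" by (simp add: power2_eq_square algebra_simps)
    also have "\<dots> \<le> s ^ 2 + (3 * r) * norm z"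
      using \<open>s < r\<close> z by (intro add_left_mono mult_right_mono) auto
    finally have "B * norm (y\<^sub>1 + z - x) ^ 2 \<le> B * (s ^ 2 + (3 * r) * norm z)"
      using B by (intro mult_left_mono) auto
    with 1 show "\<phi> (y\<^sub>1 + z) - \<phi> y\<^sub>1 \<le> (K + 3 * B * r) * norm z"
      by (simp add: \<phi>_def s_def algebra_simps)
  qed
  have far: "I (- ball 0 r) u y\<^sub>1 \<le> N * Dm * (C\<^sub>1 * h_fun \<gamma> \<sigma> r)"
  proof (rule I_far_power_le[OF y\<^sub>1(1) r(1) \<gamma>(1,2)])
    show "u (y\<^sub>1 + z) - u y\<^sub>1 \<le> N * norm z powr \<gamma>" if "y\<^sub>1 + z \<in> C" for z
      using hold[OF y\<^sub>1(1) that] by simp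
  qed (use N in auto)
  \<comment> \<open>The parabola's gradient is parallel to that of the cone and can only add to it;
    since \<open>\<tau> \<le> s\<close> the cone contributes at least \<open>K / 2\<close>.\<close>
  have slope: "norm (G y\<^sub>1) \<ge> K / 2"
  proof -
    define q where "q = K / sqrt (s ^ 2 + \<tau>\<^sup>2)"
    have "\<tau>\<^sup>2 \<le> s\<^sup>2" using s \<tau> by (intro power_mono) auto
    then have "s\<^sup>2 + \<tau>\<^sup>2 \<le> 4 * s\<^sup>2" using zero_le_power2[of s] by linarith
    then have "s\<^sup>2 + \<tau>\<^sup>2 \<le> (2 * s)\<^sup>2" by (simp add: power_mult_distrib)
    then have "sqrt (s\<^sup>2 + \<tau>\<^sup>2) \<le> 2 * s" using s by (intro real_le_lsqrt) auto
    moreover have "sqrt (s\<^sup>2 + \<tau>\<^sup>2) > 0" using s by (simp add: add_pos_nonneg)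
    ultimately have q: "q * s \<ge> K / 2" "q > 0" using K s by (auto simp: q_def field_simps)
    have "G y\<^sub>1 = (q + 2 * B) *\<^sub>R (y\<^sub>1 - x)" by (simp add: G_def q_def s_def algebra_simps)
    then have "norm (G y\<^sub>1) = (q + 2 * B) * s" using q B by (simp add: s_def)
    also have "\<dots> \<ge> q * s" using B s by (intro mult_right_mono) auto
    finally show ?thesis using q by linarith
  qed
  have hR: "h_fun \<gamma> \<sigma> r = R"
    using \<gamma> r by (auto simp: h_fun_def R_def b_def max_def)
  have "(K/2) powr m = (A/2) powr m * R"
  proof -
    have "(K/2) powr m = ((A/2) * r powr (- (b/m))) powr m" by (simp add: K_def)
    also have "\<dots> = (A/2) powr m * (r powr (- (b/m))) powr m" using A by (intro powr_mult)
    also have "(r powr (- (b/m))) powr m = R" using m by (simp add: powr_powr R_def)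
    finally show ?thesis .
  qed
  moreover have "(K/2) powr m \<le> norm (G y\<^sub>1) powr m" using slope K m by (intro powr_mono2) auto
  ultimately have "c\<^sub>H * ((A/2) powr m * R) \<le> c\<^sub>H * norm (G y\<^sub>1) powr m"
    using c\<^sub>H by simp
  also have "\<dots> \<le> H y\<^sub>1 (G y\<^sub>1) + C\<^sub>H" using coercive[OF y\<^sub>1(1), of "G y\<^sub>1"] by simp
  also have "\<dots> \<le> C\<^sub>0 + C\<^sub>H + (K + 3 * B * r) * (C\<^sub>2 * r powr (1 - \<sigma>)) + N * Dm * (C\<^sub>1 * R)"
    using eqn near far hR by simp
  \<comment> \<open>Every term is brought to a multiple of the same power \<open>R\<close>, which
    then cancels; what is left contradicts the choice of \<open>A\<close>.\<close>
  also have "(K + 3 * B * r) * (C\<^sub>2 * r powr (1 - \<sigma>)) \<le> C\<^sub>2 * A * R + 3 * C\<^sub>2 * N * R"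
  proof -
    have "K * r powr (1 - \<sigma>) \<le> K * 1" using K r \<sigma> by (intro mult_left_mono powr_le1) auto
    also have "K * 1 \<le> A * R"
    proof -
      have "b / m \<le> b" using b m by (simp add: divide_le_eq mult_le_cancel_left1)
      then have "r powr (- (b/m)) \<le> R" unfolding R_def using r by (intro powr_mono') auto
      then show ?thesis using A by (simp add: K_def)
    qed
    finally have 1: "K * r powr (1 - \<sigma>) \<le> A * R" .
    have "B * r * r powr (1 - \<sigma>) = N * (r powr (\<gamma> - 2) * r powr 1 * r powr (1 - \<sigma>))"
      using r by (simp add: B_def)
    also have "r powr (\<gamma> - 2) * r powr 1 * r powr (1 - \<sigma>) = r powr (\<gamma> - \<sigma>)"
      by (simp only: powr_add[symmetric]) simp
    also have "N * r powr (\<gamma> - \<sigma>) \<le> N * R" unfolding R_def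
      using r N by (intro mult_left_mono powr_mono') (auto simp: b_def)
    finally have 2: "B * r * r powr (1 - \<sigma>) \<le> N * R" .
    have "(K + 3 * B * r) * (C\<^sub>2 * r powr (1 - \<sigma>)) = C\<^sub>2 * (K * r powr (1 - \<sigma>)) + 3 * C\<^sub>2 * (B * r * r powr (1 - \<sigma>))"
      by (simp add: algebra_simps)
    also have "\<dots> \<le> C\<^sub>2 * (A * R) + 3 * C\<^sub>2 * (N * R)"
      using 1 2 C\<^sub>2 by (intro add_mono mult_left_mono) auto
    finally show ?thesis by (simp add: mult_ac)
  qed
  also have "C\<^sub>0 + C\<^sub>H \<le> (C\<^sub>0 + C\<^sub>H) * R" using C\<^sub>0 C\<^sub>H R1 by (simp add: mult_le_cancel_left1)
  finally have "(c\<^sub>H * (A/2) powr m) * R \<le> (C\<^sub>H + C\<^sub>0 + C\<^sub>2 * A + (3 * C\<^sub>2 + Dm * C\<^sub>1) * N) * R"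
    by (simp add: algebra_simps)
  then show False using A(2) R1 by (simp add: mult_le_cancel_right)
qed

text \<open>One turn of the bootstrap, from \<open>\<gamma>\<close> to
  \<open>1 - max 0 (\<sigma> - \<gamma>) / m\<close>. \<open>M\<close> is fixed before
  \<open>u\<close>, \<open>N\<close> and \<open>A\<close>: one caller chooses \<open>A\<close> from
  \<open>N\<close>, the other links them by \<open>N = 2 * M * A\<close>.\<close>

lemma holder_gain:
  assumes \<gamma>: "0 \<le> \<gamma>" "\<gamma> \<le> 1" "\<gamma> \<noteq> \<sigma>"
  obtains M where "M > 0"
    "\<And>u f C\<^sub>0 N A x y. continuous_on C u \<Longrightarrow> vsub \<Omega> \<nu> \<Omega> H f u \<Longrightarrow> (\<And>x. x \<in> \<Omega> \<Longrightarrow> f x \<le> C\<^sub>0) \<Longrightarrow>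
      C\<^sub>0 \<ge> 0 \<Longrightarrow> N > 0 \<Longrightarrow>
      (\<And>x y. x \<in> C \<Longrightarrow> y \<in> C \<Longrightarrow> u y - u x \<le> N * norm (y - x) powr \<gamma>) \<Longrightarrow>
      A \<ge> 1 \<Longrightarrow> c\<^sub>H * (A/2) powr m > C\<^sub>H + C\<^sub>0 + C\<^sub>2 * A + (3 * C\<^sub>2 + Dm * C\<^sub>1) * N \<Longrightarrow>
      x \<in> C \<Longrightarrow> y \<in> C \<Longrightarrow> \<bar>u x - u y\<bar> \<le> M * A * norm (x - y) powr (1 - max 0 (\<sigma> - \<gamma>) / m)"
proof -
  define a where "a = max 0 (\<sigma> - \<gamma>) / m"
  have "max 0 (\<sigma> - \<gamma>) < m" using \<sigma> \<gamma> m by auto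
  then have a: "0 \<le> a" "a < 1" using m by (auto simp: a_def)
  obtain M where M: "M > 0"
    "\<And>u A x y. continuous_on C u \<Longrightarrow> A \<ge> 0 \<Longrightarrow>
       (\<And>d x y. 0 < d \<Longrightarrow> d < 1 \<Longrightarrow> (\<And>z. z \<in> closed_segment x y \<Longrightarrow> ball z d \<subseteq> \<Omega>) \<Longrightarrow>
           u y - u x \<le> A * d powr (-a) * norm (y - x)) \<Longrightarrow>
       x \<in> C \<Longrightarrow> y \<in> C \<Longrightarrow> \<bar>u x - u y\<bar> \<le> M * A * norm (x - y) powr (1 - a)"
    using holder_of_interior_lipschitz[OF bounded_\<Omega> connected_\<Omega> \<rho> cone a] by blast
  show ?thesis
  proof (rule that[OF M(1)])
    fix u f C\<^sub>0 N A x y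
    assume cu: "continuous_on C u" and sub: "vsub \<Omega> \<nu> \<Omega> H f u"
      and f: "\<And>x. x \<in> \<Omega> \<Longrightarrow> f x \<le> C\<^sub>0" "0 \<le> C\<^sub>0" and N: "N > 0"
      and hold: "\<And>x y. x \<in> C \<Longrightarrow> y \<in> C \<Longrightarrow> u y - u x \<le> N * norm (y - x) powr \<gamma>"
      and A: "A \<ge> 1" "c\<^sub>H * (A/2) powr m > C\<^sub>H + C\<^sub>0 + C\<^sub>2 * A + (3 * C\<^sub>2 + Dm * C\<^sub>1) * N"
      and xy: "x \<in> C" "y \<in> C"
    show "\<bar>u x - u y\<bar> \<le> M * A * norm (x - y) powr (1 - max 0 (\<sigma> - \<gamma>) / m)"
      unfolding a_def[symmetric]
    proof (rule M(2)[OF cu _ _ xy])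
      fix d x y assume d: "0 < d" "d < 1" and seg: "\<And>z. z \<in> closed_segment x y \<Longrightarrow> ball z d \<subseteq> \<Omega>"
      show "u y - u x \<le> A * d powr (-a) * norm (y - x)"
      \<comment> \<open>All subsegments have the same margin \<open>d\<close>, so the quadratic term
        has one common coefficient and vanishes under subdivision.\<close>
      proof (rule segment_lipschitz_of_quadratic)
        fix p q assume pq: "p \<in> closed_segment x y" "q \<in> closed_segment x y"
        have "q \<in> \<Omega>" using seg[OF pq(2)] d(1) by (metis centre_in_ball subsetD)
        then have "q \<in> C" using \<Omega>_sub_C by blast
        show "u q - u p \<le> A * d powr (-a) * norm (q - p) + N * d powr (\<gamma> - 2) * norm (q - p) ^ 2"
          unfolding a_def
        proof (rule interior_increment_bound[where f=f])
          show "ball p d \<subseteq> \<Omega>" by (rule seg[OF pq(1)])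
        qed (fact cu sub f \<gamma> N hold A d \<open>q \<in> C\<close>)+
      qed
    qed (use A in simp)
  qed
qed

text \<open>The iteration starts at exponent 0 from the sup bound. Each turn gains at least
  \<open>\<mu>\<close> as long as the exponent is below \<open>\<sigma>\<close>; one more turn above
  \<open>\<sigma>\<close> reaches exponent 1.\<close>

lemma lipschitz_of_subsolution:
  assumes B: "B \<ge> 0" and C\<^sub>0: "C\<^sub>0 \<ge> 0"
  obtains L where "L > 0"
    "\<And>u f x y. continuous_on C u \<Longrightarrow> (\<And>x. x \<in> C \<Longrightarrow> \<bar>u x\<bar> \<le> B) \<Longrightarrow> (\<And>x. x \<in> \<Omega> \<Longrightarrow> f x \<le> C\<^sub>0) \<Longrightarrow>
      vsub \<Omega> \<nu> \<Omega> H f u \<Longrightarrow> x \<in> C \<Longrightarrow> y \<in> C \<Longrightarrow> \<bar>u x - u y\<bar> \<le> L * norm (x - y)"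
proof -
  define adm where "adm u \<longleftrightarrow> continuous_on C u \<and> (\<forall>x\<in>C. \<bar>u x\<bar> \<le> B) \<and>
    (\<exists>f. (\<forall>x\<in>\<Omega>. f x \<le> C\<^sub>0) \<and> vsub \<Omega> \<nu> \<Omega> H f u)" for u
  have gain: "\<exists>N'>0. \<forall>u. adm u \<longrightarrow> (\<forall>x\<in>C. \<forall>y\<in>C. u y - u x \<le> N' * norm (y - x) powr (1 - max 0 (\<sigma> - \<gamma>) / m))"
    if \<gamma>: "0 \<le> \<gamma>" "\<gamma> \<le> 1" "\<gamma> \<noteq> \<sigma>" and N: "N > 0"
      and hold: "\<And>u x y. adm u \<Longrightarrow> x \<in> C \<Longrightarrow> y \<in> C \<Longrightarrow> u y - u x \<le> N * norm (y - x) powr \<gamma>" for \<gamma> N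
  proof -
    obtain M where M: "M > 0" "\<And>u f C\<^sub>0 N A x y. continuous_on C u \<Longrightarrow> vsub \<Omega> \<nu> \<Omega> H f u \<Longrightarrow>
      (\<And>x. x \<in> \<Omega> \<Longrightarrow> f x \<le> C\<^sub>0) \<Longrightarrow> C\<^sub>0 \<ge> 0 \<Longrightarrow> N > 0 \<Longrightarrow>
      (\<And>x y. x \<in> C \<Longrightarrow> y \<in> C \<Longrightarrow> u y - u x \<le> N * norm (y - x) powr \<gamma>) \<Longrightarrow>
      A \<ge> 1 \<Longrightarrow> c\<^sub>H * (A/2) powr m > C\<^sub>H + C\<^sub>0 + C\<^sub>2 * A + (3 * C\<^sub>2 + Dm * C\<^sub>1) * N \<Longrightarrow>
      x \<in> C \<Longrightarrow> y \<in> C \<Longrightarrow> \<bar>u x - u y\<bar> \<le> M * A * norm (x - y) powr (1 - max 0 (\<sigma> - \<gamma>) / m)"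
      using holder_gain[OF \<gamma>] by blast
    have "C\<^sub>H + C\<^sub>0 + (3 * C\<^sub>2 + Dm * C\<^sub>1) * N \<ge> 0" using C\<^sub>H C\<^sub>0 C\<^sub>2 C\<^sub>1 Dm(1) N by simp
    then obtain A where A: "A \<ge> 1"
      "c\<^sub>H * (A/2) powr m > C\<^sub>H + C\<^sub>0 + (3 * C\<^sub>2 + Dm * C\<^sub>1) * N + C\<^sub>2 * A"
      using superlinear_beats_affine[OF c\<^sub>H m, of _ C\<^sub>2] C\<^sub>2 by (metis less_imp_le order_refl)
    have A2: "c\<^sub>H * (A/2) powr m > C\<^sub>H + C\<^sub>0 + C\<^sub>2 * A + (3 * C\<^sub>2 + Dm * C\<^sub>1) * N"
      using A(2) by linarith
    have "u y - u x \<le> M * A * norm (y - x) powr (1 - max 0 (\<sigma> - \<gamma>) / m)"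
      if u: "adm u" and xy: "x \<in> C" "y \<in> C" for u x y
    proof -
      obtain f where f: "\<And>x. x \<in> \<Omega> \<Longrightarrow> f x \<le> C\<^sub>0" "vsub \<Omega> \<nu> \<Omega> H f u" and cu: "continuous_on C u"
        using u unfolding adm_def by blast
      have "\<bar>u y - u x\<bar> \<le> M * A * norm (y - x) powr (1 - max 0 (\<sigma> - \<gamma>) / m)"
        by (rule M(2)[OF cu f(2,1) C\<^sub>0 N hold[OF u] A(1) A2 xy(2,1)])
      then show ?thesis by linarith
    qed
    then show ?thesis using M(1) A(1) by (intro exI[of _ "M * A"]) auto
  qed
  \<comment> \<open>For \<open>\<gamma> < \<sigma>\<close> the gain
    \<open>1 - (\<sigma> - \<gamma>) / m - \<gamma>\<close> is at least
    \<open>(1 - \<gamma>) * (1 - 1/m)\<close>, since \<open>\<sigma> < 1\<close>, and this is at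
    least \<open>\<mu>\<close>.\<close>
  define \<mu> where "\<mu> = (1 - \<sigma>) * (1 - 1/m)"
  have \<mu>: "\<mu> > 0" using \<sigma> m by (simp add: \<mu>_def)
  obtain k :: nat where k: "real k > \<sigma> / \<mu>" using reals_Archimedean2 by blast
  \<comment> \<open>A step no longer than the guaranteed gain, for which \<open>\<sigma>\<close>
    falls halfway between the multiples \<open>k\<close> and \<open>k + 1\<close> and is therefore
    never hit.\<close>
  define \<eta> where "\<eta> = \<sigma> / (real k + 1/2)"
  have \<eta>: "\<eta> > 0" "\<eta> \<le> \<mu>" using \<sigma> \<mu> k by (auto simp: \<eta>_def field_simps)
  have k\<eta>: "real k * \<eta> < \<sigma>" "\<sigma> < real (Suc k) * \<eta>"
    using \<sigma> by (auto simp: \<eta>_def field_simps)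
  have "\<mu> \<le> 1 - \<sigma>" using \<sigma> m by (simp add: \<mu>_def mult_left_le)
  then have Sk: "real (Suc k) * \<eta> \<le> 1" using k\<eta> \<eta> by (simp add: distrib_right)
  have iter: "\<exists>N>0. \<forall>u. adm u \<longrightarrow> (\<forall>x\<in>C. \<forall>y\<in>C. u y - u x \<le> N * norm (y - x) powr (real n * \<eta>))"
    if "n \<le> Suc k" for n
    using that
  proof (induction n)
    case 0
    have "u y - u x \<le> (2 * B + 1) * norm (y - x) powr (real 0 * \<eta>)"
      if "adm u" "x \<in> C" "y \<in> C" for u x y
    \<comment> \<open>\<open>0 powr 0\<close> is 0, so the diagonal is treated apart. The summand 1
      keeps the constant positive when \<open>B = 0\<close>.\<close>
    proof (cases "x = y")
      case False
      have "\<bar>u x\<bar> \<le> B" "\<bar>u y\<bar> \<le> B" using that unfolding adm_def by auto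
      then show ?thesis using False by simp
    qed simp
    then show ?case using B by (intro exI[of _ "2 * B + 1"]) auto
  next
    case (Suc n)
    then obtain N where N: "N > 0"
      "\<And>u x y. adm u \<Longrightarrow> x \<in> C \<Longrightarrow> y \<in> C \<Longrightarrow> u y - u x \<le> N * norm (y - x) powr (real n * \<eta>)" by auto
    have "real n * \<eta> \<le> real k * \<eta>" using Suc.prems \<eta> by simp
    then have n\<eta>: "0 \<le> real n * \<eta>" "real n * \<eta> < \<sigma>" using \<eta> k\<eta> by (simp, linarith)
    define e where "e = 1 - max 0 (\<sigma> - real n * \<eta>) / m"
    obtain N' where N': "N' > 0"
      "\<And>u x y. adm u \<Longrightarrow> x \<in> C \<Longrightarrow> y \<in> C \<Longrightarrow> u y - u x \<le> N' * norm (y - x) powr e"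
      using gain[OF n\<eta>(1) _ _ N(1) N(2)] n\<eta> \<sigma> unfolding e_def by force
    have e: "real (Suc n) * \<eta> \<le> e" "e \<le> 1"
    proof -
      have "(\<sigma> - real n * \<eta>) / m \<le> (1 - real n * \<eta>) / m"
        using \<sigma> m by (intro divide_right_mono) auto
      then have "e - real n * \<eta> \<ge> (1 - real n * \<eta>) * (1 - 1/m)"
        using n\<eta> by (simp add: e_def algebra_simps diff_divide_distrib)
      moreover have "(1 - real n * \<eta>) * (1 - 1/m) \<ge> \<mu>" unfolding \<mu>_def
        using n\<eta> m by (intro mult_right_mono) auto
      ultimately show "real (Suc n) * \<eta> \<le> e" using \<eta> by (simp add: distrib_right)
      show "e \<le> 1" using m by (simp add: e_def)
    qed
    \<comment> \<open>The exponent is lowered from \<open>e\<close> to the prescribed multiple of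
      \<open>\<eta>\<close>, at the cost of \<open>Dm\<close>, so that the induction stays on the
      grid.\<close>
    have "u y - u x \<le> N' * Dm * norm (y - x) powr (real (Suc n) * \<eta>)"
      if "adm u" "x \<in> C" "y \<in> C" for u x y
    proof -
      let ?t = "norm (y - x)"
      have t: "?t \<le> Dm" using Dm(2) that by blast
      have "?t powr e = ?t powr (real (Suc n) * \<eta>) * ?t powr (e - real (Suc n) * \<eta>)"
        by (simp add: powr_add[symmetric])
      also have "?t powr (e - real (Suc n) * \<eta>) \<le> Dm powr (e - real (Suc n) * \<eta>)"
        using t e by (intro powr_mono2) auto
      also have "Dm powr (e - real (Suc n) * \<eta>) \<le> Dm powr 1"
        
      using Dm(1) e(2) mult_nonneg_nonneg[of "real (Suc n)" \<eta>] \<eta>(1) by (intro powr_mono) linarith+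
      finally have "?t powr e \<le> ?t powr (real (Suc n) * \<eta>) * Dm" using Dm(1) by (simp add: mult_left_mono)
      then have "N' * ?t powr e \<le> N' * (?t powr (real (Suc n) * \<eta>) * Dm)" using N'(1) by simp
      then show ?thesis using N'(2)[OF that] by (simp add: mult_ac)
    qed
    then show ?case using N'(1) Dm(1) by (intro exI[of _ "N' * Dm"]) auto
  qed
  obtain N where N: "N > 0"
    "\<And>u x y. adm u \<Longrightarrow> x \<in> C \<Longrightarrow> y \<in> C \<Longrightarrow> u y - u x \<le> N * norm (y - x) powr (real (Suc k) * \<eta>)"
    using iter[of "Suc k"] by auto
  have "0 \<le> real (Suc k) * \<eta>" "real (Suc k) * \<eta> \<noteq> \<sigma>" using \<eta> k\<eta> by auto
  from gain[OF this(1) Sk this(2) N] k\<eta> obtain L where L: "L > 0"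
    "\<And>u x y. adm u \<Longrightarrow> x \<in> C \<Longrightarrow> y \<in> C \<Longrightarrow> u y - u x \<le> L * norm (y - x)"
    by (auto simp: max_def)
  show ?thesis
  proof (rule that[OF L(1)])
    fix u f x y
    assume "continuous_on C u" "\<And>x. x \<in> C \<Longrightarrow> \<bar>u x\<bar> \<le> B" "\<And>x. x \<in> \<Omega> \<Longrightarrow> f x \<le> C\<^sub>0"
      "vsub \<Omega> \<nu> \<Omega> H f u" and xy: "x \<in> C" "y \<in> C"
    then have "adm u" unfolding adm_def by blast
    then show "\<bar>u x - u y\<bar> \<le> L * norm (x - y)"
      using L(2)[OF _ xy] L(2)[OF _ xy(2,1)] by (fastforce simp: norm_minus_commute abs_le_iff)
  qed
qed

text \<open>At exponent 1 a Lipschitz constant \<open>N\<close> enters the condition on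
  \<open>A\<close> only linearly. Taking \<open>A = N / (2 * M)\<close>, superlinearity verifies it
  whenever \<open>N \<ge> L\<^sub>0\<close>, and the new constant \<open>M * A\<close> is
  \<open>N / 2\<close>. Halving stops at \<open>L\<^sub>0\<close>, wherever it began.\<close>

lemma uniform_lipschitz_of_subsolution:
  assumes C\<^sub>0: "C\<^sub>0 \<ge> 0"
  obtains L\<^sub>0 where "L\<^sub>0 > 0"
    "\<And>u f L x y. vsub \<Omega> \<nu> \<Omega> H f u \<Longrightarrow> (\<And>x. x \<in> \<Omega> \<Longrightarrow> f x \<le> C\<^sub>0) \<Longrightarrow>
      (\<And>x y. x \<in> C \<Longrightarrow> y \<in> C \<Longrightarrow> \<bar>u x - u y\<bar> \<le> L * norm (x - y)) \<Longrightarrow>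
      x \<in> C \<Longrightarrow> y \<in> C \<Longrightarrow> \<bar>u x - u y\<bar> \<le> L\<^sub>0 * norm (x - y)"
proof -
  have one: "0 \<le> (1::real)" "1 \<le> (1::real)" "1 \<noteq> \<sigma>" using \<sigma> by auto
  have e1: "1 - max 0 (\<sigma> - 1) / m = 1" using \<sigma> by simp
  obtain M where M: "M > 0" "\<And>u f C\<^sub>0 N A x y. continuous_on C u \<Longrightarrow> vsub \<Omega> \<nu> \<Omega> H f u \<Longrightarrow>
      (\<And>x. x \<in> \<Omega> \<Longrightarrow> f x \<le> C\<^sub>0) \<Longrightarrow> C\<^sub>0 \<ge> 0 \<Longrightarrow> N > 0 \<Longrightarrow>
      (\<And>x y. x \<in> C \<Longrightarrow> y \<in> C \<Longrightarrow> u y - u x \<le> N * norm (y - x) powr 1) \<Longrightarrow>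
      A \<ge> 1 \<Longrightarrow> c\<^sub>H * (A/2) powr m > C\<^sub>H + C\<^sub>0 + C\<^sub>2 * A + (3 * C\<^sub>2 + Dm * C\<^sub>1) * N \<Longrightarrow>
      x \<in> C \<Longrightarrow> y \<in> C \<Longrightarrow> \<bar>u x - u y\<bar> \<le> M * A * norm (x - y) powr 1"
    using holder_gain[OF one] unfolding e1 by blast
  \<comment> \<open>The coefficient of \<open>A\<close> after substituting
    \<open>N = 2 * M * A\<close>.\<close>
  define Q where "Q = C\<^sub>2 + (3 * C\<^sub>2 + Dm * C\<^sub>1) * (2 * M)"
  have "Q \<ge> 0" using C\<^sub>2 C\<^sub>1 Dm(1) M(1) by (simp add: Q_def)
  then obtain A\<^sub>0 where A\<^sub>0: "A\<^sub>0 \<ge> 1" "\<And>A. A \<ge> A\<^sub>0 \<Longrightarrow> c\<^sub>H * (A/2) powr m > C\<^sub>H + C\<^sub>0 + Q * A"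
    using superlinear_beats_affine[OF c\<^sub>H m, of "C\<^sub>H + C\<^sub>0" Q] C\<^sub>H C\<^sub>0 by auto
  define L\<^sub>0 where "L\<^sub>0 = 2 * M * A\<^sub>0"
  have L\<^sub>0: "L\<^sub>0 > 0" using M A\<^sub>0 by (simp add: L\<^sub>0_def)
  show ?thesis
  proof (rule that[OF L\<^sub>0])
    fix u f L x y
    assume sub: "vsub \<Omega> \<nu> \<Omega> H f u" and f: "\<And>x. x \<in> \<Omega> \<Longrightarrow> f x \<le> C\<^sub>0"
      and L: "\<And>x y. x \<in> C \<Longrightarrow> y \<in> C \<Longrightarrow> \<bar>u x - u y\<bar> \<le> L * norm (x - y)"
      and xy: "x \<in> C" "y \<in> C"
    have cu: "continuous_on C u"
    proof (rule lipschitz_on_continuous_on)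
      show "\<bar>L\<bar>-lipschitz_on C u"
      proof (rule lipschitz_onI)
        fix x y assume "x \<in> C" "y \<in> C"
        then have "\<bar>u x - u y\<bar> \<le> \<bar>L\<bar> * norm (x - y)"
          using L[of x y] by (smt (verit) mult_right_mono norm_ge_zero)
        then show "dist (u x) (u y) \<le> \<bar>L\<bar> * dist x y" by (simp add: dist_norm)
      qed simp
    qed
    have step: "\<forall>x\<in>C. \<forall>y\<in>C. \<bar>u x - u y\<bar> \<le> N / 2 * norm (x - y)"
      if N: "N \<ge> L\<^sub>0" and lip: "\<forall>x\<in>C. \<forall>y\<in>C. \<bar>u x - u y\<bar> \<le> N * norm (x - y)" for N
    proof (intro ballI)
      fix x y assume xy: "x \<in> C" "y \<in> C"
      define A where "A = N / (2 * M)"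
      have A: "A \<ge> A\<^sub>0" "N = 2 * M * A" using N M(1) by (auto simp: A_def L\<^sub>0_def field_simps)
      have "\<bar>u x - u y\<bar> \<le> M * A * norm (x - y) powr 1"
      proof (rule M(2)[OF cu sub f C\<^sub>0 _ _ _ _ xy])
        show "u y - u x \<le> N * norm (y - x) powr 1" if "x \<in> C" "y \<in> C" for x y
          using lip that by (fastforce simp: abs_le_iff)
        have "C\<^sub>2 * A + (3 * C\<^sub>2 + Dm * C\<^sub>1) * N = Q * A" unfolding A(2) Q_def by (simp add: algebra_simps)
        then show "c\<^sub>H * (A/2) powr m > C\<^sub>H + C\<^sub>0 + C\<^sub>2 * A + (3 * C\<^sub>2 + Dm * C\<^sub>1) * N"
          using A\<^sub>0(2)[OF A(1)] by linarith
        show "N > 0" "A \<ge> 1" using N L\<^sub>0 A(1) A\<^sub>0(1) by linarith+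
      qed
      then show "\<bar>u x - u y\<bar> \<le> N / 2 * norm (x - y)" using A(2) by simp
    qed
    have iter: "(\<forall>x\<in>C. \<forall>y\<in>C. \<bar>u x - u y\<bar> \<le> L\<^sub>0 * 2 ^ k * norm (x - y)) \<Longrightarrow>
        (\<forall>x\<in>C. \<forall>y\<in>C. \<bar>u x - u y\<bar> \<le> L\<^sub>0 * norm (x - y))" for k
    proof (induction k)
      case (Suc k)
      have "L\<^sub>0 * 2 ^ Suc k \<ge> L\<^sub>0" using L\<^sub>0 by (simp add: mult_le_cancel_left1 del: power_Suc)
      from step[OF this Suc.prems] show ?case by (intro Suc.IH) simp
    qed simp
    obtain k where k: "\<bar>L\<bar> / L\<^sub>0 < 2 ^ k" using real_arch_pow[of 2] by auto
    have "\<bar>u x - u y\<bar> \<le> L\<^sub>0 * 2 ^ k * norm (x - y)" if "x \<in> C" "y \<in> C" for x y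
    proof (rule order_trans[OF L[OF that]])
      have "L \<le> L\<^sub>0 * 2 ^ k" using k L\<^sub>0 by (simp add: field_simps)
      then show "L * norm (x - y) \<le> L\<^sub>0 * 2 ^ k * norm (x - y)" by (intro mult_right_mono) auto
    qed
    with iter[of k] xy show "\<bar>u x - u y\<bar> \<le> L\<^sub>0 * norm (x - y)" by blast
  qed
qed

end

section \<open>Stability and comparison\<close>

context jump_setting
begin

lemma I_mono:
  assumes "set_integrable (\<nu> x) (jumps D x) (\<lambda>z. u (x + z) - u x)"
    "set_integrable (\<nu> x) (jumps D x) (\<lambda>z. v (x + z) - v x)"
    "\<And>z. z \<in> D \<Longrightarrow> x + z \<in> C \<Longrightarrow> u (x + z) - u x \<le> v (x + z) - v x"
  shows "I D u x \<le> I D v x"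
  unfolding nonlocal_op_def by (rule set_integral_mono[OF assms(1,2)]) (use assms(3) in auto)

lemma I_union:
  assumes "set_integrable (\<nu> x) (jumps D x) (\<lambda>z. u (x + z) - u x)"
    "set_integrable (\<nu> x) (jumps D' x) (\<lambda>z. u (x + z) - u x)" "D \<inter> D' = {}"
  shows "I (D \<union> D') u x = I D u x + I D' u x"
proof -
  have "jumps (D \<union> D') x = jumps D x \<union> jumps D' x" by auto
  then show ?thesis unfolding nonlocal_op_def
    using set_integral_Un[OF _ assms(1,2)] assms(3) by fastforce
qed

lemma I_nonpos:
  assumes "\<And>z. z \<in> D \<Longrightarrow> x + z \<in> C \<Longrightarrow> u (x + z) \<le> u x"
  shows "I D u x \<le> 0"
  unfolding nonlocal_op_def
  by (rule set_integral_le_of_nn_integral[where g="\<lambda>_. 0"]) (use assms in auto)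

lemma I_C1_add_sqnorm:
  assumes "C1_with_gradient_on C \<phi> G" "x \<in> C" "D \<in> sets borel"
  shows "I D (\<lambda>w. \<phi> w + \<alpha> * norm (w - a) ^ 2) x = I D \<phi> x + \<alpha> * I D (\<lambda>w. norm (w - a) ^ 2) x"
proof -
  let ?s = "\<lambda>w. norm (w - a) ^ 2"
  have int: "set_integrable (\<nu> x) (jumps D x) (\<lambda>z. \<alpha> * (?s (x + z) - ?s x))"
    by (intro set_integrable_mult_right integrable_C1[OF C1_with_gradient_on_sqnorm] assms)
  have "I D (\<lambda>w. \<phi> w + \<alpha> * ?s w) x =
      (LINT z:jumps D x|\<nu> x. (\<phi> (x + z) - \<phi> x) + \<alpha> * (?s (x + z) - ?s x))"
    unfolding nonlocal_op_def by (simp add: algebra_simps)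
  also have "\<dots> = I D \<phi> x + (LINT z:jumps D x|\<nu> x. \<alpha> * (?s (x + z) - ?s x))"
    unfolding nonlocal_op_def by (rule set_integral_add(2)[OF integrable_C1(1)[OF assms] int])
  also have "(LINT z:jumps D x|\<nu> x. \<alpha> * (?s (x + z) - ?s x)) = \<alpha> * I D ?s x"
    unfolding nonlocal_op_def by (rule set_integral_mult_right)
  finally show ?thesis .
qed

lemma continuous_hamiltonian:
  fixes H :: "'a \<Rightarrow> 'a \<Rightarrow> real"
  assumes Hc: "continuous_on (C \<times> UNIV) (\<lambda>(x, p). H x p)" and "C1_with_gradient_on C \<phi> G"
  shows "continuous_on C (\<lambda>x. H x (G x))"
proof -
  have "continuous_on C (\<lambda>x. (x, G x))"
    using assms(2) unfolding C1_with_gradient_on_def by (intro continuous_intros) auto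
  moreover have "(\<lambda>x. (x, G x)) ` C \<subseteq> C \<times> UNIV" by auto
  ultimately show ?thesis using continuous_on_compose2[OF Hc] by fastforce
qed

text \<open>The approximations must reach \<open>u\<close> only at the given point and may lie far
  below it elsewhere. This one-sided form covers suprema of subsolutions as well as uniform limits;
  \<open>K\<close> allows the right-hand side to depend on the approximation.\<close>

lemma vsub_stable:
  assumes Hc: "continuous_on (C \<times> UNIV) (\<lambda>(x, p). H x p)"
    and E: "E \<subseteq> C" "\<And>x. x \<in> E \<Longrightarrow> \<exists>s>0. ball x s \<inter> C \<subseteq> E"
    and cu: "continuous_on C u" and cf: "continuous_on C f" and K: "K \<ge> 0"
    and approx: "\<And>x\<^sub>0 \<epsilon>. x\<^sub>0 \<in> E \<Longrightarrow> \<epsilon> > 0 \<Longrightarrow> \<exists>v g. continuous_on C v \<and> vsub \<Omega> \<nu> E H g v \<and>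
      (\<forall>x\<in>C. v x \<le> u x + \<epsilon>) \<and> v x\<^sub>0 \<ge> u x\<^sub>0 - \<epsilon> \<and> (\<forall>x\<in>C. g x \<le> f x + K * \<bar>u x - v x\<bar> + \<epsilon>)"
  shows "vsub \<Omega> \<nu> E H f u"
  unfolding vsub_def
proof (intro allI impI ballI)
  fix \<phi> G \<delta> x\<^sub>0
  assume C1: "C1_with_gradient_on C \<phi> G" and \<delta>: "(0::real) < \<delta>" and x\<^sub>0: "x\<^sub>0 \<in> E"
    and max: "\<forall>y\<in>C. u y - \<phi> y \<le> u x\<^sub>0 - \<phi> x\<^sub>0"
  have x\<^sub>0C: "x\<^sub>0 \<in> C" using x\<^sub>0 E by blast
  let ?J = "I (ball 0 \<delta>) (\<lambda>w. norm (w - x\<^sub>0) ^ 2) x\<^sub>0"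
  \<comment> \<open>The quadratic term makes the maximum strict, so maxima of the approximations
    converge to it. It leaves the gradient at \<open>x\<^sub>0\<close> unchanged and costs only
    \<open>\<alpha> * ?J\<close>.\<close>
  have pert: "- (I (ball 0 \<delta>) \<phi> x\<^sub>0 + \<alpha> * ?J) - I (- ball 0 \<delta>) u x\<^sub>0 + H x\<^sub>0 (G x\<^sub>0) \<le> f x\<^sub>0"
    if \<alpha>: "\<alpha> > 0" for \<alpha>
  proof -
    define \<psi> where "\<psi> w = \<phi> w + \<alpha> * norm (w - x\<^sub>0) ^ 2" for w
    define G' where "G' w = G w + \<alpha> *\<^sub>R (2 *\<^sub>R (w - x\<^sub>0))" for w
    have C1': "C1_with_gradient_on C \<psi> G'" unfolding \<psi>_def G'_def
      by (intro C1_with_gradient_on_add C1 C1_with_gradient_on_cmult C1_with_gradient_on_sqnorm)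
    have c\<phi>: "continuous_on C \<phi>" "continuous_on C \<psi>"
      using C1 C1' C1_with_gradient_on_continuous by blast+
    define \<epsilon> where "\<epsilon> n = inverse (real (Suc n))" for n
    have \<epsilon>: "\<epsilon> n > 0" "\<epsilon> \<longlonglongrightarrow> 0" for n
      unfolding \<epsilon>_def by (simp, rule LIMSEQ_inverse_real_of_nat)
    have "\<forall>n. \<exists>v g. continuous_on C v \<and> vsub \<Omega> \<nu> E H g v \<and> (\<forall>x\<in>C. v x \<le> u x + \<epsilon> n) \<and>
        v x\<^sub>0 \<ge> u x\<^sub>0 - \<epsilon> n \<and> (\<forall>x\<in>C. g x \<le> f x + K * \<bar>u x - v x\<bar> + \<epsilon> n)"
      using approx[OF x\<^sub>0 \<epsilon>(1)] by blast
    then obtain v g where v: "\<And>n. continuous_on C (v n)" "\<And>n. vsub \<Omega> \<nu> E H (g n) (v n)"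
      "\<And>n x. x \<in> C \<Longrightarrow> v n x \<le> u x + \<epsilon> n" "\<And>n. v n x\<^sub>0 \<ge> u x\<^sub>0 - \<epsilon> n"
      "\<And>n x. x \<in> C \<Longrightarrow> g n x \<le> f x + K * \<bar>u x - v n x\<bar> + \<epsilon> n"
      by metis
    have "\<exists>x\<in>C. \<forall>y\<in>C. v n y - \<psi> y \<le> v n x - \<psi> x" for n
      by (rule continuous_attains_sup[OF compact_C nonempty_C]) (intro continuous_intros v c\<phi>)
    then obtain X where X: "\<And>n. X n \<in> C" "\<And>n y. y \<in> C \<Longrightarrow> v n y - \<psi> y \<le> v n (X n) - \<psi> (X n)"
      by metis
    have low: "v n (X n) \<ge> u x\<^sub>0 - \<phi> x\<^sub>0 - \<epsilon> n + \<phi> (X n) + \<alpha> * norm (X n - x\<^sub>0) ^ 2" for n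
      using X(2)[OF x\<^sub>0C, of n] v(4)[of n] by (simp add: \<psi>_def)
    have sq: "norm (X n - x\<^sub>0) ^ 2 \<le> 2 * \<epsilon> n / \<alpha>" for n
    proof -
      have "\<alpha> * norm (X n - x\<^sub>0) ^ 2 \<le> 2 * \<epsilon> n"
        using low[of n] v(3)[OF X(1), of n n] max X(1)[of n] by fastforce
      then show ?thesis using \<alpha> by (simp add: field_simps)
    qed
    have "(\<lambda>n. norm (X n - x\<^sub>0) ^ 2) \<longlonglongrightarrow> 0"
    proof (rule tendsto_sandwich[OF _ _ tendsto_const])
      show "(\<lambda>n. 2 * \<epsilon> n / \<alpha>) \<longlonglongrightarrow> 0"
        using tendsto_mult_right[OF \<epsilon>(2), of "2 / \<alpha>"] by (simp add: mult.commute)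
    qed (use sq in auto)
    then have "(\<lambda>n. sqrt (norm (X n - x\<^sub>0) ^ 2)) \<longlonglongrightarrow> sqrt 0" by (intro tendsto_intros)
    then have Xlim: "X \<longlonglongrightarrow> x\<^sub>0" by (simp add: tendsto_norm_zero_iff LIM_zero_iff)
    note comp = continuous_on_tendsto_compose[OF _ Xlim x\<^sub>0C always_eventually[OF allI[OF X(1)]]]
    \<comment> \<open>The gap at the maximum points. Comparison with \<open>x\<^sub>0\<close> in
      \<open>low\<close> forces it to 0, although nothing is assumed about it elsewhere; it bounds
      the loss when the far jumps of \<open>v n\<close> are replaced by those of
      \<open>u\<close>.\<close>
    define q where "q n = u (X n) + \<epsilon> n - v n (X n)" for n
    have "(\<lambda>n. u (X n) - u x\<^sub>0 + 2 * \<epsilon> n + \<phi> x\<^sub>0 - \<phi> (X n)) \<longlonglongrightarrow> u x\<^sub>0 - u x\<^sub>0 + 2 * 0 + \<phi> x\<^sub>0 - \<phi> x\<^sub>0"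
      by (intro tendsto_intros comp cu c\<phi> \<epsilon>(2))
    then have Qlim: "(\<lambda>n. u (X n) - u x\<^sub>0 + 2 * \<epsilon> n + \<phi> x\<^sub>0 - \<phi> (X n)) \<longlonglongrightarrow> 0" by simp
    have q0: "q n \<ge> 0" for n using v(3)[OF X(1), of n n] by (simp add: q_def)
    have qlim: "q \<longlonglongrightarrow> 0"
    proof (rule tendsto_sandwich[OF _ _ tendsto_const Qlim])
      have "\<alpha> * norm (X n - x\<^sub>0) ^ 2 \<ge> 0" for n using \<alpha> by simp
      then have "q n \<le> u (X n) - u x\<^sub>0 + 2 * \<epsilon> n + \<phi> x\<^sub>0 - \<phi> (X n)" for n
        using low[of n] by (smt (verit) q_def)
      then show "\<forall>\<^sub>F n in sequentially. q n \<le> u (X n) - u x\<^sub>0 + 2 * \<epsilon> n + \<phi> x\<^sub>0 - \<phi> (X n)" by simp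
    qed (use q0 in simp)
    define M where "M = C\<^sub>1 * \<delta> powr (- \<sigma>)"
    obtain s where s: "s > 0" "ball x\<^sub>0 s \<inter> C \<subseteq> E" using E(2)[OF x\<^sub>0] by blast
    have "\<forall>\<^sub>F n in sequentially. X n \<in> ball x\<^sub>0 s"
      using Xlim s(1) by (intro topological_tendstoD) auto
    then have ineq: "\<forall>\<^sub>F n in sequentially. - I (ball 0 \<delta>) \<psi> (X n) - (I (- ball 0 \<delta>) u (X n) + q n * M)
        + H (X n) (G' (X n)) \<le> f (X n) + K * (q n + \<epsilon> n) + \<epsilon> n"
    proof eventually_elim
      case (elim n)
      then have XE: "X n \<in> E" using s(2) X(1) by blast
      have "- I (ball 0 \<delta>) \<psi> (X n) - I (- ball 0 \<delta>) (v n) (X n) + H (X n) (G' (X n)) \<le> g n (X n)"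
        by (rule vsubD[OF v(2) C1' \<delta> XE X(2)])
      moreover have "I (- ball 0 \<delta>) (v n) (X n) \<le> I (- ball 0 \<delta>) u (X n) + q n * M"
        unfolding M_def
      proof (rule I_far_le[OF cu v(1) X(1) _ \<delta> _ q0])
        show "v n (X n + z) - v n (X n) \<le> u (X n + z) - u (X n) + q n" if "X n + z \<in> C" for z
          using v(3)[OF that, of n] by (simp add: q_def)
      qed auto
      moreover have "\<bar>u (X n) - v n (X n)\<bar> \<le> q n + \<epsilon> n"
        using q0[of n] \<epsilon>(1)[of n] unfolding q_def by linarith
      then have "K * \<bar>u (X n) - v n (X n)\<bar> \<le> K * (q n + \<epsilon> n)" using K by (rule mult_left_mono)
      moreover have "g n (X n) \<le> f (X n) + K * \<bar>u (X n) - v n (X n)\<bar> + \<epsilon> n" by (rule v(5)[OF X(1)])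
      ultimately show ?case by linarith
    qed
    have "continuous_on C (\<lambda>x. H x (G' x))" by (rule continuous_hamiltonian[OF Hc C1'])
    then have L: "(\<lambda>n. - I (ball 0 \<delta>) \<psi> (X n) - (I (- ball 0 \<delta>) u (X n) + q n * M) + H (X n) (G' (X n)))
        \<longlonglongrightarrow> - I (ball 0 \<delta>) \<psi> x\<^sub>0 - (I (- ball 0 \<delta>) u x\<^sub>0 + 0 * M) + H x\<^sub>0 (G' x\<^sub>0)"
      by (intro tendsto_intros comp qlim continuous_C1[OF C1' x\<^sub>0C] continuous_far[OF cu _ \<delta>]) auto
    have R: "(\<lambda>n. f (X n) + K * (q n + \<epsilon> n) + \<epsilon> n) \<longlonglongrightarrow> f x\<^sub>0 + K * (0 + 0) + 0"
      by (intro tendsto_intros comp cf qlim \<epsilon>(2))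
    have "- I (ball 0 \<delta>) \<psi> x\<^sub>0 - (I (- ball 0 \<delta>) u x\<^sub>0 + 0 * M) + H x\<^sub>0 (G' x\<^sub>0) \<le> f x\<^sub>0 + K * (0 + 0) + 0"
      by (rule tendsto_le[OF sequentially_bot R L ineq])
    moreover have "I (ball 0 \<delta>) \<psi> x\<^sub>0 = I (ball 0 \<delta>) \<phi> x\<^sub>0 + \<alpha> * ?J"
      unfolding \<psi>_def by (rule I_C1_add_sqnorm[OF C1 x\<^sub>0C]) simp
    moreover have "G' x\<^sub>0 = G x\<^sub>0" by (simp add: G'_def)
    ultimately show ?thesis by simp
  qed
  have "((\<lambda>\<alpha>. - (I (ball 0 \<delta>) \<phi> x\<^sub>0 + \<alpha> * ?J) - I (- ball 0 \<delta>) u x\<^sub>0 + H x\<^sub>0 (G x\<^sub>0))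
      \<longlongrightarrow> - (I (ball 0 \<delta>) \<phi> x\<^sub>0 + 0 * ?J) - I (- ball 0 \<delta>) u x\<^sub>0 + H x\<^sub>0 (G x\<^sub>0)) (at_right 0)"
    by (intro tendsto_intros)
  note lim = this
  have ev: "\<forall>\<^sub>F \<alpha> in at_right 0. f x\<^sub>0 \<ge> - (I (ball 0 \<delta>) \<phi> x\<^sub>0 + \<alpha> * ?J)
      - I (- ball 0 \<delta>) u x\<^sub>0 + H x\<^sub>0 (G x\<^sub>0)"
    unfolding eventually_at_right_field using pert by (intro exI[of _ 1]) auto
  from tendsto_upperbound[OF lim ev]
  show "- I (ball 0 \<delta>) \<phi> x\<^sub>0 - I (- ball 0 \<delta>) u x\<^sub>0 + H x\<^sub>0 (G x\<^sub>0) \<le> f x\<^sub>0" by simp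
qed

text \<open>
  Doubling of variables. The shift by \<open>\<eta> *\<^sub>R e\<close> moves the point at which \<open>u\<^sub>1\<close> is tested into
  \<open>\<Omega>\<close>, so that the subsolution property is not needed on the boundary.
\<close>

lemma doubling:
  assumes cu1: "continuous_on C u\<^sub>1" and cu2: "continuous_on C u\<^sub>2"
    and L: "L > 0" "\<And>x y. x \<in> C \<Longrightarrow> y \<in> C \<Longrightarrow> \<bar>u\<^sub>1 x - u\<^sub>1 y\<bar> \<le> L * norm (x - y)"
    and sub: "viscosity_subsolution \<Omega> \<nu> H c\<^sub>1 u\<^sub>1" and super: "viscosity_supersolution \<Omega> \<nu> H c\<^sub>2 u\<^sub>2"
    and xm: "xm \<in> C" "\<And>y. y \<in> C \<Longrightarrow> u\<^sub>1 y - u\<^sub>2 y \<le> u\<^sub>1 xm - u\<^sub>2 xm"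
    and P: "P = L * (1 + 8 / \<rho>)"
    and \<eta>: "0 < \<eta>" "\<eta> \<le> \<rho>" "4 * L * \<eta> < \<rho>\<^sup>2"
  shows "\<exists>x y p. x \<in> \<Omega> \<and> y \<in> C \<and> norm p \<le> P \<and> norm (y - xm) ^ 2 \<le> 4 * L * \<eta> \<and> norm (x - y) \<le> 2 * \<eta> \<and>
    (\<forall>\<delta>. 0 < \<delta> \<and> \<delta> < 1 \<longrightarrow> c\<^sub>2 - c\<^sub>1 \<le> (2 * P + 2 * Dm) * (C\<^sub>2 * \<delta> powr (1 - \<sigma>)) +
       I (- ball 0 \<delta>) u\<^sub>1 x - I (- ball 0 \<delta>) u\<^sub>2 y + H y (p - 2 *\<^sub>R (y - xm)) - H x p)"
proof -
  obtain e where e: "norm e = 1" and cone_e: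
    "\<And>y t. y \<in> C \<Longrightarrow> norm (y - xm) < \<rho> \<Longrightarrow> 0 < t \<Longrightarrow> t \<le> \<rho> \<Longrightarrow> ball (y + t *\<^sub>R e) (\<rho> * t) \<subseteq> \<Omega>"
    using cone xm(1) unfolding uniform_cone_def by (auto simp: dist_norm norm_minus_commute)
  \<comment> \<open>Keeps the smoothing error \<open>P * \<tau>\<close> within
    \<open>2 * L * \<eta>\<close>, the order of the other errors.\<close>
  define \<tau> where "\<tau> = \<rho> * \<eta> / 8"
  define S where "S w = sqrt (norm w ^ 2 + \<tau>\<^sup>2)" for w :: 'a
  have \<tau>: "\<tau> > 0" using \<rho> \<eta> by (simp add: \<tau>_def)
  \<comment> \<open>The excess \<open>8 * L / \<rho>\<close> of \<open>P\<close> over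
    \<open>L\<close> turns the total error \<open>4 * L * \<eta>\<close> into
    \<open>norm w \<le> \<rho> * \<eta> / 2\<close>, half the radius available in the cone.\<close>
  have PL: "P > 0" "P * \<tau> \<le> 2 * L * \<eta>" "P - L = 8 * L / \<rho>"
  proof -
    show "P > 0" unfolding P using L \<rho> by (simp add: add_pos_nonneg)
    have "P * \<tau> = L * \<eta> * (\<rho> + 8) / 8" using \<rho> by (simp add: P \<tau>_def field_simps)
    also have "\<dots> \<le> L * \<eta> * 2" using L \<eta> \<rho> by (simp add: field_simps)
    finally show "P * \<tau> \<le> 2 * L * \<eta>" by simp
    show "P - L = 8 * L / \<rho>" by (simp add: P algebra_simps)
  qed
  have S: "norm w \<le> S w" "S 0 = \<tau>" "S w > 0" "S a \<le> S b + norm (a - b)" "S (- w) = S w" for w a b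
    using \<tau> soft_norm_triangle[of a \<tau> b]
    by (auto simp: S_def real_le_rsqrt add_nonneg_pos)
  have cS: "continuous_on A (\<lambda>x. S (f x))" if "continuous_on A f" for A and f :: "'a \<times> 'a \<Rightarrow> 'a"
    unfolding S_def using that by (intro continuous_intros)
  \<comment> \<open>A penalty of finite slope suffices because \<open>u\<^sub>1\<close> is
    Lipschitz, and it keeps \<open>p\<close> bounded. The square ties \<open>y\<close>, hence also
    \<open>x\<close>, to \<open>xm\<close>.\<close>
  define \<Phi> where "\<Phi> x y = u\<^sub>1 x - u\<^sub>2 y - P * S (x - y - \<eta> *\<^sub>R e) - norm (y - xm) ^ 2" for x y
  have c\<Phi>: "continuous_on (C \<times> C) (\<lambda>z. \<Phi> (fst z) (snd z))" unfolding \<Phi>_def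
    by (intro continuous_intros cS continuous_on_compose2[OF cu1] continuous_on_compose2[OF cu2]) auto
  have "compact (C \<times> C)" "C \<times> C \<noteq> {}" using compact_C nonempty_C by (auto intro: compact_Times)
  from continuous_attains_sup[OF this c\<Phi>]
  obtain z where z: "z \<in> C \<times> C" "\<And>z'. z' \<in> C \<times> C \<Longrightarrow> \<Phi> (fst z') (snd z') \<le> \<Phi> (fst z) (snd z)"
    by blast
  define x where "x = fst z"
  define y where "y = snd z"
  have xy: "x \<in> C" "y \<in> C" using z(1) by (auto simp: x_def y_def)
  have max: "\<Phi> x' y' \<le> \<Phi> x y" if "x' \<in> C" "y' \<in> C" for x' y'
    using z(2)[of "(x', y')"] that by (simp add: x_def y_def)
  define w where "w = x - y - \<eta> *\<^sub>R e"
  \<comment> \<open>The competitor \<open>(xm + \<eta> *\<^sub>R e, xm)\<close> makes the shifted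
    penalty minimal and gives the lower bound for the maximum.\<close>
  have "ball (xm + \<eta> *\<^sub>R e) (\<rho> * \<eta>) \<subseteq> \<Omega>" by (rule cone_e[OF xm(1)]) (use \<rho> \<eta> in auto)
  then have "xm + \<eta> *\<^sub>R e \<in> \<Omega>" using \<rho> \<eta> by (metis centre_in_ball mult_pos_pos subsetD)
  then have xe: "xm + \<eta> *\<^sub>R e \<in> C" using \<Omega>_sub_C by blast
  have "\<bar>u\<^sub>1 (xm + \<eta> *\<^sub>R e) - u\<^sub>1 xm\<bar> \<le> L * \<eta>"
    using L(2)[OF xe xm(1)] e \<eta> by simp
  then have lo: "\<Phi> x y \<ge> u\<^sub>1 xm - u\<^sub>2 xm - L * \<eta> - P * \<tau>"
    using max[OF xe xm(1)] S(2) by (simp add: \<Phi>_def)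
  have "norm (x - y) \<le> norm w + \<eta>"
    using norm_triangle_ineq[of w "\<eta> *\<^sub>R e"] e \<eta> by (simp add: w_def)
  then have "u\<^sub>1 x \<le> u\<^sub>1 y + L * (norm w + \<eta>)"
    using L(2)[OF xy] L(1) by (smt (verit) mult_left_mono)
  moreover have "P * S w \<ge> P * norm w" using S(1) PL(1) by (intro mult_left_mono) auto
  ultimately have "\<Phi> x y \<le> u\<^sub>1 xm - u\<^sub>2 xm + L * (norm w + \<eta>) - P * norm w - norm (y - xm) ^ 2"
    using xm(2)[OF xy(2)] by (simp add: \<Phi>_def w_def)
  then have "(P - L) * norm w + norm (y - xm) ^ 2 \<le> 2 * L * \<eta> + P * \<tau>"
    using lo by (simp add: algebra_simps)
  then have key: "8 * L / \<rho> * norm w + norm (y - xm) ^ 2 \<le> 4 * L * \<eta>" using PL by simp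
  have "8 * L / \<rho> * norm w \<ge> 0" using L \<rho> by simp
  then have yxm: "norm (y - xm) ^ 2 \<le> 4 * L * \<eta>" using key by linarith
  have "8 * L / \<rho> * norm w \<le> 4 * L * \<eta>" using key zero_le_power2[of "norm (y - xm)"] by linarith
  then have wle: "2 * norm w \<le> \<rho> * \<eta>" using L \<rho> by (simp add: field_simps)
  have "norm (y - xm) ^ 2 < \<rho> ^ 2" using yxm \<eta> by linarith
  then have "norm (y - xm) < \<rho>" using \<rho> by (simp add: power2_less_imp_less)
  then have "ball (y + \<eta> *\<^sub>R e) (\<rho> * \<eta>) \<subseteq> \<Omega>" by (intro cone_e xy \<eta>)
  moreover have "norm w < \<rho> * \<eta>" using wle \<rho> \<eta> by (smt (verit) mult_pos_pos)
  then have "x \<in> ball (y + \<eta> *\<^sub>R e) (\<rho> * \<eta>)"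
    by (simp add: w_def dist_norm norm_minus_commute algebra_simps)
  ultimately have x\<Omega>: "x \<in> \<Omega>" by blast
  have "\<rho> * \<eta> \<le> \<eta>" using \<rho> \<eta> by (simp add: mult_le_cancel_right1)
  then have xyd: "norm (x - y) \<le> 2 * \<eta>" using \<open>norm (x - y) \<le> norm w + \<eta>\<close> wle by (smt (verit) norm_ge_zero)
  define p where "p = P *\<^sub>R ((1 / S w) *\<^sub>R w)"
  have p: "norm p \<le> P"
    using S(1)[of w] S(3)[of w] PL(1) by (simp add: p_def field_simps)
  define \<phi> where "\<phi> x' = P * S (x' - (y + \<eta> *\<^sub>R e))" for x'
  define \<theta> where "\<theta> y' = P * S (y' - (x - \<eta> *\<^sub>R e)) + norm (y' - xm) ^ 2" for y'
  have C1\<phi>: "C1_with_gradient_on C \<phi> (\<lambda>x'. P *\<^sub>R ((1 / S (x' - (y + \<eta> *\<^sub>R e))) *\<^sub>R (x' - (y + \<eta> *\<^sub>R e))))"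
    unfolding \<phi>_def S_def by (intro C1_with_gradient_on_cmult C1_with_gradient_on_soft_norm \<tau>)
  have C1\<theta>: "C1_with_gradient_on C \<theta> (\<lambda>y'. P *\<^sub>R ((1 / S (y' - (x - \<eta> *\<^sub>R e))) *\<^sub>R (y' - (x - \<eta> *\<^sub>R e)))
      + 2 *\<^sub>R (y' - xm))"
    unfolding \<theta>_def S_def
    by (intro C1_with_gradient_on_add C1_with_gradient_on_cmult C1_with_gradient_on_soft_norm
        C1_with_gradient_on_sqnorm \<tau>)
  have wx: "x - (y + \<eta> *\<^sub>R e) = w" by (simp add: w_def)
  have wy: "y - (x - \<eta> *\<^sub>R e) = - w" by (simp add: w_def)
  have \<theta>S: "S (y' - (x - \<eta> *\<^sub>R e)) = S (x - y' - \<eta> *\<^sub>R e)" for y'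
    using S(5)[of "x - y' - \<eta> *\<^sub>R e"] by (simp add: algebra_simps)
  have ineq: "c\<^sub>2 - c\<^sub>1 \<le> (2 * P + 2 * Dm) * (C\<^sub>2 * \<delta> powr (1 - \<sigma>)) +
       I (- ball 0 \<delta>) u\<^sub>1 x - I (- ball 0 \<delta>) u\<^sub>2 y + H y (p - 2 *\<^sub>R (y - xm)) - H x p"
    if \<delta>: "0 < \<delta>" "\<delta> < 1" for \<delta>
  proof -
    have "u\<^sub>1 x' - \<phi> x' \<le> u\<^sub>1 x - \<phi> x" if "x' \<in> C" for x'
      using max[OF that xy(2)] by (simp add: \<Phi>_def \<phi>_def diff_diff_eq)
    from vsubD[OF sub[unfolded viscosity_subsolution_iff_vsub] C1\<phi> \<delta>(1) x\<Omega> this]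
    have 1: "- I (ball 0 \<delta>) \<phi> x - I (- ball 0 \<delta>) u\<^sub>1 x + H x p \<le> c\<^sub>1"
      by (simp add: wx p_def)
    have "- u\<^sub>2 y' - \<theta> y' \<le> - u\<^sub>2 y - \<theta> y" if "y' \<in> C" for y'
      using max[OF xy(1) that] by (simp add: \<Phi>_def \<theta>_def \<theta>S)
    from vsubD[OF super[unfolded viscosity_supersolution_iff_vsub] C1\<theta> \<delta>(1) xy(2) this]
    have 2: "- I (ball 0 \<delta>) \<theta> y + I (- ball 0 \<delta>) u\<^sub>2 y - H y (p - 2 *\<^sub>R (y - xm)) \<le> - c\<^sub>2"
      unfolding wy S(5) by (simp add: nonlocal_op_minus p_def algebra_simps)
    have 3: "I (ball 0 \<delta>) \<phi> x \<le> P * (C\<^sub>2 * \<delta> powr (1 - \<sigma>))"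
    proof (rule I_near_le[OF xy(1) \<delta>])
      fix z
      have "S (x + z - (y + \<eta> *\<^sub>R e)) \<le> S (x - (y + \<eta> *\<^sub>R e)) + norm z"
        using S(4)[of "x + z - (y + \<eta> *\<^sub>R e)" "x - (y + \<eta> *\<^sub>R e)"] by simp
      then have "P * S (x + z - (y + \<eta> *\<^sub>R e)) \<le> P * (S (x - (y + \<eta> *\<^sub>R e)) + norm z)"
        using PL(1) by (intro mult_left_mono) auto
      then show "\<phi> (x + z) - \<phi> x \<le> P * norm z" by (simp add: \<phi>_def algebra_simps)
    qed (use PL in simp)
    have 4: "I (ball 0 \<delta>) \<theta> y \<le> (P + 2 * Dm) * (C\<^sub>2 * \<delta> powr (1 - \<sigma>))"
    proof (rule I_near_le[OF xy(2) \<delta>])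
      fix z assume z: "y + z \<in> C"
      have "S (y + z - (x - \<eta> *\<^sub>R e)) \<le> S (y - (x - \<eta> *\<^sub>R e)) + norm z"
        using S(4)[of "y + z - (x - \<eta> *\<^sub>R e)" "y - (x - \<eta> *\<^sub>R e)"] by simp
      then have a: "P * S (y + z - (x - \<eta> *\<^sub>R e)) \<le> P * (S (y - (x - \<eta> *\<^sub>R e)) + norm z)"
        using PL(1) by (intro mult_left_mono) auto
      have "norm (y + z - xm) ^ 2 - norm (y - xm) ^ 2
          = (norm (y + z - xm) + norm (y - xm)) * (norm (y + z - xm) - norm (y - xm))"
        by (simp add: power2_eq_square algebra_simps)
      also have "\<dots> \<le> (norm (y + z - xm) + norm (y - xm)) * norm z"
        using norm_triangle_ineq2[of "y + z - xm" "y - xm"] by (intro mult_left_mono) auto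
      also have "\<dots> \<le> (2 * Dm) * norm z"
        using Dm(2)[OF z xm(1)] Dm(2)[OF xy(2) xm(1)] by (intro mult_right_mono) auto
      finally have b: "norm (y + z - xm) ^ 2 - norm (y - xm) ^ 2 \<le> (2 * Dm) * norm z" .
      show "\<theta> (y + z) - \<theta> y \<le> (P + 2 * Dm) * norm z"
        using a b by (simp add: \<theta>_def algebra_simps)
    qed (use PL Dm(1) in simp)
    show ?thesis using 1 2 3 4 by (simp add: algebra_simps)
  qed
  show ?thesis using x\<Omega> xy(2) p yxm xyd ineq by blast
qed

text \<open>For fixed \<open>\<delta>\<close> the shift tends to 0 first: both points converge to
  \<open>xm\<close>, the Hamiltonians cancel and the far terms are ordered there. Only the near
  error, of order \<open>\<delta> powr (1 - \<sigma>)\<close>, remains, and \<open>\<delta>\<close>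
  tends to 0 last.\<close>

lemma subsolution_constant_ge:
  assumes Hc: "continuous_on (C \<times> UNIV) (\<lambda>(x, p). H x p)"
    and cu1: "continuous_on C u\<^sub>1" and cu2: "continuous_on C u\<^sub>2"
    and L: "L > 0" "\<And>x y. x \<in> C \<Longrightarrow> y \<in> C \<Longrightarrow> \<bar>u\<^sub>1 x - u\<^sub>1 y\<bar> \<le> L * norm (x - y)"
    and sub: "viscosity_subsolution \<Omega> \<nu> H c\<^sub>1 u\<^sub>1" and super: "viscosity_supersolution \<Omega> \<nu> H c\<^sub>2 u\<^sub>2"
  shows "c\<^sub>2 \<le> c\<^sub>1"
proof -
  define P where "P = L * (1 + 8 / \<rho>)"
  have P: "P > 0" unfolding P_def using L \<rho> by (simp add: add_pos_nonneg)
  obtain xm where xm: "xm \<in> C" "\<And>y. y \<in> C \<Longrightarrow> u\<^sub>1 y - u\<^sub>2 y \<le> u\<^sub>1 xm - u\<^sub>2 xm"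
    using continuous_attains_sup[OF compact_C nonempty_C continuous_on_diff[OF cu1 cu2]] by blast
  define \<eta>\<^sub>0 where "\<eta>\<^sub>0 = min \<rho> (\<rho>\<^sup>2 / (8 * L))"
  have \<eta>\<^sub>0: "\<eta>\<^sub>0 > 0" "\<eta>\<^sub>0 \<le> \<rho>" "8 * L * \<eta>\<^sub>0 \<le> \<rho>\<^sup>2"
    using \<rho> L by (auto simp: \<eta>\<^sub>0_def min_def field_simps)
  define \<eta> where "\<eta> n = \<eta>\<^sub>0 * inverse (real (Suc n))" for n
  have \<eta>: "\<eta> n > 0" "\<eta> n \<le> \<rho>" "4 * L * \<eta> n < \<rho>\<^sup>2" for n
  proof -
    have i: "inverse (real (Suc n)) > 0" "inverse (real (Suc n)) \<le> 1" by (auto simp: field_simps)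
    show pos: "\<eta> n > 0" using \<eta>\<^sub>0 i by (simp add: \<eta>_def)
    have le: "\<eta> n \<le> \<eta>\<^sub>0" using \<eta>\<^sub>0 i by (simp add: \<eta>_def mult_left_le)
    then show "\<eta> n \<le> \<rho>" using \<eta>\<^sub>0 by simp
    have "4 * L * \<eta> n < 8 * L * \<eta> n" using L pos by simp
    also have "\<dots> \<le> 8 * L * \<eta>\<^sub>0" using le L by simp
    finally show "4 * L * \<eta> n < \<rho>\<^sup>2" using \<eta>\<^sub>0 by simp
  qed
  have "\<eta> \<longlonglongrightarrow> \<eta>\<^sub>0 * 0" unfolding \<eta>_def by (intro tendsto_intros LIMSEQ_inverse_real_of_nat)
  then have \<eta>lim: "\<eta> \<longlonglongrightarrow> 0" by simp
  from doubling[OF cu1 cu2 L sub super xm P_def \<eta>]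
  obtain X Y p where XYp: "\<And>n. X n \<in> \<Omega>" "\<And>n. Y n \<in> C" "\<And>n. norm (p n) \<le> P"
    "\<And>n. norm (Y n - xm) ^ 2 \<le> 4 * L * \<eta> n" "\<And>n. norm (X n - Y n) \<le> 2 * \<eta> n"
    "\<And>n \<delta>. 0 < \<delta> \<Longrightarrow> \<delta> < 1 \<Longrightarrow> c\<^sub>2 - c\<^sub>1 \<le> (2 * P + 2 * Dm) * (C\<^sub>2 * \<delta> powr (1 - \<sigma>)) +
       I (- ball 0 \<delta>) u\<^sub>1 (X n) - I (- ball 0 \<delta>) u\<^sub>2 (Y n) + H (Y n) (p n - 2 *\<^sub>R (Y n - xm)) - H (X n) (p n)"
    by metis
  have XC: "X n \<in> C" for n using XYp(1) \<Omega>_sub_C by blast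
  have "(\<lambda>n. norm (Y n - xm) ^ 2) \<longlonglongrightarrow> 0"
  proof (rule tendsto_sandwich[OF _ _ tendsto_const])
    show "(\<lambda>n. 4 * L * \<eta> n) \<longlonglongrightarrow> 0" using tendsto_mult_left[OF \<eta>lim, of "4 * L"] by simp
  qed (use XYp(4) in auto)
  then have "(\<lambda>n. sqrt (norm (Y n - xm) ^ 2)) \<longlonglongrightarrow> sqrt 0" by (intro tendsto_intros)
  then have Ylim: "Y \<longlonglongrightarrow> xm" by (simp add: tendsto_norm_zero_iff LIM_zero_iff)
  have "(\<lambda>n. X n - Y n) \<longlonglongrightarrow> 0"
  proof (rule Lim_null_comparison)
    show "(\<lambda>n. 2 * \<eta> n) \<longlonglongrightarrow> 0" using tendsto_mult_left[OF \<eta>lim, of 2] by simp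
  qed (use XYp(5) in auto)
  from tendsto_add[OF this Ylim] have Xlim: "X \<longlonglongrightarrow> xm" by simp
  \<comment> \<open>The slopes stay below \<open>P\<close>; along a subsequence both Hamiltonians
    converge to the same value \<open>H xm q\<close>.\<close>
  have "compact (cball (0::'a) P)" by simp
  moreover have "\<forall>n. p n \<in> cball 0 P" using XYp(3) by simp
  ultimately obtain q r where q: "strict_mono r" "(p \<circ> r) \<longlonglongrightarrow> q"
    unfolding compact_def by (metis (no_types, lifting))
  have Xr: "(\<lambda>n. X (r n)) \<longlonglongrightarrow> xm" and Yr: "(\<lambda>n. Y (r n)) \<longlonglongrightarrow> xm" and pr: "(\<lambda>n. p (r n)) \<longlonglongrightarrow> q"
    using LIMSEQ_subseq_LIMSEQ[OF Xlim q(1)] LIMSEQ_subseq_LIMSEQ[OF Ylim q(1)] q(2) by (auto simp: o_def)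
  have bound: "c\<^sub>2 - c\<^sub>1 \<le> (2 * P + 2 * Dm) * (C\<^sub>2 * \<delta> powr (1 - \<sigma>))" if \<delta>: "0 < \<delta>" "\<delta> < 1" for \<delta>
  proof -
    let ?D = "- ball (0::'a) \<delta>"
    have D: "?D \<in> sets borel" "?D \<subseteq> - ball 0 \<delta>" by auto
    have u1: "(\<lambda>n. I ?D u\<^sub>1 (X (r n))) \<longlonglongrightarrow> I ?D u\<^sub>1 xm"
      by (rule continuous_on_tendsto_compose[OF continuous_far[OF cu1 D(1) \<delta>(1) D(2)] Xr xm(1)])
        (use XC in simp)
    have u2: "(\<lambda>n. I ?D u\<^sub>2 (Y (r n))) \<longlonglongrightarrow> I ?D u\<^sub>2 xm"
      by (rule continuous_on_tendsto_compose[OF continuous_far[OF cu2 D(1) \<delta>(1) D(2)] Yr xm(1)])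
        (use XYp(2) in simp)
    have "(\<lambda>n. (Y (r n), p (r n) - 2 *\<^sub>R (Y (r n) - xm))) \<longlonglongrightarrow> (xm, q - 2 *\<^sub>R (xm - xm))"
      by (intro tendsto_intros Yr pr)
    then have H1: "(\<lambda>n. H (Y (r n)) (p (r n) - 2 *\<^sub>R (Y (r n) - xm))) \<longlonglongrightarrow> H xm q"
      using continuous_on_tendsto_compose[OF Hc, of "\<lambda>n. (Y (r n), p (r n) - 2 *\<^sub>R (Y (r n) - xm))" "(xm, q)"]
        xm(1) XYp(2) by simp
    have "(\<lambda>n. (X (r n), p (r n))) \<longlonglongrightarrow> (xm, q)"
      by (intro tendsto_intros Xr pr)
    then have H2: "(\<lambda>n. H (X (r n)) (p (r n))) \<longlonglongrightarrow> H xm q"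
      using continuous_on_tendsto_compose[OF Hc, of "\<lambda>n. (X (r n), p (r n))" "(xm, q)"] xm(1) XC by simp
    let ?K = "(2 * P + 2 * Dm) * (C\<^sub>2 * \<delta> powr (1 - \<sigma>))"
    have "(\<lambda>n. ?K + I ?D u\<^sub>1 (X (r n)) - I ?D u\<^sub>2 (Y (r n)) +
        H (Y (r n)) (p (r n) - 2 *\<^sub>R (Y (r n) - xm)) - H (X (r n)) (p (r n)))
        \<longlonglongrightarrow> ?K + I ?D u\<^sub>1 xm - I ?D u\<^sub>2 xm + H xm q - H xm q"
      by (intro tendsto_intros u1 u2 H1 H2)
    then have "c\<^sub>2 - c\<^sub>1 \<le> ?K + I ?D u\<^sub>1 xm - I ?D u\<^sub>2 xm + H xm q - H xm q"
      by (rule LIMSEQ_le_const) (use XYp(6)[OF \<delta>] in blast)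
    \<comment> \<open>Both far terms now sit at \<open>xm\<close>, a maximum of
      \<open>u\<^sub>1 - u\<^sub>2\<close>, so their increments compare without error.\<close>
    moreover have "I ?D u\<^sub>1 xm \<le> I ?D u\<^sub>2 xm + 0 * (C\<^sub>1 * \<delta> powr (- \<sigma>))"
    proof (rule I_far_le[OF cu2 cu1 xm(1) D(1) \<delta>(1) D(2)])
      show "u\<^sub>1 (xm + z) - u\<^sub>1 xm \<le> u\<^sub>2 (xm + z) - u\<^sub>2 xm + 0" if "xm + z \<in> C" for z
        using xm(2)[OF that] by linarith
    qed simp
    ultimately show ?thesis by simp
  qed
  have "((\<lambda>\<delta>. (2 * P + 2 * Dm) * (C\<^sub>2 * \<delta> powr (1 - \<sigma>))) \<longlongrightarrow> (2 * P + 2 * Dm) * (C\<^sub>2 * 0 powr (1 - \<sigma>))) (at_right 0)"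
    using \<sigma> by (intro tendsto_intros tendsto_powr2)
      (auto simp: eventually_at_right_field intro: exI[of _ 1])
  then have lim: "((\<lambda>\<delta>. (2 * P + 2 * Dm) * (C\<^sub>2 * \<delta> powr (1 - \<sigma>))) \<longlongrightarrow> 0) (at_right 0)" by simp
  have "\<forall>\<^sub>F \<delta> in at_right 0. c\<^sub>2 - c\<^sub>1 \<le> (2 * P + 2 * Dm) * (C\<^sub>2 * \<delta> powr (1 - \<sigma>))"
    unfolding eventually_at_right_field using bound by (intro exI[of _ 1]) auto
  from tendsto_lowerbound[OF lim this] show ?thesis by simp
qed

end

section \<open>Existence\<close>

lemma gradient_zero_at_interior_min:
  assumes "C1_with_gradient_on S f F" "open A" "A \<subseteq> S" "x \<in> A" "\<And>y. y \<in> S \<Longrightarrow> f x \<le> f y"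
  shows "F x = 0"
proof -
  have "x \<in> interior S" using assms interior_maximal by blast
  then have "at x within S = at x" by (rule at_within_interior)
  then have "(f has_derivative (\<lambda>h. F x \<bullet> h)) (at x)"
    using assms unfolding C1_with_gradient_on_def by (metis subsetD)
  moreover have "\<forall>\<^sub>F y in at x. f x \<le> f y"
    using assms by (auto simp: eventually_at_topological)
  ultimately have "(\<lambda>h. F x \<bullet> h) = (\<lambda>h. 0)" by (rule has_derivative_local_min)
  then have "F x \<bullet> F x = 0" by metis
  then show ?thesis by simp
qed

context coercive_setting
begin

text \<open>A test function touching a constant from above inside \<open>\<Omega>\<close> has zero
  gradient and nonnegative increments. The result makes the Perron class nonempty.\<close>

lemma discounted_constant_subsolution:
  assumes \<kappa>: "\<kappa> > 0" and Cb: "\<And>x. x \<in> C \<Longrightarrow> H x 0 \<le> Cb"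
  shows "vsub \<Omega> \<nu> \<Omega> H (\<lambda>x. - \<kappa> * (- (Cb / \<kappa>))) (\<lambda>_. - (Cb / \<kappa>))"
  unfolding vsub_def
proof (intro allI impI ballI)
  fix \<phi> G \<delta> x
  assume C1: "C1_with_gradient_on C \<phi> G" and "(0::real) < \<delta>" and x: "x \<in> \<Omega>"
    and max: "\<forall>y\<in>C. - (Cb / \<kappa>) - \<phi> y \<le> - (Cb / \<kappa>) - \<phi> x"
  have xC: "x \<in> C" using x \<Omega>_sub_C by blast
  have "G x = 0"
    by (rule gradient_zero_at_interior_min[OF C1 open_\<Omega> \<Omega>_sub_C x]) (use max in auto)
  moreover have "I (ball 0 \<delta>) (\<lambda>x. - \<phi> x) x \<le> 0" by (rule I_nonpos) (use max in auto)
  moreover have "I (- ball 0 \<delta>) (\<lambda>_. - (Cb / \<kappa>)) x = 0" by (simp add: nonlocal_op_def set_lebesgue_integral_def)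
  ultimately show "- I (ball 0 \<delta>) \<phi> x - I (- ball 0 \<delta>) (\<lambda>_. - (Cb / \<kappa>)) x + H x (G x)
      \<le> - \<kappa> * (- (Cb / \<kappa>))"
    using Cb[OF xC] \<kappa> by (simp add: nonlocal_op_minus)
qed

text \<open>The local modification of Perron's method. Where the bump is active, the maximum has
  lost at most \<open>h\<close> against \<open>u\<close> in its far increments; the slack
  \<open>h * (C\<^sub>1 * \<delta> powr (- \<sigma>))\<close> in \<open>strict\<close> pays for
  this.\<close>

lemma vsub_bump:
  assumes cu: "continuous_on C u" and sub: "vsub \<Omega> \<nu> \<Omega> H (\<lambda>x. - \<kappa> * u x) u"
    and C1: "C1_with_gradient_on C \<psi> G" and \<delta>: "\<delta> > 0"
    and le: "\<And>x. x \<in> C \<Longrightarrow> \<psi> x \<le> u x" and h: "h \<ge> 0"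
    and strict: "\<And>x. x \<in> C \<Longrightarrow> \<psi> x + h > u x \<Longrightarrow>
      - I (ball 0 \<delta>) \<psi> x - I (- ball 0 \<delta>) u x + H x (G x) + h * (C\<^sub>1 * \<delta> powr (- \<sigma>)) \<le> - \<kappa> * (\<psi> x + h)"
  shows "vsub \<Omega> \<nu> \<Omega> H (\<lambda>x. - \<kappa> * max (u x) (\<psi> x + h)) (\<lambda>x. max (u x) (\<psi> x + h))"
  unfolding vsub_def
proof (intro allI impI ballI)
  define w where "w x = max (u x) (\<psi> x + h)" for x
  fix \<phi> F \<delta>' x
  assume C1\<phi>: "C1_with_gradient_on C \<phi> F" and \<delta>': "(0::real) < \<delta>'" and x: "x \<in> \<Omega>"
    and "\<forall>y\<in>C. max (u y) (\<psi> y + h) - \<phi> y \<le> max (u x) (\<psi> x + h) - \<phi> x"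
  then have mx: "\<And>y. y \<in> C \<Longrightarrow> w y - \<phi> y \<le> w x - \<phi> x" by (simp add: w_def)
  have xC: "x \<in> C" using x \<Omega>_sub_C by blast
  have c\<psi>: "continuous_on C \<psi>" using C1_with_gradient_on_continuous[OF C1] .
  have cw: "continuous_on C w" unfolding w_def using cu c\<psi> by (intro continuous_intros)
  show "- I (ball 0 \<delta>') \<phi> x - I (- ball 0 \<delta>') (\<lambda>x. max (u x) (\<psi> x + h)) x + H x (F x)
      \<le> - \<kappa> * max (u x) (\<psi> x + h)"
    unfolding w_def[symmetric]
  proof (cases "\<psi> x + h \<le> u x")
    case True
    then have wx: "w x = u x" by (simp add: w_def)
    have "u y - \<phi> y \<le> u x - \<phi> x" if "y \<in> C" for y
      using mx[OF that] wx max.cobounded1[of "u y" "\<psi> y + h"] by (simp add: w_def)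
    from vsubD[OF sub C1\<phi> \<delta>' x this]
    have "- I (ball 0 \<delta>') \<phi> x - I (- ball 0 \<delta>') u x + H x (F x) \<le> - \<kappa> * w x" using wx by simp
    moreover have "I (- ball 0 \<delta>') u x \<le> I (- ball 0 \<delta>') w x + 0 * (C\<^sub>1 * \<delta>' powr (- \<sigma>))"
    proof (rule I_far_le[OF cw cu xC _ \<delta>'])
      show "u (x + z) - u x \<le> w (x + z) - w x + 0" for z
        using wx max.cobounded1[of "u (x + z)" "\<psi> (x + z) + h"] unfolding w_def by linarith
    qed auto
    ultimately show "- I (ball 0 \<delta>') \<phi> x - I (- ball 0 \<delta>') w x + H x (F x) \<le> - \<kappa> * w x" by simp
  next
    case False
    then have wx: "w x = \<psi> x + h" by (simp add: w_def)
    \<comment> \<open>The bump lies below the maximum and agrees with it at \<open>x\<close>, so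
      \<open>\<phi> - \<psi>\<close> has a minimum at \<open>x\<close>, which is interior.\<close>
    have grad: "F x = G x"
    proof -
      have "C1_with_gradient_on C (\<lambda>y. \<phi> y + - \<psi> y) (\<lambda>y. F y + - G y)"
        by (intro C1_with_gradient_on_add C1\<phi> C1_with_gradient_on_minus C1)
      moreover have "\<phi> x + - \<psi> x \<le> \<phi> y + - \<psi> y" if "y \<in> C" for y
        using mx[OF that] wx max.cobounded2[of "\<psi> y + h" "u y"] by (simp add: w_def)
      ultimately have "F x + - G x = 0"
        using gradient_zero_at_interior_min[OF _ open_\<Omega> \<Omega>_sub_C x] by blast
      then show ?thesis by simp
    qed
    let ?B = "ball (0::'a) \<delta>" and ?B' = "ball (0::'a) \<delta>'"
    have w\<psi>: "\<psi> (x + z) - \<psi> x \<le> w (x + z) - w x" for z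
      using wx max.cobounded2[of "\<psi> (x + z) + h" "u (x + z)"] by (simp add: w_def)
    have w\<phi>: "w (x + z) - w x \<le> \<phi> (x + z) - \<phi> x" if "x + z \<in> C" for z
      using mx[OF that] by linarith
    have uw: "u (x + z) - u x \<le> w (x + z) - w x + h" for z
      using wx le[OF xC] max.cobounded1[of "u (x + z)" "\<psi> (x + z) + h"] unfolding w_def by linarith
    have far: "I (- ?B) u x \<le> I (- ?B) w x + h * (C\<^sub>1 * \<delta> powr (- \<sigma>))"
      by (rule I_far_le[OF cw cu xC _ \<delta> _ h]) (use uw in auto)
    note int1 = integrable_C1(1)[OF C1 xC] and int2 = integrable_C1(1)[OF C1\<phi> xC]
    \<comment> \<open>\<open>strict\<close> is known at the radius \<open>\<delta>\<close>, the test
      uses \<open>\<delta>'\<close>. On the shell between them the increments are ordered as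
      \<open>\<psi>\<close>, \<open>w\<close>, \<open>\<phi>\<close>, which allows the exchange in
      either direction.\<close>
    have low: "I ?B \<psi> x + I (- ?B) w x \<le> I ?B' \<phi> x + I (- ?B') w x"
    proof (cases "\<delta>' \<le> \<delta>")
      case True
      have intw: "set_integrable (\<nu> x) (jumps D x) (\<lambda>z. w (x + z) - w x)"
        if "D \<in> sets borel" "D \<subseteq> - ?B'" for D
        by (rule integrable_far[OF cw xC that(1) \<delta>' that(2)])
      have sub': "- ?B \<subseteq> - ?B'" "?B - ?B' \<subseteq> - ?B'" using True by auto
      have "I (?B' \<union> (?B - ?B')) \<psi> x = I ?B' \<psi> x + I (?B - ?B') \<psi> x"
        by (rule I_union[OF int1 int1]) auto
      moreover have "?B' \<union> (?B - ?B') = ?B" using True by auto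
      ultimately have "I ?B \<psi> x = I ?B' \<psi> x + I (?B - ?B') \<psi> x" by simp
      moreover have "I ((?B - ?B') \<union> - ?B) w x = I (?B - ?B') w x + I (- ?B) w x"
        by (rule I_union[OF intw intw]) (use sub' in auto)
      moreover have "(?B - ?B') \<union> - ?B = - ?B'" using True by auto
      ultimately have eq: "I ?B \<psi> x = I ?B' \<psi> x + I (?B - ?B') \<psi> x"
        "I (- ?B') w x = I (?B - ?B') w x + I (- ?B) w x" by simp_all
      have "I ?B' \<psi> x \<le> I ?B' \<phi> x"
        by (rule I_mono[OF int1 int2]) (use w\<psi> w\<phi> in \<open>auto intro: order_trans\<close>)
      moreover have "I (?B - ?B') \<psi> x \<le> I (?B - ?B') w x"
        by (rule I_mono[OF int1 intw]) (use sub' w\<psi> in auto)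
      ultimately show ?thesis using eq by linarith
    next
      case False
      have intw: "set_integrable (\<nu> x) (jumps D x) (\<lambda>z. w (x + z) - w x)"
        if "D \<in> sets borel" "D \<subseteq> - ?B" for D
        by (rule integrable_far[OF cw xC that(1) \<delta> that(2)])
      have sub': "- ?B' \<subseteq> - ?B" "?B' - ?B \<subseteq> - ?B" using False by auto
      have "I (?B \<union> (?B' - ?B)) \<phi> x = I ?B \<phi> x + I (?B' - ?B) \<phi> x"
        by (rule I_union[OF int2 int2]) auto
      moreover have "?B \<union> (?B' - ?B) = ?B'" using False by auto
      ultimately have "I ?B' \<phi> x = I ?B \<phi> x + I (?B' - ?B) \<phi> x" by simp
      moreover have "I ((?B' - ?B) \<union> - ?B') w x = I (?B' - ?B) w x + I (- ?B') w x"
        by (rule I_union[OF intw intw]) (use sub' in auto)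
      moreover have "(?B' - ?B) \<union> - ?B' = - ?B" using False by auto
      ultimately have eq: "I ?B' \<phi> x = I ?B \<phi> x + I (?B' - ?B) \<phi> x"
        "I (- ?B) w x = I (?B' - ?B) w x + I (- ?B') w x" by simp_all
      have "I ?B \<psi> x \<le> I ?B \<phi> x"
        by (rule I_mono[OF int1 int2]) (use w\<psi> w\<phi> in \<open>auto intro: order_trans\<close>)
      moreover have "I (?B' - ?B) w x \<le> I (?B' - ?B) \<phi> x"
        by (rule I_mono[OF intw int2]) (use sub' w\<phi> in auto)
      ultimately show ?thesis using eq by linarith
    qed
    have "- I (ball 0 \<delta>) \<psi> x - I (- ball 0 \<delta>) u x + H x (G x) + h * (C\<^sub>1 * \<delta> powr (- \<sigma>)) \<le> - \<kappa> * w x"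
      using strict[OF xC] False wx by simp
    then show "- I (ball 0 \<delta>') \<phi> x - I (- ball 0 \<delta>') w x + H x (F x) \<le> - \<kappa> * w x"
      unfolding grad using far low by linarith
  qed
qed

text \<open>Perron's method; by \<open>lipschitz_of_subsolution\<close> the class of competitors is equi-Lipschitz.\<close>

lemma discounted_solution:
  assumes \<kappa>: "\<kappa> > 0" and Cb: "Cb \<ge> C\<^sub>H" "\<And>x. x \<in> C \<Longrightarrow> H x 0 \<le> Cb"
  obtains u L where "\<And>x. x \<in> C \<Longrightarrow> \<bar>\<kappa> * u x\<bar> \<le> Cb"
    "\<And>x y. x \<in> C \<Longrightarrow> y \<in> C \<Longrightarrow> \<bar>u x - u y\<bar> \<le> L * norm (x - y)"
    "vsub \<Omega> \<nu> \<Omega> H (\<lambda>x. - \<kappa> * u x) u"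
    "vsub \<Omega> \<nu> C (\<lambda>x p. - H x (- p)) (\<lambda>x. \<kappa> * u x) (\<lambda>x. - u x)"
proof -
  have Cb0: "Cb \<ge> 0" using Cb C\<^sub>H by simp
  define B where "B = Cb / \<kappa>"
  have B: "B \<ge> 0" "\<kappa> * B = Cb" using Cb0 \<kappa> by (auto simp: B_def)
  define S where "S = {v. continuous_on C v \<and> (\<forall>x\<in>C. \<bar>v x\<bar> \<le> B) \<and> vsub \<Omega> \<nu> \<Omega> H (\<lambda>x. - \<kappa> * v x) v}"
  have S_ne: "(\<lambda>_. - B) \<in> S"
    using discounted_constant_subsolution[OF \<kappa> Cb(2)] B by (auto simp: S_def B_def)
  obtain L where L: "L > 0"
    "\<And>u f x y. continuous_on C u \<Longrightarrow> (\<And>x. x \<in> C \<Longrightarrow> \<bar>u x\<bar> \<le> B) \<Longrightarrow> (\<And>x. x \<in> \<Omega> \<Longrightarrow> f x \<le> Cb) \<Longrightarrow>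
      vsub \<Omega> \<nu> \<Omega> H f u \<Longrightarrow> x \<in> C \<Longrightarrow> y \<in> C \<Longrightarrow> \<bar>u x - u y\<bar> \<le> L * norm (x - y)"
    using lipschitz_of_subsolution[OF B(1) Cb0] by blast
  have SL: "\<bar>v x - v y\<bar> \<le> L * norm (x - y)" if v: "v \<in> S" and xy: "x \<in> C" "y \<in> C" for v x y
  proof (rule L(2)[OF _ _ _ _ xy])
    show "- \<kappa> * v x \<le> Cb" if "x \<in> \<Omega>" for x
    proof -
      have "\<bar>v x\<bar> \<le> B" using v that \<Omega>_sub_C unfolding S_def by blast
      then have "\<kappa> * (- v x) \<le> \<kappa> * B" using \<kappa> by (intro mult_left_mono) auto
      then show ?thesis using B by simp
    qed
  qed (use v in \<open>auto simp: S_def\<close>)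
  have Sb: "\<bar>v x\<bar> \<le> B" if "v \<in> S" "x \<in> C" for v x using that by (auto simp: S_def)
  define u where "u x = (SUP v\<in>S. v x)" for x
  have bdd: "bdd_above ((\<lambda>v. v x) ` S)" if "x \<in> C" for x
    using Sb[OF _ that] by (intro bdd_aboveI2[of _ _ B]) (auto simp: abs_le_iff)
  have up: "v x \<le> u x" if "v \<in> S" "x \<in> C" for v x
    unfolding u_def using that bdd by (intro cSUP_upper)
  have ub: "u x \<le> c" if "x \<in> C" "\<And>v. v \<in> S \<Longrightarrow> v x \<le> c" for x c
    unfolding u_def using that S_ne by (intro cSUP_least) auto
  have uB: "\<bar>u x\<bar> \<le> B" if "x \<in> C" for x
  proof -
    have "u x \<le> B" by (rule ub[OF that]) (use Sb[OF _ that] in \<open>auto simp: abs_le_iff\<close>)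
    moreover have "- B \<le> u x" using up[OF S_ne that] by simp
    ultimately show ?thesis by linarith
  qed
  have uL1: "u x \<le> u y + L * norm (x - y)" if xy: "x \<in> C" "y \<in> C" for x y
  proof (rule ub[OF xy(1)])
    fix v assume v: "v \<in> S"
    show "v x \<le> u y + L * norm (x - y)" using SL[OF v xy] up[OF v xy(2)] by linarith
  qed
  have uL: "\<bar>u x - u y\<bar> \<le> L * norm (x - y)" if "x \<in> C" "y \<in> C" for x y
    using uL1[OF that] uL1[OF that(2,1)] by (simp add: norm_minus_commute abs_le_iff)
  have cu: "continuous_on C u"
  proof (rule lipschitz_on_continuous_on)
    show "L-lipschitz_on C u" by (rule lipschitz_onI) (use uL L(1) in \<open>auto simp: dist_norm\<close>)
  qed
  have sub: "vsub \<Omega> \<nu> \<Omega> H (\<lambda>x. - \<kappa> * u x) u"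
  proof (rule vsub_stable[OF H_cont \<Omega>_sub_C _ cu, where K=\<kappa>])
    show "\<exists>s>0. ball x s \<inter> C \<subseteq> \<Omega>" if "x \<in> \<Omega>" for x
      using open_\<Omega> that openE by (metis inf.coboundedI1)
    show "continuous_on C (\<lambda>x. - \<kappa> * u x)" using cu by (intro continuous_intros)
    fix x\<^sub>0 and \<epsilon> :: real assume x\<^sub>0: "x\<^sub>0 \<in> \<Omega>" and \<epsilon>: "\<epsilon> > 0"
    have x\<^sub>0C: "x\<^sub>0 \<in> C" using x\<^sub>0 \<Omega>_sub_C by blast
    \<comment> \<open>\<open>v\<close> is close to \<open>u\<close> only at
      \<open>x\<^sub>0\<close>; where it lies far below, its larger right-hand side is absorbed by
      \<open>\<kappa> * \<bar>u x - v x\<bar>\<close>.\<close>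
    obtain v where v: "v \<in> S" "v x\<^sub>0 > u x\<^sub>0 - \<epsilon>"
      using ub[OF x\<^sub>0C, of "u x\<^sub>0 - \<epsilon>"] \<epsilon> by (meson diff_less_eq less_add_same_cancel1 not_le)
    show "\<exists>v g. continuous_on C v \<and> vsub \<Omega> \<nu> \<Omega> H g v \<and> (\<forall>x\<in>C. v x \<le> u x + \<epsilon>) \<and>
        u x\<^sub>0 - \<epsilon> \<le> v x\<^sub>0 \<and> (\<forall>x\<in>C. g x \<le> - \<kappa> * u x + \<kappa> * \<bar>u x - v x\<bar> + \<epsilon>)"
    proof (rule exI[of _ v], rule exI[of _ "\<lambda>x. - \<kappa> * v x"], intro conjI ballI)
      show "continuous_on C v" "vsub \<Omega> \<nu> \<Omega> H (\<lambda>x. - \<kappa> * v x) v" using v(1) by (auto simp: S_def)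
      show "u x\<^sub>0 - \<epsilon> \<le> v x\<^sub>0" using v(2) by simp
      fix x assume x: "x \<in> C"
      show "v x \<le> u x + \<epsilon>" using up[OF v(1) x] \<epsilon> by simp
      have "\<kappa> * (u x - v x) \<le> \<kappa> * \<bar>u x - v x\<bar>" using \<kappa> by (intro mult_left_mono) auto
      then show "- \<kappa> * v x \<le> - \<kappa> * u x + \<kappa> * \<bar>u x - v x\<bar> + \<epsilon>" using \<epsilon> by (simp add: algebra_simps)
    qed
  qed (use \<kappa> in simp)
  have super: "vsub \<Omega> \<nu> C (\<lambda>x p. - H x (- p)) (\<lambda>x. \<kappa> * u x) (\<lambda>x. - u x)"
    unfolding vsub_def
  proof (intro allI impI ballI)
    fix \<phi>' G' \<delta> x\<^sub>0
    assume C1': "C1_with_gradient_on C \<phi>' G'" and \<delta>: "(0::real) < \<delta>" and x\<^sub>0: "x\<^sub>0 \<in> C"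
      and mx: "\<forall>y\<in>C. - u y - \<phi>' y \<le> - u x\<^sub>0 - \<phi>' x\<^sub>0"
    let ?B = "ball (0::'a) \<delta>"
    have Iu: "I (- ?B) (\<lambda>x. - u x) x\<^sub>0 = - I (- ?B) u x\<^sub>0" by (rule nonlocal_op_minus)
    show "- I ?B \<phi>' x\<^sub>0 - I (- ?B) (\<lambda>x. - u x) x\<^sub>0 + - H x\<^sub>0 (- G' x\<^sub>0) \<le> \<kappa> * u x\<^sub>0"
    proof (rule ccontr)
      assume "\<not> ?thesis"
      then have neg: "I ?B \<phi>' x\<^sub>0 - I (- ?B) u x\<^sub>0 + H x\<^sub>0 (- G' x\<^sub>0) < - \<kappa> * u x\<^sub>0"
        unfolding Iu by simp
      \<comment> \<open>Room for the bump under the ceiling \<open>B\<close>. If \<open>u\<close>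
        had its top value \<open>B\<close> at \<open>x\<^sub>0\<close>, all jumps would go down, and
        coercivity with \<open>Cb \<ge> C\<^sub>H\<close> would already give the supersolution
        inequality.\<close>
      have uxB: "u x\<^sub>0 < B"
      proof (rule ccontr)
        assume "\<not> u x\<^sub>0 < B"
        then have top: "u x\<^sub>0 = B" using uB[OF x\<^sub>0] by linarith
        have le: "u y \<le> u x\<^sub>0" if "y \<in> C" for y using uB[OF that] top by linarith
        have "I (- ?B) u x\<^sub>0 \<le> 0" by (rule I_nonpos) (use le in auto)
        moreover have "I ?B (\<lambda>x. - \<phi>' x) x\<^sub>0 \<le> 0"
          by (rule I_nonpos) (use le mx in fastforce)
        then have "I ?B \<phi>' x\<^sub>0 \<ge> 0" by (simp add: nonlocal_op_minus)
        moreover have "c\<^sub>H * norm (- G' x\<^sub>0) powr m \<ge> 0" using c\<^sub>H by simp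
        then have "H x\<^sub>0 (- G' x\<^sub>0) \<ge> - C\<^sub>H" using coercive[OF x\<^sub>0, of "- G' x\<^sub>0"] by linarith
        ultimately show False using neg top B(2) Cb(1) by simp
      qed
      define J where "J = I ?B (\<lambda>y. norm (y - x\<^sub>0) ^ 2) x\<^sub>0"
      define g where "g = - \<kappa> * u x\<^sub>0 - (I ?B \<phi>' x\<^sub>0 - I (- ?B) u x\<^sub>0 + H x\<^sub>0 (- G' x\<^sub>0))"
      have g: "g > 0" using neg by (simp add: g_def)
      define t where "t = \<bar>J\<bar> + 1"
      have t: "t > 0" "J \<le> t" by (auto simp: t_def)
      \<comment> \<open>The parabola that separates the bump from \<open>u\<close> away from
        \<open>x\<^sub>0\<close> may use up half of the gap \<open>g\<close>.\<close>
      define \<alpha> where "\<alpha> = g / (2 * t)"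
      have \<alpha>: "\<alpha> > 0" using g t by (simp add: \<alpha>_def)
      have \<alpha>J: "\<alpha> * J \<le> g / 2"
      proof -
        have "\<alpha> * J \<le> \<alpha> * t" using \<alpha> t by (intro mult_left_mono) auto
        also have "\<dots> = g / 2" using t by (simp add: \<alpha>_def)
        finally show ?thesis .
      qed
      define \<theta> where "\<theta> y = \<phi>' y + \<alpha> * norm (y - x\<^sub>0) ^ 2" for y
      define F where "F y = G' y + \<alpha> *\<^sub>R (2 *\<^sub>R (y - x\<^sub>0))" for y
      have C1\<theta>: "C1_with_gradient_on C \<theta> F" unfolding \<theta>_def F_def
        by (intro C1_with_gradient_on_add C1' C1_with_gradient_on_cmult C1_with_gradient_on_sqnorm)
      define \<psi> where "\<psi> y = - \<theta> y + (u x\<^sub>0 + \<phi>' x\<^sub>0)" for y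
      have C1: "C1_with_gradient_on C \<psi> (\<lambda>y. - F y)"
        using C1_with_gradient_on_add[OF C1_with_gradient_on_minus[OF C1\<theta>] C1_with_gradient_on_const[of _ "u x\<^sub>0 + \<phi>' x\<^sub>0"]]
        unfolding \<psi>_def by simp
      have \<psi>x\<^sub>0: "\<psi> x\<^sub>0 = u x\<^sub>0" by (simp add: \<psi>_def \<theta>_def)
      have \<psi>u: "\<psi> y \<le> u y - \<alpha> * norm (y - x\<^sub>0) ^ 2" if "y \<in> C" for y
        using mx that by (fastforce simp: \<psi>_def \<theta>_def)
      have I\<psi>: "I ?B \<psi> x\<^sub>0 = - (I ?B \<phi>' x\<^sub>0 + \<alpha> * J)"
      proof -
        have "I ?B \<psi> x\<^sub>0 = - I ?B \<theta> x\<^sub>0" unfolding \<psi>_def nonlocal_op_add_const nonlocal_op_minus ..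
        also have "I ?B \<theta> x\<^sub>0 = I ?B \<phi>' x\<^sub>0 + \<alpha> * J"
          unfolding \<theta>_def J_def by (rule I_C1_add_sqnorm[OF C1' x\<^sub>0]) simp
        finally show ?thesis .
      qed
      define M where "M = C\<^sub>1 * \<delta> powr (- \<sigma>)"
      have M: "M \<ge> 0" using C\<^sub>1 by (simp add: M_def)
      \<comment> \<open>The discounted residual of \<open>\<psi>\<close> with the far jumps of
        \<open>u\<close>. Being continuous, it stays negative near \<open>x\<^sub>0\<close>, also
        within \<open>C\<close> at a boundary point.\<close>
      define K where "K y = - I ?B \<psi> y - I (- ?B) u y + H y (- F y) + \<kappa> * \<psi> y" for y
      have c\<psi>: "continuous_on C \<psi>" using C1_with_gradient_on_continuous[OF C1] .
      have "continuous_on C K" unfolding K_def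
        by (intro continuous_intros continuous_C1[OF C1 x\<^sub>0] continuous_far[OF cu _ \<delta>]
            continuous_hamiltonian[OF H_cont C1] c\<psi>) auto
      moreover have "K x\<^sub>0 \<le> - (g / 2)"
      proof -
        have "K x\<^sub>0 = \<alpha> * J - g" unfolding K_def I\<psi> \<psi>x\<^sub>0 by (simp add: g_def F_def)
        then show ?thesis using \<alpha>J by linarith
      qed
      ultimately obtain s\<^sub>1 where s\<^sub>1: "s\<^sub>1 > 0" "\<And>y. y \<in> C \<Longrightarrow> dist y x\<^sub>0 < s\<^sub>1 \<Longrightarrow> K y < - (g / 4)"
      proof -
        assume cK: "continuous_on C K" and Kx: "K x\<^sub>0 \<le> - (g / 2)"
          and th: "\<And>s\<^sub>1. s\<^sub>1 > 0 \<Longrightarrow> (\<And>y. y \<in> C \<Longrightarrow> dist y x\<^sub>0 < s\<^sub>1 \<Longrightarrow> K y < - (g / 4)) \<Longrightarrow> thesis"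
        have "g / 4 > 0" using g by simp
        then obtain d where d: "d > 0" "\<And>y. y \<in> C \<Longrightarrow> dist y x\<^sub>0 < d \<Longrightarrow> dist (K y) (K x\<^sub>0) < g / 4"
          using cK x\<^sub>0 unfolding continuous_on_iff by meson
        show thesis
        proof (rule th[OF d(1)])
          show "K y < - (g / 4)" if "y \<in> C" "dist y x\<^sub>0 < d" for y
            using d(2)[OF that] Kx unfolding dist_real_def by linarith
        qed
      qed
      define e where "e = (B - u x\<^sub>0) / 2"
      have e: "e > 0" using uxB by (simp add: e_def)
      obtain s\<^sub>2 where s\<^sub>2: "s\<^sub>2 > 0" "\<And>y. y \<in> C \<Longrightarrow> dist y x\<^sub>0 < s\<^sub>2 \<Longrightarrow> \<psi> y < u x\<^sub>0 + e"
      proof -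
        obtain d where d: "d > 0" "\<And>y. y \<in> C \<Longrightarrow> dist y x\<^sub>0 < d \<Longrightarrow> dist (\<psi> y) (\<psi> x\<^sub>0) < e"
          using c\<psi> x\<^sub>0 e unfolding continuous_on_iff by meson
        show ?thesis
        proof (rule that[OF d(1)])
          show "\<psi> y < u x\<^sub>0 + e" if "y \<in> C" "dist y x\<^sub>0 < d" for y
            using d(2)[OF that] \<psi>x\<^sub>0 unfolding dist_real_def by linarith
        qed
      qed
      define s where "s = min s\<^sub>1 s\<^sub>2"
      have s: "s > 0" "s \<le> s\<^sub>1" "s \<le> s\<^sub>2" using s\<^sub>1 s\<^sub>2 by (auto simp: s_def)
      \<comment> \<open>Three constraints: the bump is active only within \<open>s\<close> of
        \<open>x\<^sub>0\<close>, it stays below \<open>B\<close>, and its cost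
        \<open>h * (\<kappa> + M)\<close> fits into the remaining gap \<open>g / 4\<close>.\<close>
      define h where "h = min (\<alpha> * s\<^sup>2) (min e (g / 4 / (\<kappa> + M)))"
      have h: "h > 0" "h \<le> \<alpha> * s\<^sup>2" "h \<le> e" "h * (\<kappa> + M) \<le> g / 4"
      proof -
        have \<kappa>M: "\<kappa> + M > 0" using \<kappa> M by simp
        show "h > 0" using \<alpha> s e g \<kappa>M by (simp add: h_def)
        show "h \<le> \<alpha> * s\<^sup>2" "h \<le> e" by (auto simp: h_def)
        have "h \<le> g / 4 / (\<kappa> + M)" by (simp add: h_def)
        then show "h * (\<kappa> + M) \<le> g / 4" using \<kappa>M by (simp only: pos_le_divide_eq)
      qed
      have close: "dist y x\<^sub>0 < s" if "y \<in> C" "\<psi> y + h > u y" for y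
      proof -
        have "\<alpha> * norm (y - x\<^sub>0) ^ 2 < \<alpha> * s\<^sup>2" using \<psi>u[OF that(1)] that(2) h(2) by linarith
        then have "norm (y - x\<^sub>0) ^ 2 < s\<^sup>2" using \<alpha> by simp
        then show ?thesis using s(1) by (simp add: dist_norm power2_less_imp_less)
      qed
      define w where "w y = max (u y) (\<psi> y + h)" for y
      have "w \<in> S" unfolding S_def
      proof (intro CollectI conjI ballI)
        show "continuous_on C w" unfolding w_def using cu c\<psi> by (intro continuous_intros)
        show "\<bar>w y\<bar> \<le> B" if y: "y \<in> C" for y
        proof (cases "\<psi> y + h > u y")
          case True
          have "\<psi> y < u x\<^sub>0 + e" using s\<^sub>2(2)[OF y] close[OF y True] s by linarith
          then have "\<psi> y + h \<le> B" using h(3) unfolding e_def by (simp add: field_simps)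
          then show ?thesis using uB[OF y] True by (simp add: w_def)
        next
          case False
          then show ?thesis using uB[OF y] by (simp add: w_def)
        qed
        show "vsub \<Omega> \<nu> \<Omega> H (\<lambda>x. - \<kappa> * w x) w" unfolding w_def
        proof (rule vsub_bump[OF cu sub C1 \<delta>])
          show "\<psi> y \<le> u y" if "y \<in> C" for y
          proof -
            have "\<alpha> * norm (y - x\<^sub>0) ^ 2 \<ge> 0" using \<alpha> by simp
            then show ?thesis using \<psi>u[OF that] by linarith
          qed
          fix y assume y: "y \<in> C" "\<psi> y + h > u y"
          have "K y < - (g / 4)" using s\<^sub>1(2)[OF y(1)] close[OF y] s by linarith
          then show "- I ?B \<psi> y - I (- ?B) u y + H y (- F y) + h * (C\<^sub>1 * \<delta> powr (- \<sigma>)) \<le> - \<kappa> * (\<psi> y + h)"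
            using h(4) unfolding K_def M_def[symmetric] by (simp add: algebra_simps)
        qed (use h in simp)
      qed
      then have "w x\<^sub>0 \<le> u x\<^sub>0" using up x\<^sub>0 by blast
      then show False using h(1) \<psi>x\<^sub>0 by (simp add: w_def)
    qed
  qed
  show ?thesis
  proof (rule that[OF _ uL sub super])
    show "\<bar>\<kappa> * u x\<bar> \<le> Cb" if "x \<in> C" for x
    proof -
      have "\<kappa> * \<bar>u x\<bar> \<le> \<kappa> * B" using uB[OF that] \<kappa> by (intro mult_left_mono) auto
      then show ?thesis using B \<kappa> by (simp add: abs_mult)
    qed
  qed
qed

text \<open>
  Vanishing discount: the discounted solutions, normalised at a fixed point, are uniformly
  Lipschitz, and a limit of them solves the problem.
\<close>

lemma ergodic_solution:
  obtains c u where "state_constraint_solution \<Omega> \<nu> H c u"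
proof -
  obtain xs where xs: "xs \<in> C" using nonempty_C by (meson ex_in_conv)
  have "continuous_on C (\<lambda>x. H x 0)"
    by (rule continuous_hamiltonian[OF H_cont C1_with_gradient_on_const])
  then obtain xh where xh: "\<And>x. x \<in> C \<Longrightarrow> H x 0 \<le> H xh 0"
    using continuous_attains_sup[OF compact_C nonempty_C] by blast
  define Cb where "Cb = max C\<^sub>H (H xh 0)"
  have Cb: "Cb \<ge> C\<^sub>H" "\<And>x. x \<in> C \<Longrightarrow> H x 0 \<le> Cb" "Cb \<ge> 0"
    using xh C\<^sub>H by (auto simp: Cb_def le_max_iff_disj)
  define \<kappa> where "\<kappa> n = inverse (real (Suc n))" for n
  have \<kappa>: "\<kappa> n > 0" for n by (simp add: \<kappa>_def)
  have \<kappa>lim: "\<kappa> \<longlonglongrightarrow> 0" unfolding \<kappa>_def by (rule LIMSEQ_inverse_real_of_nat)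
  have "\<exists>u L. (\<forall>x\<in>C. \<bar>\<kappa> n * u x\<bar> \<le> Cb) \<and> (\<forall>x\<in>C. \<forall>y\<in>C. \<bar>u x - u y\<bar> \<le> L * norm (x - y)) \<and>
      vsub \<Omega> \<nu> \<Omega> H (\<lambda>x. - \<kappa> n * u x) u \<and>
      vsub \<Omega> \<nu> C (\<lambda>x p. - H x (- p)) (\<lambda>x. \<kappa> n * u x) (\<lambda>x. - u x)" for n
    using discounted_solution[OF \<kappa> Cb(1,2)] by metis
  then obtain u L where u: "\<And>n x. x \<in> C \<Longrightarrow> \<bar>\<kappa> n * u n x\<bar> \<le> Cb"
    "\<And>n x y. x \<in> C \<Longrightarrow> y \<in> C \<Longrightarrow> \<bar>u n x - u n y\<bar> \<le> L n * norm (x - y)"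
    "\<And>n. vsub \<Omega> \<nu> \<Omega> H (\<lambda>x. - \<kappa> n * u n x) (u n)"
    "\<And>n. vsub \<Omega> \<nu> C (\<lambda>x p. - H x (- p)) (\<lambda>x. \<kappa> n * u n x) (\<lambda>x. - u n x)"
    by metis
  \<comment> \<open>The constants \<open>L n\<close> may grow as the discount vanishes;
    \<open>L\<^sub>0\<close> depends only on the bound \<open>Cb\<close> for the right-hand
    sides.\<close>
  obtain L\<^sub>0 where L\<^sub>0: "L\<^sub>0 > 0"
    "\<And>u f L x y. vsub \<Omega> \<nu> \<Omega> H f u \<Longrightarrow> (\<And>x. x \<in> \<Omega> \<Longrightarrow> f x \<le> Cb) \<Longrightarrow>
      (\<And>x y. x \<in> C \<Longrightarrow> y \<in> C \<Longrightarrow> \<bar>u x - u y\<bar> \<le> L * norm (x - y)) \<Longrightarrow>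
      x \<in> C \<Longrightarrow> y \<in> C \<Longrightarrow> \<bar>u x - u y\<bar> \<le> L\<^sub>0 * norm (x - y)"
    using uniform_lipschitz_of_subsolution[OF Cb(3)] by blast
  have uL: "\<bar>u n x - u n y\<bar> \<le> L\<^sub>0 * norm (x - y)" if xy: "x \<in> C" "y \<in> C" for n x y
  proof (rule L\<^sub>0(2)[OF u(3) _ u(2) xy])
    show "- \<kappa> n * u n x \<le> Cb" if "x \<in> \<Omega>" for x
    proof -
      have "x \<in> C" using that \<Omega>_sub_C by blast
      then show ?thesis using u(1)[of x n] by linarith
    qed
  qed
  define w where "w n x = u n x - u n xs" for n x
  \<comment> \<open>A bounded sequence whose limit is the ergodic constant.\<close>
  define c where "c n = - \<kappa> n * u n xs" for n
  have wL: "\<bar>w n x - w n y\<bar> \<le> L\<^sub>0 * norm (x - y)" if "x \<in> C" "y \<in> C" for n x y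
    using uL[OF that] by (simp add: w_def)
  have wb: "\<bar>w n x\<bar> \<le> L\<^sub>0 * Dm" if "x \<in> C" for n x
  proof -
    have "L\<^sub>0 * norm (x - xs) \<le> L\<^sub>0 * Dm" using Dm(2)[OF that xs] L\<^sub>0(1) by (intro mult_left_mono) auto
    then show ?thesis using uL[OF that xs, of n] by (simp add: w_def)
  qed
  have cb: "\<bar>c n\<bar> \<le> Cb" for n using u(1)[OF xs, of n] by (simp add: c_def)
  have eqc: "- \<kappa> n * u n x = c n - \<kappa> n * w n x" for n x by (simp add: c_def w_def algebra_simps)
  have cw: "continuous_on C (w n)" for n
  proof (rule lipschitz_on_continuous_on)
    show "L\<^sub>0-lipschitz_on C (w n)" by (rule lipschitz_onI) (use wL L\<^sub>0(1) in \<open>auto simp: dist_norm\<close>)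
  qed
  obtain W r where W: "continuous_on C W" "strict_mono (r :: nat \<Rightarrow> nat)"
    "\<And>e. 0 < e \<Longrightarrow> \<exists>N. \<forall>n x. n \<ge> N \<and> x \<in> C \<longrightarrow> norm (w (r n) x - W x) < e"
  proof (rule Arzela_Ascoli[OF compact_C, of w "L\<^sub>0 * Dm"])
    show "norm (w n x) \<le> L\<^sub>0 * Dm" if "x \<in> C" for n x using wb[OF that] by simp
    show "\<exists>d>0. \<forall>n y. y \<in> C \<and> norm (x - y) < d \<longrightarrow> norm (w n x - w n y) < e"
      if x: "x \<in> C" and e: "0 < e" for x e
    proof (intro exI[of _ "e / L\<^sub>0"] conjI allI impI)
      show "0 < e / L\<^sub>0" using e L\<^sub>0(1) by simp
      fix n y assume y: "y \<in> C \<and> norm (x - y) < e / L\<^sub>0"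
      then have "L\<^sub>0 * norm (x - y) < e" using L\<^sub>0(1) by (simp add: field_simps)
      then show "norm (w n x - w n y) < e" using wL[OF x, of y n] y by simp
    qed
    fix g and k :: "nat \<Rightarrow> nat"
    assume "continuous_on C g" "strict_mono k"
      "\<And>e. 0 < e \<Longrightarrow> \<exists>N. \<forall>n x. n \<ge> N \<and> x \<in> C \<longrightarrow> norm (w (k n) x - g x) < e"
    then show thesis by (rule that)
  qed
  have "compact {- Cb..Cb}" by simp
  moreover have "\<forall>n. (c \<circ> r) n \<in> {- Cb..Cb}" using cb by (simp add: abs_le_iff minus_le_iff)
  ultimately obtain c\<^sub>0 r' where c\<^sub>0: "strict_mono (r' :: nat \<Rightarrow> nat)" "((c \<circ> r) \<circ> r') \<longlonglongrightarrow> c\<^sub>0"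
    unfolding compact_def by (metis (no_types, lifting))
  define k where "k n = r (r' n)" for n
  have k: "strict_mono k" using W(2) c\<^sub>0(1) by (simp add: k_def strict_mono_def)
  have clim: "(\<lambda>n. c (k n)) \<longlonglongrightarrow> c\<^sub>0" using c\<^sub>0(2) by (simp add: k_def o_def)
  \<comment> \<open>The normalised solutions are uniformly bounded, so the discount term disappears
    and the right-hand sides converge uniformly to a constant.\<close>
  have "(\<lambda>n. \<kappa> (k n) * (L\<^sub>0 * Dm)) \<longlonglongrightarrow> 0 * (L\<^sub>0 * Dm)"
    using LIMSEQ_subseq_LIMSEQ[OF \<kappa>lim k] by (intro tendsto_intros) (simp add: o_def)
  then have \<kappa>klim: "(\<lambda>n. \<kappa> (k n) * (L\<^sub>0 * Dm)) \<longlonglongrightarrow> 0" by simp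
  have approx: "\<exists>n. (\<forall>x\<in>C. \<bar>w n x - W x\<bar> < \<epsilon>) \<and> (\<forall>x\<in>C. \<bar>- \<kappa> n * u n x - c\<^sub>0\<bar> \<le> \<epsilon>)" if \<epsilon>: "\<epsilon> > 0" for \<epsilon>
  proof -
    obtain N where N: "\<And>n x. n \<ge> N \<Longrightarrow> x \<in> C \<Longrightarrow> norm (w (r n) x - W x) < \<epsilon>" using W(3)[OF \<epsilon>] by blast
    have "\<forall>\<^sub>F n in sequentially. dist (c (k n)) c\<^sub>0 < \<epsilon> / 2"
      using clim \<epsilon> by (intro tendstoD) auto
    moreover have "\<forall>\<^sub>F n in sequentially. \<kappa> (k n) * (L\<^sub>0 * Dm) < \<epsilon> / 2"
      using \<kappa>klim \<epsilon> by (intro order_tendstoD) auto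
    moreover have "\<forall>\<^sub>F n in sequentially. n \<ge> N" by (rule eventually_ge_at_top)
    ultimately have "\<forall>\<^sub>F n in sequentially. dist (c (k n)) c\<^sub>0 < \<epsilon> / 2 \<and> \<kappa> (k n) * (L\<^sub>0 * Dm) < \<epsilon> / 2 \<and> n \<ge> N"
      by eventually_elim simp
    then obtain n where n: "dist (c (k n)) c\<^sub>0 < \<epsilon> / 2" "\<kappa> (k n) * (L\<^sub>0 * Dm) < \<epsilon> / 2" "n \<ge> N"
      by (auto simp: eventually_sequentially)
    show ?thesis
    proof (intro exI[of _ "k n"] conjI ballI)
      fix x assume x: "x \<in> C"
      have "N \<le> r' n" using n(3) seq_suble[OF c\<^sub>0(1), of n] by linarith
      then show "\<bar>w (k n) x - W x\<bar> < \<epsilon>" using N[OF _ x] by (simp add: k_def)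
      have "\<bar>\<kappa> (k n) * w (k n) x\<bar> \<le> \<kappa> (k n) * (L\<^sub>0 * Dm)"
        using wb[OF x] \<kappa>[of "k n"] by (simp add: abs_mult mult_left_mono)
      then show "\<bar>- \<kappa> (k n) * u (k n) x - c\<^sub>0\<bar> \<le> \<epsilon>"
        using n(1,2) unfolding eqc dist_real_def by linarith
    qed
  qed
  have "vsub \<Omega> \<nu> \<Omega> H (\<lambda>_. c\<^sub>0) W"
  proof (rule vsub_stable[OF H_cont \<Omega>_sub_C _ W(1), where K=0])
    show "\<exists>s>0. ball x s \<inter> C \<subseteq> \<Omega>" if "x \<in> \<Omega>" for x
      using open_\<Omega> that openE by (metis inf.coboundedI1)
    fix x\<^sub>0 and \<epsilon> :: real assume x\<^sub>0: "x\<^sub>0 \<in> \<Omega>" and \<epsilon>: "\<epsilon> > 0"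
    obtain n where n: "\<And>x. x \<in> C \<Longrightarrow> \<bar>w n x - W x\<bar> < \<epsilon>" "\<And>x. x \<in> C \<Longrightarrow> \<bar>- \<kappa> n * u n x - c\<^sub>0\<bar> \<le> \<epsilon>"
      using approx[OF \<epsilon>] by blast
    show "\<exists>v g. continuous_on C v \<and> vsub \<Omega> \<nu> \<Omega> H g v \<and> (\<forall>x\<in>C. v x \<le> W x + \<epsilon>) \<and>
        W x\<^sub>0 - \<epsilon> \<le> v x\<^sub>0 \<and> (\<forall>x\<in>C. g x \<le> c\<^sub>0 + 0 * \<bar>W x - v x\<bar> + \<epsilon>)"
    proof (rule exI[of _ "w n"], rule exI[of _ "\<lambda>x. - \<kappa> n * u n x"], intro conjI ballI cw)
      \<comment> \<open>Normalising shifts the function but leaves the right-hand side in terms of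
        \<open>u n\<close>.\<close>
      show "vsub \<Omega> \<nu> \<Omega> H (\<lambda>x. - \<kappa> n * u n x) (w n)"
        using vsub_add_const[OF u(3)[of n], of "- u n xs"] by (simp add: w_def[abs_def])
      have "x\<^sub>0 \<in> C" using x\<^sub>0 \<Omega>_sub_C by blast
      then show "W x\<^sub>0 - \<epsilon> \<le> w n x\<^sub>0" using n(1)[of x\<^sub>0] by linarith
      fix x assume x: "x \<in> C"
      show "w n x \<le> W x + \<epsilon>" using n(1)[OF x] by linarith
      show "- \<kappa> n * u n x \<le> c\<^sub>0 + 0 * \<bar>W x - w n x\<bar> + \<epsilon>" using n(2)[OF x] by linarith
    qed
  qed auto
  moreover have "vsub \<Omega> \<nu> C (\<lambda>x p. - H x (- p)) (\<lambda>_. - c\<^sub>0) (\<lambda>x. - W x)"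
  proof (rule vsub_stable[OF _ order_refl, where K=0])
    have "continuous_on (C \<times> UNIV) (\<lambda>z. - (case (fst z, - snd z) of (x, p) \<Rightarrow> H x p))"
      by (intro continuous_intros continuous_on_compose2[OF H_cont]) auto
    then show "continuous_on (C \<times> UNIV) (\<lambda>(x, p). - H x (- p))" by (simp add: case_prod_beta)
    show "continuous_on C (\<lambda>x. - W x)" using W(1) by (intro continuous_intros)
    show "\<exists>s>0. ball x s \<inter> C \<subseteq> C" for x by (intro exI[of _ 1]) auto
    fix x\<^sub>0 and \<epsilon> :: real assume x\<^sub>0: "x\<^sub>0 \<in> C" and \<epsilon>: "\<epsilon> > 0"
    obtain n where n: "\<And>x. x \<in> C \<Longrightarrow> \<bar>w n x - W x\<bar> < \<epsilon>" "\<And>x. x \<in> C \<Longrightarrow> \<bar>- \<kappa> n * u n x - c\<^sub>0\<bar> \<le> \<epsilon>"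
      using approx[OF \<epsilon>] by blast
    show "\<exists>v g. continuous_on C v \<and> vsub \<Omega> \<nu> C (\<lambda>x p. - H x (- p)) g v \<and> (\<forall>x\<in>C. v x \<le> - W x + \<epsilon>) \<and>
        - W x\<^sub>0 - \<epsilon> \<le> v x\<^sub>0 \<and> (\<forall>x\<in>C. g x \<le> - c\<^sub>0 + 0 * \<bar>- W x - v x\<bar> + \<epsilon>)"
    proof (rule exI[of _ "\<lambda>x. - w n x"], rule exI[of _ "\<lambda>x. \<kappa> n * u n x"], intro conjI ballI)
      show "continuous_on C (\<lambda>x. - w n x)" using cw by (intro continuous_intros)
      show "vsub \<Omega> \<nu> C (\<lambda>x p. - H x (- p)) (\<lambda>x. \<kappa> n * u n x) (\<lambda>x. - w n x)"
        using vsub_add_const[OF u(4)[of n], of "u n xs"] by (simp add: w_def)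
      show "- W x\<^sub>0 - \<epsilon> \<le> - w n x\<^sub>0" using n(1)[OF x\<^sub>0] by linarith
      fix x assume x: "x \<in> C"
      show "- w n x \<le> - W x + \<epsilon>" using n(1)[OF x] by linarith
      show "\<kappa> n * u n x \<le> - c\<^sub>0 + 0 * \<bar>- W x - - w n x\<bar> + \<epsilon>" using n(2)[OF x] by linarith
    qed
  qed auto
  ultimately have "state_constraint_solution \<Omega> \<nu> H c\<^sub>0 W"
    unfolding state_constraint_solution_def viscosity_subsolution_iff_vsub
      viscosity_supersolution_iff_vsub using W(1) by blast
  then show ?thesis by (rule that)
qed

section \<open>Regularity of arbitrary solutions and uniqueness of the constant\<close>

lemma solution_lipschitz:
  assumes "state_constraint_solution \<Omega> \<nu> H c u"
  obtains L where "L > 0" "\<And>x y. x \<in> C \<Longrightarrow> y \<in> C \<Longrightarrow> \<bar>u x - u y\<bar> \<le> L * norm (x - y)"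
proof -
  have cu: "continuous_on C u" and sub: "vsub \<Omega> \<nu> \<Omega> H (\<lambda>_. c) u"
    using assms unfolding state_constraint_solution_def viscosity_subsolution_iff_vsub by auto
  have "bounded (u ` C)" by (intro compact_imp_bounded compact_continuous_image cu compact_C)
  then obtain B where B: "B > 0" "\<And>x. x \<in> C \<Longrightarrow> \<bar>u x\<bar> \<le> B"
    by (metis bounded_pos imageI real_norm_def)
  obtain L where "L > 0" "\<And>u f x y. continuous_on C u \<Longrightarrow> (\<And>x. x \<in> C \<Longrightarrow> \<bar>u x\<bar> \<le> B) \<Longrightarrow>
      (\<And>x. x \<in> \<Omega> \<Longrightarrow> f x \<le> \<bar>c\<bar>) \<Longrightarrow> vsub \<Omega> \<nu> \<Omega> H f u \<Longrightarrow> x \<in> C \<Longrightarrow> y \<in> C \<Longrightarrow>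
      \<bar>u x - u y\<bar> \<le> L * norm (x - y)"
    using lipschitz_of_subsolution[of B "\<bar>c\<bar>"] B(1) by (metis abs_ge_zero less_imp_le)
  from this(1) this(2)[OF cu B(2) _ sub] show ?thesis by (intro that[of L]) auto
qed

text \<open>The first solution acts as Lipschitz subsolution, the second as supersolution;
  exchanging the roles yields uniqueness.\<close>

lemma solution_constant_le:
  assumes "state_constraint_solution \<Omega> \<nu> H c\<^sub>1 u\<^sub>1" "state_constraint_solution \<Omega> \<nu> H c\<^sub>2 u\<^sub>2"
  shows "c\<^sub>2 \<le> c\<^sub>1"
proof -
  obtain L where "L > 0" "\<And>x y. x \<in> C \<Longrightarrow> y \<in> C \<Longrightarrow> \<bar>u\<^sub>1 x - u\<^sub>1 y\<bar> \<le> L * norm (x - y)"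
    using solution_lipschitz[OF assms(1)] by blast
  then show ?thesis
    using assms subsolution_constant_ge[OF H_cont, of u\<^sub>1 u\<^sub>2 L c\<^sub>1 c\<^sub>2]
    unfolding state_constraint_solution_def by blast
qed

end

theorem proposition5p1:
  fixes \<Omega> :: "'a::euclidean_space set"
    and \<nu> :: "'a \<Rightarrow> 'a measure"
    and H\<^sub>0 :: "'a \<Rightarrow> 'a \<Rightarrow> real"
    and \<sigma> m :: real
  assumes "C1_domain \<Omega>" and "bounded \<Omega>"
    and "0 < \<sigma>" and "\<sigma> < 1"
    and "\<And>x. x \<in> closure \<Omega> \<Longrightarrow> regular_jump_measure (\<nu> x)"
    and "cond_M0 \<Omega> \<nu>" and "cond_M1 \<Omega> \<nu> \<sigma>" and "cond_M2 \<Omega> \<nu> \<sigma>" and "cond_M3 \<Omega> \<nu> \<sigma>"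
    and "continuous_on (closure \<Omega> \<times> UNIV) (\<lambda>(x, p). H\<^sub>0 x p)"
    and "m > 1" and "cond_H2 \<Omega> H\<^sub>0 m"
  shows "\<exists>c. (\<exists>u. state_constraint_solution \<Omega> \<nu> H\<^sub>0 c u \<and> (\<exists>L. L-lipschitz_on (closure \<Omega>) u)) \<and>
             (\<forall>c'. (\<exists>u. state_constraint_solution \<Omega> \<nu> H\<^sub>0 c' u) \<longrightarrow> c' = c)"
proof -
  have \<Omega>: "open \<Omega>" "connected \<Omega>" "\<Omega> \<noteq> {}" "C1_boundary \<Omega>"
    using assms(1) unfolding C1_domain_def by auto
  obtain \<rho> where \<rho>: "0 < \<rho>" "\<rho> \<le> 1" "uniform_cone \<Omega> \<rho>"
    using C1_boundary_imp_uniform_cone[OF \<Omega>(4,1) assms(2)] by blast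
  obtain C\<^sub>1 where C\<^sub>1: "C\<^sub>1 > 0" "\<forall>\<beta>\<in>{0..2}. \<forall>\<delta>>0.
      (SUP x\<in>closure \<Omega>. \<integral>\<^sup>+z\<in>- ball 0 \<delta>. ennreal (min 1 (norm z powr \<beta>)) \<partial>\<nu> x)
          \<le> ennreal (C\<^sub>1 * h_fun \<beta> \<sigma> \<delta>)"
    using assms(7) unfolding cond_M1_def by blast
  obtain C\<^sub>2 where C\<^sub>2: "C\<^sub>2 > 0" "\<forall>\<beta>\<in>{\<sigma><..2}. \<forall>\<delta>\<in>{0<..<1}.
      (SUP x\<in>closure \<Omega>. \<integral>\<^sup>+z\<in>ball 0 \<delta>. ennreal (norm z powr \<beta>) \<partial>\<nu> x)
          \<le> ennreal (C\<^sub>2 * \<delta> powr (\<beta> - \<sigma>))"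
    using assms(8) unfolding cond_M2_def by blast
  obtain c\<^sub>H C\<^sub>H where H: "c\<^sub>H > 0" "C\<^sub>H \<ge> 0"
    "\<And>x p. x \<in> closure \<Omega> \<Longrightarrow> H\<^sub>0 x p \<ge> c\<^sub>H * norm p powr m - C\<^sub>H"
    using assms(12) unfolding cond_H2_def by blast
  interpret coercive_setting \<Omega> \<nu> \<sigma> C\<^sub>1 C\<^sub>2 \<rho> H\<^sub>0 m c\<^sub>H C\<^sub>H
  proof unfold_locales
    show "sets (\<nu> x) = sets borel" if "x \<in> closure \<Omega>" for x
      using assms(5)[OF that] unfolding regular_jump_measure_def by blast
    show "(\<integral>\<^sup>+z\<in>- ball 0 \<delta>. ennreal (min 1 (norm z powr \<beta>)) \<partial>\<nu> x) \<le> ennreal (C\<^sub>1 * h_fun \<beta> \<sigma> \<delta>)"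
      if "x \<in> closure \<Omega>" "0 \<le> \<beta>" "\<beta> \<le> 2" "0 < \<delta>" for x \<beta> \<delta>
      using SUP_upper[OF that(1)] C\<^sub>1(2) that by (force intro: order_trans)
    show "(\<integral>\<^sup>+z\<in>ball 0 \<delta>. ennreal (norm z) \<partial>\<nu> x) \<le> ennreal (C\<^sub>2 * \<delta> powr (1 - \<sigma>))"
      if x: "x \<in> closure \<Omega>" and \<delta>: "0 < \<delta>" "\<delta> < 1" for x \<delta>
    proof -
      have "(\<integral>\<^sup>+z\<in>ball 0 \<delta>. ennreal (norm z powr 1) \<partial>\<nu> x)
          \<le> (SUP x\<in>closure \<Omega>. \<integral>\<^sup>+z\<in>ball 0 \<delta>. ennreal (norm z powr 1) \<partial>\<nu> x)"
        using x by (rule SUP_upper)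
      also have "\<dots> \<le> ennreal (C\<^sub>2 * \<delta> powr (1 - \<sigma>))" using C\<^sub>2(2)[rule_format, of 1 \<delta>] \<delta> assms(3,4) by simp
      finally show ?thesis by simp
    qed
  qed (use \<Omega> \<rho> C\<^sub>1 C\<^sub>2 H assms in auto)
  obtain c u where sol: "state_constraint_solution \<Omega> \<nu> H\<^sub>0 c u" using ergodic_solution by blast
  obtain L where L: "L > 0" "\<And>x y. x \<in> C \<Longrightarrow> y \<in> C \<Longrightarrow> \<bar>u x - u y\<bar> \<le> L * norm (x - y)"
    using solution_lipschitz[OF sol] by blast
  have "L-lipschitz_on C u" by (rule lipschitz_onI) (use L in \<open>auto simp: dist_norm\<close>)
  moreover have "c' = c" if "state_constraint_solution \<Omega> \<nu> H\<^sub>0 c' v" for c' v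
    using solution_constant_le[OF sol that] solution_constant_le[OF that sol] by linarith
  ultimately show ?thesis using sol by blast
qed

end
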